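(* Let $k$ be an algebraically closed field and let $R$ be a one-dimensional affine (i.e. finitely generated) $k$-algebra. Let $n \ge 1$, let $a$ be a non-zerodivisor in $R$, and let $P = P(Z_1,\dots,Z_n)$ be an element of the polynomial ring $R[Z_1,\dots,Z_n]$ in $n$ variables over $R$ such that the image of $P$ in $\frac{R}{aR}[Z_1,\dots,Z_n]$ is a coordinate in $\frac{R}{aR}[Z_1,\dots,Z_n]$ (over $R/aR$). If $R_{red}$ is seminormal or if the characteristic of $k$ is zero, then the polynomial $F := aW + P$ is a coordinate in the polynomial ring $R[Z_1,\dots,Z_n,W]$ in $n+1$ variables over $R$.
   Context: All rings are commutative with unity. $R_{red}$ denotes $R/\mathrm{nil}(R)$, the quotient of $R$ by its nilradical. A reduced ring $R$ is called seminormal if for all $b,c\in R$ with $b^3=c^2$ there is an $a\in R$ such that $a^2=b$ and $a^3=c$. For a ring $R$ and a polynomial ring $A=R[X_1,\dots,X_m]$ in $m$ variables, an element $F\in A$ is called a coordinate in $A$ (over $R$) if there exist $F_2,\dots,F_m\in A$ such that $A=R[F,F_2,\dots,F_m]$. *)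

theory Defs
  imports
    "HOL-Algebra.Module"
    "HOL-Algebra.QuotRing"
    "HOL-Algebra.Generated_Rings"
    "HOL-Algebra.Indexed_Polynomials"
    "HOL-Algebra.Algebraic_Closure"
    "HOL-Library.Extended_Real"
begin

text \<open>The library provides the elements, sum, constants and variables of polynomials on indexed
  letters (functions from monomials, i.e. multisets of letters, to coefficients), but not their
  product. The polynomial ring in \<open>m\<close> variables has the letters \<open>0, \<dots>, m - 1\<close>, so that the ring
  in \<open>m\<close> variables is literally a subset of the one in \<open>m + 1\<close> variables, whose new variable is
  the letter \<open>m\<close>.\<close>

definition mpoly_mult ::
  "('a, 'b) ring_scheme \<Rightarrow> (nat multiset \<Rightarrow> 'a) \<Rightarrow> (nat multiset \<Rightarrow> 'a) \<Rightarrow> nat multiset \<Rightarrow> 'a"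
  where "mpoly_mult R P Q = (\<lambda>u. \<Oplus>\<^bsub>R\<^esub>v \<in> {v. v \<subseteq># u}. P v \<otimes>\<^bsub>R\<^esub> Q (u - v))"

definition mpoly_ring :: "('a, 'b) ring_scheme \<Rightarrow> nat \<Rightarrow> (nat multiset \<Rightarrow> 'a) ring"
  where "mpoly_ring R m =
    \<lparr>carrier = ring.indexed_pset R {..<m} (carrier R),
     monoid.mult = mpoly_mult R,
     one = ring.indexed_const R \<one>\<^bsub>R\<^esub>,
     zero = ring.indexed_const R \<zero>\<^bsub>R\<^esub>,
     add = ring.indexed_padd R\<rparr>"

definition mpoly_image :: "('a, 'b) ring_scheme \<Rightarrow> 'a set \<Rightarrow> (nat multiset \<Rightarrow> 'a) \<Rightarrow> nat multiset \<Rightarrow> 'a set"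
  where "mpoly_image R I P = (\<lambda>u. I +>\<^bsub>R\<^esub> P u)"

definition is_coordinate :: "('a, 'b) ring_scheme \<Rightarrow> nat \<Rightarrow> (nat multiset \<Rightarrow> 'a) \<Rightarrow> bool"
  where "is_coordinate R m F \<longleftrightarrow>
    m \<ge> 1 \<and> F \<in> carrier (mpoly_ring R m) \<and>
    (\<exists>G :: nat \<Rightarrow> nat multiset \<Rightarrow> 'a. G ` {2..m} \<subseteq> carrier (mpoly_ring R m) \<and>
      carrier (mpoly_ring R m) =
        generate_ring (mpoly_ring R m)
          (ring.indexed_const R ` carrier R \<union> insert F (G ` {2..m})))"

definition fin_gen_algebra :: "('k, 'c) ring_scheme \<Rightarrow> ('k, 'a, 'b) module_scheme \<Rightarrow> bool"
  where "fin_gen_algebra k R \<longleftrightarrow> algebra k R \<and>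
    (\<exists>S. finite S \<and> S \<subseteq> carrier R \<and>
      carrier R = generate_ring R ((\<lambda>c. c \<odot>\<^bsub>R\<^esub> \<one>\<^bsub>R\<^esub>) ` carrier k \<union> S))"

text \<open>Supremum of the lengths of strict chains of prime ideals; it is \<open>-\<infinity>\<close> for the zero ring.\<close>

definition krull_dim :: "('a, 'b) ring_scheme \<Rightarrow> ereal"
  where "krull_dim R = Sup {ereal (real d) | d.
    \<exists>C :: nat \<Rightarrow> 'a set. (\<forall>i\<le>d. primeideal (C i) R) \<and> (\<forall>i<d. C i \<subset> C (Suc i))}"

definition ring_char :: "('a, 'b) ring_scheme \<Rightarrow> nat"
  where "ring_char R =
    (if \<exists>m::nat. m > 0 \<and> [m] \<cdot>\<^bsub>R\<^esub> \<one>\<^bsub>R\<^esub> = \<zero>\<^bsub>R\<^esub>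
     then LEAST m::nat. m > 0 \<and> [m] \<cdot>\<^bsub>R\<^esub> \<one>\<^bsub>R\<^esub> = \<zero>\<^bsub>R\<^esub> else 0)"

definition non_zerodivisor :: "('a, 'b) ring_scheme \<Rightarrow> 'a \<Rightarrow> bool"
  where "non_zerodivisor R a \<longleftrightarrow>
    a \<in> carrier R \<and> (\<forall>x \<in> carrier R. a \<otimes>\<^bsub>R\<^esub> x = \<zero>\<^bsub>R\<^esub> \<longrightarrow> x = \<zero>\<^bsub>R\<^esub>)"

definition nilradical :: "('a, 'b) ring_scheme \<Rightarrow> 'a set"
  where "nilradical R = {x \<in> carrier R. \<exists>n::nat. x [^]\<^bsub>R\<^esub> n = \<zero>\<^bsub>R\<^esub>}"

definition red_ring :: "('a, 'b) ring_scheme \<Rightarrow> 'a set ring"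
  where "red_ring R = R Quot nilradical R"

definition reduced_ring :: "('a, 'b) ring_scheme \<Rightarrow> bool"
  where "reduced_ring R \<longleftrightarrow> cring R \<and> nilradical R = {\<zero>\<^bsub>R\<^esub>}"

definition seminormal_ring :: "('a, 'b) ring_scheme \<Rightarrow> bool"
  where "seminormal_ring R \<longleftrightarrow> reduced_ring R \<and>
    (\<forall>b \<in> carrier R. \<forall>c \<in> carrier R. b [^]\<^bsub>R\<^esub> (3::nat) = c [^]\<^bsub>R\<^esub> (2::nat) \<longrightarrow>
      (\<exists>a \<in> carrier R. a [^]\<^bsub>R\<^esub> (2::nat) = b \<and> a [^]\<^bsub>R\<^esub> (3::nat) = c))"

end

theory Submission
  imports Defs "HOL-Algebra.UnivPoly"
begin

text \<open>Only finitely many \<open>k\<close>-points \<open>\<chi>\<close> of \<open>R\<close> kill \<open>a\<close>, because \<open>R\<close> is one-dimensional; and an element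
  vanishing at all of them is nilpotent modulo \<open>a\<close>. At each such \<open>\<chi>\<close> the image of \<open>P\<close> is an affine
  combination of a coordinate system \<open>\<gamma>\<close> that is tangent to the identity at the origin. Such a \<open>\<gamma>\<close>
  is joined to the identity by the path \<open>\<gamma>(cZ)/c\<close>, and putting for \<open>c\<close> an element of \<open>R\<close> that is \<open>1\<close>
  at \<open>\<chi>\<close> and \<open>0\<close> at the other points lifts \<open>\<gamma>\<close> to an automorphism of \<open>R[Z]\<close>. Composing these, one may
  assume that \<open>P\<close> is affine modulo \<open>a\<close> and nilpotents, and after a shear that the coefficient of
  \<open>Z\<^sub>0\<close> is a unit modulo \<open>a\<close>. A fixed point iteration then gives \<open>h\<close> such that, modulo \<open>a\<close>, the maps
  \<open>Z\<^sub>0 \<mapsto> P\<close> and \<open>Z\<^sub>0 \<mapsto> h\<close> are inverse to each other. Hence \<open>Z\<^sub>0 - h(F, Z\<^sub>1, \<dots>)\<close> is a multiple \<open>a H\<close>,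
  and \<open>F, H, Z\<^sub>1, \<dots>\<close> generate \<open>R[Z, W]\<close>, as \<open>a\<close> can be cancelled when \<open>W\<close> is expressed by them.\<close>

section \<open>Polynomial rings\<close>

text \<open>The obstacle is that data given at the points have to be lifted to \<open>R\<close>
  itself. There are separating elements but in general no idempotents, so an automorphism that is
  prescribed at one point and trivial at the others cannot be cut out by a projection; a family of
  automorphisms polynomial in a parameter, however, can be evaluated at any ring element. Rescaling
  leads to the identity only for systems with identity linear part, since
  \<open>\<gamma>(cZ)/c\<close> at \<open>c = 0\<close> is the linear part. Translations and linear
  parts are therefore not lifted: an interpolated matrix that is invertible at every point is
  invertible modulo \<open>a\<close> but need not be so over \<open>R\<close>. They stay in
  \<open>P\<close> as coefficients of its affine form, where a single unit modulo \<open>a\<close>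
  suffices. The non-zero coefficient may sit at different variables for different points, which the
  shear repairs. Nilpotents modulo \<open>a\<close> remain and are the reason for an iteration in
  place of a division. That \<open>a\<close> is a non-zerodivisor also enters in the count of
  points: primes containing it are not minimal.\<close>

lemma finite_submultisets: "finite {v. v \<subseteq># u}"
proof (induction u)
  case (add x u)
  have "v \<in> {v. v \<subseteq># u} \<union> add_mset x ` {v. v \<subseteq># u}" if "v \<subseteq># add_mset x u" for v
  proof (cases "x \<in># v")
    case True
    then have "v = add_mset x (v - {#x#})" by simp
    moreover have "v - {#x#} \<subseteq># u" using that by (simp add: subset_eq_diff_conv)
    ultimately show ?thesis by blast
  next
    case False
    then have "v \<subseteq># u" using that by (metis diff_single_trivial subset_eq_diff_conv add_mset_add_single)
    then show ?thesis by blast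
  qed
  then have "{v. v \<subseteq># add_mset x u} \<subseteq> {v. v \<subseteq># u} \<union> add_mset x ` {v. v \<subseteq># u}" by blast
  then show ?case using add by (meson finite_UnI finite_imageI finite_subset)
qed auto

lemma mpoly_ring_simps:
  "carrier (mpoly_ring R m) = ring.indexed_pset R {..<m} (carrier R)"
  "x \<otimes>\<^bsub>mpoly_ring R m\<^esub> y = mpoly_mult R x y"
  "\<one>\<^bsub>mpoly_ring R m\<^esub> = ring.indexed_const R \<one>\<^bsub>R\<^esub>"
  "\<zero>\<^bsub>mpoly_ring R m\<^esub> = ring.indexed_const R \<zero>\<^bsub>R\<^esub>"
  "x \<oplus>\<^bsub>mpoly_ring R m\<^esub> y = ring.indexed_padd R x y"
  by (simp_all add: mpoly_ring_def)

context cring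
begin

lemma mpoly_multE:
  "mpoly_mult R P Q u = (\<Oplus>v\<in>{v. v \<subseteq># u}. P v \<otimes> Q (u - v))"
  by (simp add: mpoly_mult_def)

lemma mpoly_mult_coeff:
  assumes "carrier_coeff P" "carrier_coeff Q"
  shows "carrier_coeff (mpoly_mult R P Q)"
  using assms unfolding carrier_coeff_def by (auto simp: mpoly_multE intro!: finsum_closed)

text \<open>Complementation \<open>v \<mapsto> u - v\<close> is an involution of the submultisets of
  \<open>u\<close> and exchanges the two factors of each summand.\<close>

lemma mpoly_mult_comm:
  assumes "carrier_coeff P" "carrier_coeff Q"
  shows "mpoly_mult R P Q = mpoly_mult R Q P"
proof
  fix u :: "nat multiset"
  have inj: "inj_on (\<lambda>v. u - v) {v. v \<subseteq># u}"
  proof (rule inj_onI)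
    fix v w assume v: "v \<in> {v. v \<subseteq># u}" "w \<in> {v. v \<subseteq># u}" and eq: "u - v = u - w"
    have "u - (u - v) = v" "u - (u - w) = w"
      using v by (auto simp: multiset_eq_iff subseteq_mset_def)
    then show "v = w" using eq by metis
  qed
  have img: "(\<lambda>v. u - v) ` {v. v \<subseteq># u} = {v. v \<subseteq># u}"
  proof
    show "{v. v \<subseteq># u} \<subseteq> (\<lambda>v. u - v) ` {v. v \<subseteq># u}"
    proof
      fix v assume "v \<in> {v. v \<subseteq># u}"
      then have "v = u - (u - v)" "u - v \<subseteq># u"
        by (auto simp: multiset_eq_iff subseteq_mset_def)
      then show "v \<in> (\<lambda>v. u - v) ` {v. v \<subseteq># u}" by blast
    qed
  qed auto
  have c: "P v \<in> carrier R" "Q v \<in> carrier R" for v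
    using assms by (auto simp: carrier_coeff_def)
  have "mpoly_mult R P Q u = (\<Oplus>v\<in>(\<lambda>v. u - v) ` {v. v \<subseteq># u}. P v \<otimes> Q (u - v))"
    unfolding img by (simp add: mpoly_multE)
  also have "\<dots> = (\<Oplus>v\<in>{v. v \<subseteq># u}. P (u - v) \<otimes> Q (u - (u - v)))"
    by (rule finsum_reindex[OF _ inj]) (auto simp: c)
  also have "\<dots> = (\<Oplus>v\<in>{v. v \<subseteq># u}. Q v \<otimes> P (u - v))"
  proof (rule finsum_cong')
    fix v assume "v \<in> {v. v \<subseteq># u}"
    then have "u - (u - v) = v" by (auto simp: multiset_eq_iff subseteq_mset_def)
    then show "P (u - v) \<otimes> Q (u - (u - v)) = Q v \<otimes> P (u - v)"
      by (simp add: c m_comm)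
  qed (auto simp: c)
  finally show "mpoly_mult R P Q u = mpoly_mult R Q P u" by (simp add: mpoly_multE)
qed

text \<open>With this rule and the next two, one for each way of building a polynomial, facts about
  products follow by induction on the left factor.\<close>

lemma mpoly_mult_const:
  assumes "c \<in> carrier R" "carrier_coeff Q"
  shows "mpoly_mult R (indexed_const c) Q = (\<lambda>u. c \<otimes> Q u)"
proof
  fix u
  have c: "Q v \<in> carrier R" for v
    using assms by (auto simp: carrier_coeff_def)
  have "mpoly_mult R (indexed_const c) Q u
      = (\<Oplus>v\<in>{v. v \<subseteq># u}. if {#} = v then c \<otimes> Q (u - v) else \<zero>)"
    unfolding mpoly_multE indexed_const_def by (rule finsum_cong') (auto simp: c assms)
  also have "\<dots> = c \<otimes> Q (u - {#})"
    by (rule finsum_singleton) (auto simp: c assms finite_submultisets)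
  finally show "mpoly_mult R (indexed_const c) Q u = c \<otimes> Q u" by simp
qed

lemma mpoly_mult_padd:
  assumes "carrier_coeff P" "carrier_coeff P'" "carrier_coeff Q"
  shows "mpoly_mult R (indexed_padd P P') Q = indexed_padd (mpoly_mult R P Q) (mpoly_mult R P' Q)"
proof
  fix u
  have c: "P v \<in> carrier R" "P' v \<in> carrier R" "Q v \<in> carrier R" for v
    using assms by (auto simp: carrier_coeff_def)
  show "mpoly_mult R (indexed_padd P P') Q u
      = indexed_padd (mpoly_mult R P Q) (mpoly_mult R P' Q) u"
    unfolding indexed_padd_def mpoly_multE
    by (subst finsum_addf[symmetric]) (auto simp: c l_distr)
qed

text \<open>The submultisets of \<open>u\<close> that contain \<open>i\<close> are the
  \<open>add_mset i v\<close> with \<open>v\<close> inside \<open>u - {#i#}\<close>; at all others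
  the shifted factor has coefficient zero.\<close>

lemma mpoly_mult_pmult:
  assumes "carrier_coeff P" "carrier_coeff Q"
  shows "mpoly_mult R (indexed_pmult P i) Q = indexed_pmult (mpoly_mult R P Q) i"
proof
  fix u
  have c: "P v \<in> carrier R" "Q v \<in> carrier R" for v
    using assms by (auto simp: carrier_coeff_def)
  show "mpoly_mult R (indexed_pmult P i) Q u = indexed_pmult (mpoly_mult R P Q) i u"
  proof (cases "i \<in># u")
    case False
    then have "i \<notin># v" if "v \<subseteq># u" for v using that by (meson mset_subset_eqD)
    then have "mpoly_mult R (indexed_pmult P i) Q u = (\<Oplus>v\<in>{v. v \<subseteq># u}. \<zero>)"
      unfolding mpoly_multE indexed_pmult_def by (intro finsum_cong') (auto simp: c)
    then show ?thesis using False by (simp add: indexed_pmult_def)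
  next
    case True
    define w where "w = u - {#i#}"
    have u: "u = add_mset i w" using True by (simp add: w_def)
    have "indexed_pmult (mpoly_mult R P Q) i u = (\<Oplus>v\<in>{v. v \<subseteq># w}. P v \<otimes> Q (w - v))"
      using True by (simp add: indexed_pmult_def mpoly_multE w_def)
    also have "\<dots> = (\<Oplus>v\<in>{v. v \<subseteq># w}. indexed_pmult P i (add_mset i v) \<otimes> Q (u - add_mset i v))"
      by (rule finsum_cong') (auto simp: c u indexed_pmult_def)
    also have "\<dots> = (\<Oplus>v\<in>add_mset i ` {v. v \<subseteq># w}. indexed_pmult P i v \<otimes> Q (u - v))"
      by (rule finsum_reindex[symmetric]) (auto simp: c indexed_pmult_def inj_on_def)
    also have "\<dots> = (\<Oplus>v\<in>{v. v \<subseteq># u}. indexed_pmult P i v \<otimes> Q (u - v))"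
    proof (rule add.finprod_mono_neutral_cong_left[OF finite_submultisets])
      show "add_mset i ` {v. v \<subseteq># w} \<subseteq> {v. v \<subseteq># u}" by (auto simp: u)
    next
      fix v assume v: "v \<in> {v. v \<subseteq># u} - add_mset i ` {v. v \<subseteq># w}"
      have "i \<notin># v"
      proof
        assume i: "i \<in># v"
        then have "v = add_mset i (v - {#i#})" by simp
        moreover have "v - {#i#} \<subseteq># w" using v by (simp add: u subset_eq_diff_conv)
        ultimately show False using v by blast
      qed
      then show "indexed_pmult P i v \<otimes> Q (u - v) = \<zero>" by (simp add: indexed_pmult_def c)
    qed (auto simp: c indexed_pmult_def)
    finally show ?thesis by (simp add: mpoly_multE)
  qed
qed

abbreviation "polys I \<equiv> indexed_pset I (carrier R)"

lemma polys_coeff: "P \<in> polys I \<Longrightarrow> carrier_coeff P"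
  using indexed_pset_in_carrier by blast

lemma polys_closed: "P \<in> polys I \<Longrightarrow> P u \<in> carrier R"
  using polys_coeff carrier_coeffE by blast

lemma polys_mono: "P \<in> polys I \<Longrightarrow> I \<subseteq> J \<Longrightarrow> P \<in> polys J"
  by (induction rule: indexed_pset.induct) (auto intro: indexed_pset.intros)

lemma polys_finite_support: "P \<in> polys I \<Longrightarrow> finite {u. P u \<noteq> \<zero>}"
proof (induction rule: indexed_pset.induct)
  case (indexed_const k)
  show ?case by (rule finite_subset[of _ "{{#}}"]) (auto simp: indexed_const_def split: if_splits)
next
  case (indexed_padd P Q)
  show ?case
    by (rule finite_subset[of _ "{u. P u \<noteq> \<zero>} \<union> {u. Q u \<noteq> \<zero>}"])
      (use indexed_padd in \<open>auto simp: indexed_padd_def\<close>)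
next
  case (indexed_pmult P i)
  show ?case
  proof (rule finite_subset)
    show "{u. (P \<Otimes> i) u \<noteq> \<zero>} \<subseteq> add_mset i ` {u. P u \<noteq> \<zero>}"
      by (auto simp: indexed_pmult_def image_iff split: if_splits) (metis insert_DiffM)
  qed (use indexed_pmult in simp)
qed

lemma polys_support: "P \<in> polys I \<Longrightarrow> P u \<noteq> \<zero> \<Longrightarrow> set_mset u \<subseteq> I"
proof (induction arbitrary: u rule: indexed_pset.induct)
  case (indexed_padd P Q)
  then have "P u \<noteq> \<zero> \<or> Q u \<noteq> \<zero>" by (auto simp: indexed_padd_def)
  with indexed_padd show ?case by blast
next
  case (indexed_pmult P i)
  then have "i \<in># u" "P (u - {#i#}) \<noteq> \<zero>" by (auto simp: indexed_pmult_def split: if_splits)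
  with indexed_pmult have "set_mset (u - {#i#}) \<subseteq> I" by blast
  with \<open>i \<in># u\<close> \<open>i \<in> I\<close> show ?case
    by (metis insert_DiffM insert_subset set_mset_add_mset_insert)
qed (auto simp: indexed_const_def split: if_splits)

lemma polys_monomial:
  assumes "c \<in> carrier R" "set_mset u \<subseteq> I"
  shows "(\<lambda>v. if v = u then c else \<zero>) \<in> polys I"
  using assms(2)
proof (induction u)
  case empty
  then show ?case using indexed_pset.indexed_const[OF assms(1), of I] by (simp add: indexed_const_def)
next
  case (add i u)
  have "indexed_pmult (\<lambda>v. if v = u then c else \<zero>) i = (\<lambda>v. if v = add_mset i u then c else \<zero>)"
    by (auto simp: indexed_pmult_def fun_eq_iff)
  then show ?case using indexed_pset.indexed_pmult[of _ I "carrier R" i] add by fastforce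
qed

text \<open>Links the inductive set to finite supports by removing one monomial at a time. It serves
  functions that are given coefficientwise, such as negatives or scalar multiples, for which no
  introduction rule is at hand.\<close>

lemma polysI:
  fixes P :: "'i multiset \<Rightarrow> 'a"
  assumes "finite {u. P u \<noteq> \<zero>}" "\<And>u. P u \<in> carrier R" "\<And>u. P u \<noteq> \<zero> \<Longrightarrow> set_mset u \<subseteq> I"
  shows "P \<in> polys I"
proof -
  \<comment> \<open>The support is fixed as \<open>S\<close> and \<open>P\<close> is quantified, so
    that the hypothesis can be applied to \<open>P(w := \<zero>)\<close>.\<close>
  have "\<forall>P :: 'i multiset \<Rightarrow> 'a. {u. P u \<noteq> \<zero>} = S \<longrightarrow> (\<forall>u. P u \<in> carrier R) \<longrightarrow> (\<forall>u. P u \<noteq> \<zero> \<longrightarrow> set_mset u \<subseteq> I)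
      \<longrightarrow> P \<in> polys I" if "finite S" for S
    using that
  proof (induction S)
    case empty
    show ?case
    proof (intro allI impI)
      fix P :: "'i multiset \<Rightarrow> 'a" assume "{u. P u \<noteq> \<zero>} = {}"
      then have "P = indexed_const \<zero>" by (auto simp: indexed_const_def)
      then show "P \<in> polys I" by (auto intro: indexed_pset.indexed_const)
    qed
  next
    case (insert w S)
    show ?case
    proof (intro allI impI)
      fix P :: "'i multiset \<Rightarrow> 'a" assume P: "{u. P u \<noteq> \<zero>} = insert w S" "\<forall>u. P u \<in> carrier R"
        "\<forall>u. P u \<noteq> \<zero> \<longrightarrow> set_mset u \<subseteq> I"
      have "{u. (P(w := \<zero>)) u \<noteq> \<zero>} = S"
        using insert.hyps P(1) by auto
      then have "P(w := \<zero>) \<in> polys I"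
        using insert.IH P(2,3) by (auto simp del: fun_upd_apply simp: fun_upd_def)
      moreover have "(\<lambda>v. if v = w then P w else \<zero>) \<in> polys I"
        using P by (intro polys_monomial) auto
      moreover have "P = indexed_padd (P(w := \<zero>)) (\<lambda>v. if v = w then P w else \<zero>)"
        using P(2) by (auto simp: indexed_padd_def fun_eq_iff)
      ultimately show "P \<in> polys I" by (metis indexed_pset.indexed_padd)
    qed
  qed
  then show ?thesis using assms by blast
qed

lemma polys_mult_closed:
  assumes "P \<in> polys I" "Q \<in> polys I"
  shows "mpoly_mult R P Q \<in> polys I"
  using assms
proof (induction rule: indexed_pset.induct)
  case (indexed_const k)
  show ?case
  proof (rule polysI)
    show "finite {u. mpoly_mult R (indexed_const k) Q u \<noteq> \<zero>}"
      by (rule finite_subset[OF _ polys_finite_support[OF \<open>Q \<in> polys I\<close>]])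
        (use indexed_const in \<open>auto simp: mpoly_mult_const polys_coeff\<close>)
    show "mpoly_mult R (indexed_const k) Q u \<in> carrier R" for u
      using indexed_const by (simp add: mpoly_mult_const polys_coeff polys_closed)
    show "set_mset u \<subseteq> I" if "mpoly_mult R (indexed_const k) Q u \<noteq> \<zero>" for u
    proof (rule polys_support[OF \<open>Q \<in> polys I\<close>])
      show "Q u \<noteq> \<zero>" using that indexed_const by (auto simp: mpoly_mult_const polys_coeff)
    qed
  qed
next
  case (indexed_padd P P')
  then show ?case by (simp add: mpoly_mult_padd polys_coeff indexed_pset.indexed_padd)
next
  case (indexed_pmult P i)
  then show ?case by (simp add: mpoly_mult_pmult polys_coeff indexed_pset.indexed_pmult)
qed

text \<open>Induction on the left factor avoids the double sum over chains of submultisets;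
  distributivity over one sum, in the case of a constant, is all that remains.\<close>

lemma mpoly_mult_assoc:
  assumes "P \<in> polys I" "carrier_coeff Q" "carrier_coeff S"
  shows "mpoly_mult R (mpoly_mult R P Q) S = mpoly_mult R P (mpoly_mult R Q S)"
  using assms(1)
proof (induction rule: indexed_pset.induct)
  case (indexed_const k)
  have c: "Q v \<in> carrier R" "S v \<in> carrier R" for v
    using assms by (auto simp: carrier_coeff_def)
  have k: "k \<in> carrier R" using indexed_const by simp
  have "mpoly_mult R (\<lambda>u. k \<otimes> Q u) S u = k \<otimes> mpoly_mult R Q S u" for u
    using finsum_rdistr[OF finite_submultisets k, of "\<lambda>v. Q v \<otimes> S (u - v)"]
    by (simp add: mpoly_multE c m_assoc k)
  then show ?case
    using k assms(2,3) by (simp add: mpoly_mult_const mpoly_mult_coeff)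
next
  case (indexed_padd P P')
  then show ?case by (simp add: mpoly_mult_padd polys_coeff mpoly_mult_coeff assms)
next
  case (indexed_pmult P i)
  then show ?case by (simp add: mpoly_mult_pmult polys_coeff mpoly_mult_coeff assms)
qed

lemma cring_mpoly_ring: "cring (mpoly_ring R m)"
proof -
  have c: "P u \<in> carrier R" if "P \<in> polys {..<m}" for P u
    using that by (rule polys_closed)
  show ?thesis
  proof (rule cringI)
    show "abelian_group (mpoly_ring R m)"
    proof (rule abelian_groupI)
      fix P assume P: "P \<in> carrier (mpoly_ring R m)"
      \<comment> \<open>Negation is not among the rules that build \<open>polys\<close>, so the
        inverse is given coefficientwise and recognised by its support.\<close>
      have "(\<lambda>u. \<ominus> P u) \<in> polys {..<m}"
      proof (rule polysI)
        show "finite {u. \<ominus> P u \<noteq> \<zero>}"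
          by (rule finite_subset[OF _ polys_finite_support]) (use P in \<open>auto simp: mpoly_ring_simps\<close>)
        show "set_mset u \<subseteq> {..<m}" if "\<ominus> P u \<noteq> \<zero>" for u
          by (rule polys_support[of P]) (use P that in \<open>auto simp: mpoly_ring_simps\<close>)
      qed (use P c in \<open>auto simp: mpoly_ring_simps\<close>)
      moreover have "indexed_padd (\<lambda>u. \<ominus> P u) P = indexed_const \<zero>"
        using P c by (auto simp: mpoly_ring_simps indexed_padd_def indexed_const_def l_neg)
      ultimately show "\<exists>Q\<in>carrier (mpoly_ring R m). Q \<oplus>\<^bsub>mpoly_ring R m\<^esub> P = \<zero>\<^bsub>mpoly_ring R m\<^esub>"
        by (metis mpoly_ring_simps(1,4,5))
      show "\<zero>\<^bsub>mpoly_ring R m\<^esub> \<oplus>\<^bsub>mpoly_ring R m\<^esub> P = P"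
        using P c by (auto simp: mpoly_ring_simps indexed_padd_def indexed_zero_def fun_eq_iff)
      fix Q assume Q: "Q \<in> carrier (mpoly_ring R m)"
      show "P \<oplus>\<^bsub>mpoly_ring R m\<^esub> Q = Q \<oplus>\<^bsub>mpoly_ring R m\<^esub> P"
        using P Q c by (auto simp: mpoly_ring_simps indexed_padd_def fun_eq_iff a_comm)
      fix S assume S: "S \<in> carrier (mpoly_ring R m)"
      show "P \<oplus>\<^bsub>mpoly_ring R m\<^esub> Q \<oplus>\<^bsub>mpoly_ring R m\<^esub> S
          = P \<oplus>\<^bsub>mpoly_ring R m\<^esub> (Q \<oplus>\<^bsub>mpoly_ring R m\<^esub> S)"
        using P Q S c by (auto simp: mpoly_ring_simps indexed_padd_def fun_eq_iff a_assoc)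
    qed (simp_all add: mpoly_ring_simps indexed_pset.intros)
    show "comm_monoid (mpoly_ring R m)"
    proof (rule comm_monoidI)
      fix P assume P: "P \<in> carrier (mpoly_ring R m)"
      then show "\<one>\<^bsub>mpoly_ring R m\<^esub> \<otimes>\<^bsub>mpoly_ring R m\<^esub> P = P"
        using c by (simp add: mpoly_ring_simps mpoly_mult_const polys_coeff)
    qed (auto simp: mpoly_ring_simps indexed_pset.intros polys_mult_closed mpoly_mult_assoc[of _ "{..<m}"]
        polys_coeff mpoly_mult_comm)
  qed (auto simp: mpoly_ring_simps mpoly_mult_padd polys_coeff)
qed

end

text \<open>The induction of \<open>indexed_pset\<close> with the ring as an explicit argument, so
  that it can be applied inside locales that speak of several rings.\<close>

lemma polys_induct [consumes 2, case_names const padd pmult]: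
  assumes "cring R" "P \<in> ring.indexed_pset R I (carrier R)"
    and "\<And>c. c \<in> carrier R \<Longrightarrow> Q (ring.indexed_const R c)"
    and "\<And>P P'. P \<in> ring.indexed_pset R I (carrier R) \<Longrightarrow> Q P \<Longrightarrow>
           P' \<in> ring.indexed_pset R I (carrier R) \<Longrightarrow> Q P' \<Longrightarrow> Q (ring.indexed_padd R P P')"
    and "\<And>P i. P \<in> ring.indexed_pset R I (carrier R) \<Longrightarrow> Q P \<Longrightarrow> i \<in> I \<Longrightarrow> Q (ring.indexed_pmult R P i)"
  shows "Q P"
proof -
  interpret cring R by fact
  show ?thesis
    using assms(2) by (induction rule: indexed_pset.induct) (rule assms(3-5); assumption)+
qed

section \<open>Evaluation and substitution\<close>

definition mon_eval :: "('b, 'y) ring_scheme \<Rightarrow> (nat \<Rightarrow> 'b) \<Rightarrow> nat multiset \<Rightarrow> 'b"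
  where "mon_eval S y u = (\<Otimes>\<^bsub>S\<^esub>i\<in>set_mset u. y i [^]\<^bsub>S\<^esub> count u i)"

text \<open>A sum over the support and not a recursion, since one polynomial is built by the rules
  of \<open>indexed_pset\<close> in many ways and independence of the way would have to be
  shown.\<close>

definition mpoly_eval :: "('a, 'x) ring_scheme \<Rightarrow> ('b, 'y) ring_scheme \<Rightarrow> ('a \<Rightarrow> 'b) \<Rightarrow> (nat \<Rightarrow> 'b)
    \<Rightarrow> (nat multiset \<Rightarrow> 'a) \<Rightarrow> 'b"
  where "mpoly_eval R S h y P = (\<Oplus>\<^bsub>S\<^esub>u\<in>{u. P u \<noteq> \<zero>\<^bsub>R\<^esub>}. h (P u) \<otimes>\<^bsub>S\<^esub> mon_eval S y u)"

definition mpoly_map :: "('a \<Rightarrow> 'b) \<Rightarrow> (nat multiset \<Rightarrow> 'a) \<Rightarrow> nat multiset \<Rightarrow> 'b"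
  where "mpoly_map h P = (\<lambda>u. h (P u))"

lemma mpoly_map_apply: "mpoly_map h P u = h (P u)"
  by (simp add: mpoly_map_def)

lemma (in cring) mon_eval_closed:
  "set_mset u \<subseteq> I \<Longrightarrow> y \<in> I \<rightarrow> carrier R \<Longrightarrow> mon_eval R y u \<in> carrier R"
  unfolding mon_eval_def by (intro finprod_closed) auto

lemma (in cring) mon_eval_empty [simp]: "mon_eval R y {#} = \<one>"
  by (simp add: mon_eval_def)

text \<open>The letter \<open>i\<close> may or may not occur in \<open>u\<close>. Both monomials are
  therefore written as products over the same set \<open>insert i A\<close>, where letters of
  multiplicity zero contribute the unit.\<close>

lemma (in cring) mon_eval_add_mset:
  assumes "set_mset u \<subseteq> I" "y \<in> I \<rightarrow> carrier R" "i \<in> I"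
  shows "mon_eval R y (add_mset i u) = y i \<otimes> mon_eval R y u"
proof -
  have y: "y j \<in> carrier R" if "j \<in> I" for j using assms(2) that by auto
  define A where "A = set_mset u - {i}"
  have A: "finite A" "i \<notin> A" "A \<subseteq> I" using assms by (auto simp: A_def)
  have ev: "mon_eval R y w = y i [^] count w i \<otimes> (\<Otimes>j\<in>A. y j [^] count w j)"
    if "set_mset w \<subseteq> insert i A" for w
  proof -
    have "mon_eval R y w = (\<Otimes>j\<in>insert i A. y j [^] count w j)"
      unfolding mon_eval_def
    proof (rule finprod_mono_neutral_cong_left)
      show "y j [^] count w j = \<one>" if "j \<in> insert i A - set_mset w" for j
        using that by (simp add: not_in_iff)
      show "(\<lambda>j. y j [^] count w j) \<in> insert i A \<rightarrow> carrier R"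
        using y A(3) \<open>i \<in> I\<close> by blast
    qed (use that A(1) in auto)
    also have "\<dots> = y i [^] count w i \<otimes> (\<Otimes>j\<in>A. y j [^] count w j)"
    proof (rule finprod_insert[OF A(1,2)])
      show "(\<lambda>j. y j [^] count w j) \<in> A \<rightarrow> carrier R"
        using y A(3) by blast
      show "y i [^] count w i \<in> carrier R" using y \<open>i \<in> I\<close> by blast
    qed
    finally show ?thesis .
  qed
  have "(\<Otimes>j\<in>A. y j [^] count (add_mset i u) j) = (\<Otimes>j\<in>A. y j [^] count u j)"
  proof (rule finprod_cong')
    show "y j [^] count (add_mset i u) j = y j [^] count u j" if "j \<in> A" for j
      using that A(2) by auto
    show "(\<lambda>j. y j [^] count u j) \<in> A \<rightarrow> carrier R"
      using y A(3) by blast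
  qed simp
  moreover have "(\<Otimes>j\<in>A. y j [^] count u j) \<in> carrier R"
  proof (rule finprod_closed)
    show "(\<lambda>j. y j [^] count u j) \<in> A \<rightarrow> carrier R"
      using y A(3) by blast
  qed
  ultimately show ?thesis
  proof -
    assume eq: "(\<Otimes>j\<in>A. y j [^] count (add_mset i u) j) = (\<Otimes>j\<in>A. y j [^] count u j)"
      and c: "(\<Otimes>j\<in>A. y j [^] count u j) \<in> carrier R"
    have "mon_eval R y (add_mset i u) = y i [^] Suc (count u i) \<otimes> (\<Otimes>j\<in>A. y j [^] count u j)"
      using ev[of "add_mset i u"] unfolding eq by (auto simp: A_def)
    moreover have "mon_eval R y u = y i [^] count u i \<otimes> (\<Otimes>j\<in>A. y j [^] count u j)"
      using ev[of u] by (auto simp: A_def)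
    ultimately show ?thesis
      using c y[OF \<open>i \<in> I\<close>] by (simp add: m_ac)
  qed
qed

context ring_hom_cring
begin

context
  fixes y :: "nat \<Rightarrow> 'c" and I :: "nat set"
  assumes y: "y \<in> I \<rightarrow> carrier S"
begin

lemma mon_eval_in: "set_mset u \<subseteq> I \<Longrightarrow> mon_eval S y u \<in> carrier S"
  using y by (rule S.mon_eval_closed[rotated])

lemma eval_term_closed:
  assumes "P \<in> R.polys I" "set_mset u \<subseteq> I"
  shows "h (P u) \<otimes>\<^bsub>S\<^esub> mon_eval S y u \<in> carrier S"
  using R.polys_closed[OF assms(1)] mon_eval_in[OF assms(2)] by simp

text \<open>Cancellation can shrink the support of a sum or of a scaled polynomial. Padding the
  index set with zero terms gives all of them a common range of summation.\<close>

lemma eval_superset: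
  assumes "P \<in> R.polys I" "finite A" "{u. P u \<noteq> \<zero>} \<subseteq> A" "\<And>u. u \<in> A \<Longrightarrow> set_mset u \<subseteq> I"
  shows "mpoly_eval R S h y P = (\<Oplus>\<^bsub>S\<^esub>u\<in>A. h (P u) \<otimes>\<^bsub>S\<^esub> mon_eval S y u)"
  unfolding mpoly_eval_def
proof (rule S.add.finprod_mono_neutral_cong_left)
  fix u assume "u \<in> A - {u. P u \<noteq> \<zero>}"
  then show "h (P u) \<otimes>\<^bsub>S\<^esub> mon_eval S y u = \<zero>\<^bsub>S\<^esub>"
    using mon_eval_in[OF assms(4)] by simp
next
  show "(\<lambda>u. h (P u) \<otimes>\<^bsub>S\<^esub> mon_eval S y u) \<in> A \<rightarrow> carrier S"
    using eval_term_closed[OF assms(1) assms(4)] by blast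
qed (use assms(2,3) in auto)

lemma eval_closed:
  assumes "P \<in> R.polys I" shows "mpoly_eval R S h y P \<in> carrier S"
  unfolding mpoly_eval_def
  using eval_term_closed[OF assms R.polys_support[OF assms]] by (intro S.finsum_closed) blast

lemma eval_const:
  assumes "c \<in> carrier R" shows "mpoly_eval R S h y (R.indexed_const c) = h c"
proof -
  have "mpoly_eval R S h y (R.indexed_const c)
      = (\<Oplus>\<^bsub>S\<^esub>u\<in>{{#}}. h (R.indexed_const c u) \<otimes>\<^bsub>S\<^esub> mon_eval S y u)"
  proof (rule eval_superset)
    show "R.indexed_const c \<in> R.polys I" using assms by (rule R.indexed_pset.indexed_const)
  qed (auto simp: R.indexed_const_def split: if_splits)
  then show ?thesis using assms by (simp add: R.indexed_const_def)
qed

lemma eval_padd: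
  assumes "P \<in> R.polys I" "Q \<in> R.polys I"
  shows "mpoly_eval R S h y (R.indexed_padd P Q) = mpoly_eval R S h y P \<oplus>\<^bsub>S\<^esub> mpoly_eval R S h y Q"
proof -
  define A where "A = {u. P u \<noteq> \<zero>} \<union> {u. Q u \<noteq> \<zero>}"
  have A: "finite A" "\<And>u. u \<in> A \<Longrightarrow> set_mset u \<subseteq> I"
    using assms R.polys_finite_support R.polys_support unfolding A_def by blast+
  have "mpoly_eval R S h y (R.indexed_padd P Q)
      = (\<Oplus>\<^bsub>S\<^esub>u\<in>A. h (R.indexed_padd P Q u) \<otimes>\<^bsub>S\<^esub> mon_eval S y u)"
  proof (rule eval_superset)
    show "R.indexed_padd P Q \<in> R.polys I" using assms by (rule R.indexed_pset.indexed_padd)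
  qed (use A in \<open>auto simp: A_def R.indexed_padd_def\<close>)
  also have "\<dots> = (\<Oplus>\<^bsub>S\<^esub>u\<in>A. h (P u) \<otimes>\<^bsub>S\<^esub> mon_eval S y u \<oplus>\<^bsub>S\<^esub> h (Q u) \<otimes>\<^bsub>S\<^esub> mon_eval S y u)"
  proof (rule S.finsum_cong')
    fix u assume "u \<in> A"
    then show "h (R.indexed_padd P Q u) \<otimes>\<^bsub>S\<^esub> mon_eval S y u
        = h (P u) \<otimes>\<^bsub>S\<^esub> mon_eval S y u \<oplus>\<^bsub>S\<^esub> h (Q u) \<otimes>\<^bsub>S\<^esub> mon_eval S y u"
      using mon_eval_in[OF A(2)] R.polys_closed[OF assms(1)] R.polys_closed[OF assms(2)]
      by (simp add: R.indexed_padd_def S.l_distr)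
  next
    show "(\<lambda>u. h (P u) \<otimes>\<^bsub>S\<^esub> mon_eval S y u \<oplus>\<^bsub>S\<^esub> h (Q u) \<otimes>\<^bsub>S\<^esub> mon_eval S y u) \<in> A \<rightarrow> carrier S"
      using eval_term_closed[OF assms(1) A(2)] eval_term_closed[OF assms(2) A(2)] by blast
  qed simp
  also have "\<dots> = (\<Oplus>\<^bsub>S\<^esub>u\<in>A. h (P u) \<otimes>\<^bsub>S\<^esub> mon_eval S y u) \<oplus>\<^bsub>S\<^esub> (\<Oplus>\<^bsub>S\<^esub>u\<in>A. h (Q u) \<otimes>\<^bsub>S\<^esub> mon_eval S y u)"
    by (rule S.finsum_addf)
      (use eval_term_closed[OF assms(1) A(2)] eval_term_closed[OF assms(2) A(2)] in blast)+
  also have "(\<Oplus>\<^bsub>S\<^esub>u\<in>A. h (P u) \<otimes>\<^bsub>S\<^esub> mon_eval S y u) = mpoly_eval R S h y P"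
    by (rule eval_superset[symmetric]) (use assms A in \<open>auto simp: A_def\<close>)
  also have "(\<Oplus>\<^bsub>S\<^esub>u\<in>A. h (Q u) \<otimes>\<^bsub>S\<^esub> mon_eval S y u) = mpoly_eval R S h y Q"
    by (rule eval_superset[symmetric]) (use assms A in \<open>auto simp: A_def\<close>)
  finally show ?thesis .
qed

lemma eval_pmult:
  assumes "P \<in> R.polys I" "i \<in> I"
  shows "mpoly_eval R S h y (R.indexed_pmult P i) = mpoly_eval R S h y P \<otimes>\<^bsub>S\<^esub> y i"
proof -
  define A where "A = {u. P u \<noteq> \<zero>}"
  have A: "finite A" "\<And>u. u \<in> A \<Longrightarrow> set_mset u \<subseteq> I"
    using assms R.polys_finite_support R.polys_support unfolding A_def by blast+
  have c: "h (P u) \<in> carrier S" "u \<in> A \<Longrightarrow> mon_eval S y u \<in> carrier S" "y i \<in> carrier S" for u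
    using funcset_mem[OF y assms(2)] mon_eval_in[OF A(2)] R.polys_closed[OF assms(1)] by auto
  have "mpoly_eval R S h y (R.indexed_pmult P i)
      = (\<Oplus>\<^bsub>S\<^esub>u\<in>add_mset i ` A. h (R.indexed_pmult P i u) \<otimes>\<^bsub>S\<^esub> mon_eval S y u)"
  proof (rule eval_superset)
    show "{u. R.indexed_pmult P i u \<noteq> \<zero>} \<subseteq> add_mset i ` A"
      by (auto simp: R.indexed_pmult_def A_def image_iff split: if_splits) (metis insert_DiffM)
    show "set_mset u \<subseteq> I" if "u \<in> add_mset i ` A" for u
      using that A(2) assms(2) by fastforce
  qed (use assms A(1) in \<open>auto simp: R.indexed_pset.intros\<close>)
  also have "\<dots> = (\<Oplus>\<^bsub>S\<^esub>u\<in>A. h (P u) \<otimes>\<^bsub>S\<^esub> mon_eval S y (add_mset i u))"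
  proof (subst S.finsum_reindex)
    show "(\<lambda>u. h (R.indexed_pmult P i u) \<otimes>\<^bsub>S\<^esub> mon_eval S y u) \<in> add_mset i ` A \<rightarrow> carrier S"
      using c A(2) assms(2) by (auto simp: R.indexed_pmult_def S.mon_eval_add_mset[OF A(2) y])
  qed (auto simp: inj_on_def R.indexed_pmult_def)
  also have "\<dots> = (\<Oplus>\<^bsub>S\<^esub>u\<in>A. (h (P u) \<otimes>\<^bsub>S\<^esub> mon_eval S y u) \<otimes>\<^bsub>S\<^esub> y i)"
    by (rule S.finsum_cong') (use A(1) c assms(2) in \<open>auto simp: S.mon_eval_add_mset[OF A(2) y] S.m_ac\<close>)
  also have "\<dots> = (\<Oplus>\<^bsub>S\<^esub>u\<in>A. h (P u) \<otimes>\<^bsub>S\<^esub> mon_eval S y u) \<otimes>\<^bsub>S\<^esub> y i"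
    by (rule S.finsum_ldistr[symmetric]) (use A(1) c in auto)
  finally show ?thesis by (simp add: mpoly_eval_def A_def)
qed

lemma eval_var:
  assumes "i \<in> I" shows "mpoly_eval R S h y (R.indexed_var i) = y i"
proof -
  have "y i \<in> carrier S" using assms y by auto
  then show ?thesis
    using assms by (simp add: R.indexed_var_def eval_pmult eval_const R.indexed_pset.intros)
qed

text \<open>Induction on the left factor: a sum and a shift reduce to \<open>eval_padd\<close> and
  \<open>eval_pmult\<close>, and a constant moves through the sum over the support of
  \<open>Q\<close>.\<close>

lemma eval_mult:
  assumes "P \<in> R.polys I" "Q \<in> R.polys I"
  shows "mpoly_eval R S h y (mpoly_mult R P Q) = mpoly_eval R S h y P \<otimes>\<^bsub>S\<^esub> mpoly_eval R S h y Q"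
  using R.is_cring assms(1)
proof (induction rule: polys_induct)
  case (const c)
  have "mpoly_eval R S h y (mpoly_mult R (R.indexed_const c) Q)
      = (\<Oplus>\<^bsub>S\<^esub>u\<in>{u. Q u \<noteq> \<zero>}. h (c \<otimes> Q u) \<otimes>\<^bsub>S\<^esub> mon_eval S y u)"
    unfolding R.mpoly_mult_const[OF const R.polys_coeff[OF assms(2)]]
  proof (rule eval_superset)
    show "(\<lambda>u. c \<otimes> Q u) \<in> R.polys I"
      using R.polys_mult_closed[OF R.indexed_pset.indexed_const assms(2), of c] const
      by (simp only: R.mpoly_mult_const[OF const R.polys_coeff[OF assms(2)]])
  qed (use assms(2) const R.polys_support[OF assms(2)] in \<open>auto simp: R.polys_finite_support\<close>)
  also have "\<dots> = (\<Oplus>\<^bsub>S\<^esub>u\<in>{u. Q u \<noteq> \<zero>}. h c \<otimes>\<^bsub>S\<^esub> (h (Q u) \<otimes>\<^bsub>S\<^esub> mon_eval S y u))"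
  proof (rule S.finsum_cong')
    fix u assume "u \<in> {u. Q u \<noteq> \<zero>}"
    then show "h (c \<otimes> Q u) \<otimes>\<^bsub>S\<^esub> mon_eval S y u = h c \<otimes>\<^bsub>S\<^esub> (h (Q u) \<otimes>\<^bsub>S\<^esub> mon_eval S y u)"
      using const mon_eval_in[OF R.polys_support[OF assms(2)]] R.polys_closed[OF assms(2)]
      by (simp add: S.m_assoc)
  next
    show "(\<lambda>u. h c \<otimes>\<^bsub>S\<^esub> (h (Q u) \<otimes>\<^bsub>S\<^esub> mon_eval S y u)) \<in> {u. Q u \<noteq> \<zero>} \<rightarrow> carrier S"
      using const eval_term_closed[OF assms(2) R.polys_support[OF assms(2)]] by blast
  qed simp
  also have "\<dots> = h c \<otimes>\<^bsub>S\<^esub> mpoly_eval R S h y Q"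
    unfolding mpoly_eval_def
    by (rule S.finsum_rdistr[symmetric])
      (use const eval_term_closed[OF assms(2) R.polys_support[OF assms(2)]]
        R.polys_finite_support[OF assms(2)] in \<open>blast intro: hom_closed\<close>)+
  finally show ?case using const by (simp add: eval_const)
next
  case (padd P P')
  then show ?case
    by (simp add: R.mpoly_mult_padd[OF _ _ R.polys_coeff[OF assms(2)]] R.polys_coeff eval_padd
        R.polys_mult_closed[OF _ assms(2)] eval_closed eval_closed[OF assms(2)] S.l_distr)
next
  case (pmult P i)
  then show ?case
    using funcset_mem[OF y \<open>i \<in> I\<close>] assms
    by (simp add: R.mpoly_mult_pmult[OF _ R.polys_coeff[OF assms(2)]] R.polys_coeff eval_pmult
        R.polys_mult_closed[OF _ assms(2)] eval_closed eval_closed[OF assms(2)] S.m_ac)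
qed

end

text \<open>The existence half of the universal property of polynomial rings.\<close>

lemma eval_hom:
  assumes "y \<in> {..<m} \<rightarrow> carrier S"
  shows "mpoly_eval R S h y \<in> ring_hom (mpoly_ring R m) S"
  by (rule ring_hom_memI)
    (auto simp: mpoly_ring_simps eval_closed[OF assms] eval_mult[OF assms] eval_padd[OF assms]
      eval_const[OF assms])

lemma eval_cong:
  assumes "P \<in> R.polys I" "y \<in> I \<rightarrow> carrier S" "\<And>i. i \<in> I \<Longrightarrow> y i = z i"
  shows "mpoly_eval R S h y P = mpoly_eval R S h z P"
proof -
  have z: "z \<in> I \<rightarrow> carrier S" using assms(2) by (auto simp: Pi_iff assms(3)[symmetric])
  show ?thesis
    using R.is_cring assms(1)
    by (induction rule: polys_induct)
      (simp_all add: eval_const[OF assms(2)] eval_const[OF z] eval_padd[OF assms(2)] eval_padd[OF z]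
        eval_pmult[OF assms(2)] eval_pmult[OF z] assms(3))
qed

lemma map_const: "c \<in> carrier R \<Longrightarrow> mpoly_map h (R.indexed_const c) = S.indexed_const (h c)"
  by (auto simp: fun_eq_iff mpoly_map_apply R.indexed_const_def S.indexed_const_def)

lemma map_padd:
  "P \<in> R.polys I \<Longrightarrow> Q \<in> R.polys I \<Longrightarrow> mpoly_map h (R.indexed_padd P Q) = S.indexed_padd (mpoly_map h P) (mpoly_map h Q)"
  by (auto simp: fun_eq_iff mpoly_map_apply R.indexed_padd_def S.indexed_padd_def R.polys_closed)

lemma map_pmult: "mpoly_map h (R.indexed_pmult P i) = S.indexed_pmult (mpoly_map h P) i"
  by (auto simp: fun_eq_iff mpoly_map_apply R.indexed_pmult_def S.indexed_pmult_def)

lemma map_var: "mpoly_map h (R.indexed_var i) = S.indexed_var i"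
  by (simp add: R.indexed_var_def S.indexed_var_def map_pmult map_const)

lemma map_polys: "P \<in> R.polys I \<Longrightarrow> mpoly_map h P \<in> S.polys I"
  using R.is_cring
proof (induction rule: polys_induct)
  case (padd P P')
  then show ?case using S.indexed_pset.indexed_padd map_padd by metis
next
  case (pmult P i)
  then show ?case unfolding map_pmult by (blast intro: S.indexed_pset.indexed_pmult)
qed (simp add: map_const S.indexed_pset.intros)

lemma map_mult:
  assumes "P \<in> R.polys I" "Q \<in> R.polys I"
  shows "mpoly_map h (mpoly_mult R P Q) = mpoly_mult S (mpoly_map h P) (mpoly_map h Q)"
proof (rule ext)
  fix u
  have c: "P v \<in> carrier R" "Q v \<in> carrier R" for v
    using assms R.polys_closed by blast+
  have "h (\<Oplus>v\<in>{v. v \<subseteq># u}. P v \<otimes> Q (u - v)) = (\<Oplus>\<^bsub>S\<^esub>v\<in>{v. v \<subseteq># u}. h (P v \<otimes> Q (u - v)))"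
    using c by (subst hom_finsum) (auto simp: comp_def)
  also have "\<dots> = (\<Oplus>\<^bsub>S\<^esub>v\<in>{v. v \<subseteq># u}. h (P v) \<otimes>\<^bsub>S\<^esub> h (Q (u - v)))"
    by (rule S.finsum_cong') (use c in auto)
  finally show "mpoly_map h (mpoly_mult R P Q) u = mpoly_mult S (mpoly_map h P) (mpoly_map h Q) u"
    by (simp add: mpoly_mult_def mpoly_map_apply)
qed

lemma map_hom: "(mpoly_map h) \<in> ring_hom (mpoly_ring R m) (mpoly_ring S m)"
proof (rule ring_hom_memI)
  fix P Q assume "P \<in> carrier (mpoly_ring R m)" "Q \<in> carrier (mpoly_ring R m)"
  then have PQ: "P \<in> R.polys {..<m}" "Q \<in> R.polys {..<m}" by (simp_all add: mpoly_ring_simps)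
  show "mpoly_map h P \<in> carrier (mpoly_ring S m)"
    using map_polys[OF PQ(1)] by (simp add: mpoly_ring_simps)
  show "mpoly_map h (P \<otimes>\<^bsub>mpoly_ring R m\<^esub> Q) = (mpoly_map h P) \<otimes>\<^bsub>mpoly_ring S m\<^esub> (mpoly_map h Q)"
    using map_mult[OF PQ] by (simp add: mpoly_ring_simps)
  show "mpoly_map h (P \<oplus>\<^bsub>mpoly_ring R m\<^esub> Q) = (mpoly_map h P) \<oplus>\<^bsub>mpoly_ring S m\<^esub> (mpoly_map h Q)"
    using map_padd[OF PQ] by (simp add: mpoly_ring_simps)
next
  show "mpoly_map h \<one>\<^bsub>mpoly_ring R m\<^esub> = \<one>\<^bsub>mpoly_ring S m\<^esub>"
    using map_const[OF R.one_closed] by (simp add: mpoly_ring_simps)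
qed

end

context cring
begin

lemma const_hom: "ring_hom_cring R (mpoly_ring R m) indexed_const"
proof -
  interpret M: cring "mpoly_ring R m" by (rule cring_mpoly_ring)
  show ?thesis
  proof (unfold_locales, rule ring_hom_memI)
    fix c d assume c: "c \<in> carrier R" and d: "d \<in> carrier R"
    show "indexed_const c \<in> carrier (mpoly_ring R m)"
      using c by (simp add: mpoly_ring_simps indexed_pset.indexed_const)
    have "carrier_coeff (indexed_const d :: nat multiset \<Rightarrow> 'a)"
      using d by (simp add: carrier_coeff_def indexed_const_def)
    then show "indexed_const (c \<otimes> d) = indexed_const c \<otimes>\<^bsub>mpoly_ring R m\<^esub> indexed_const d"
      using mpoly_mult_const[OF c, of "indexed_const d"] c
      by (auto simp: mpoly_ring_simps fun_eq_iff) (auto simp: indexed_const_def)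
    show "indexed_const (c \<oplus> d) = indexed_const c \<oplus>\<^bsub>mpoly_ring R m\<^esub> indexed_const d"
      by (simp add: mpoly_ring_simps indexed_padd_const)
  qed (simp add: mpoly_ring_simps)
qed

lemma mpoly_var_closed: "i < m \<Longrightarrow> indexed_var i \<in> carrier (mpoly_ring R m)"
  by (auto simp: indexed_var_def mpoly_ring_simps indexed_pset.intros)

lemma pmult_eq_mult:
  assumes "P \<in> polys I" shows "indexed_pmult P i = mpoly_mult R P (indexed_var i)"
proof -
  have "carrier_coeff (indexed_const \<one>)" by (auto simp: carrier_coeff_def indexed_const_def)
  moreover have "carrier_coeff P" using assms polys_coeff by blast
  moreover have "mpoly_mult R (indexed_const \<one>) P = P"
    using mpoly_mult_const[OF one_closed, of P] polys_closed[OF assms] polys_coeff[OF assms] by auto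
  ultimately show ?thesis
    by (metis indexed_var_def indexed_pmult_in_carrier mpoly_mult_comm mpoly_mult_pmult)
qed

end

text \<open>Substitution is evaluation in the polynomial ring in \<open>m\<close> variables,
  coefficients entering as constants. Only the number of variables of the target is recorded; those
  of the source are the letters of the argument.\<close>

abbreviation mpoly_subst :: "('a, 'x) ring_scheme \<Rightarrow> nat \<Rightarrow> (nat \<Rightarrow> nat multiset \<Rightarrow> 'a)
    \<Rightarrow> (nat multiset \<Rightarrow> 'a) \<Rightarrow> nat multiset \<Rightarrow> 'a"
  where "mpoly_subst R m \<equiv> mpoly_eval R (mpoly_ring R m) (ring.indexed_const R)"

lemma (in cring) subst_var_id:
  assumes "P \<in> polys {..<m}"
  shows "mpoly_subst R m indexed_var P = P"
proof -
  interpret C: ring_hom_cring R "mpoly_ring R m" indexed_const by (rule const_hom)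
  have v: "indexed_var \<in> {..<m} \<rightarrow> carrier (mpoly_ring R m)" using mpoly_var_closed by auto
  show ?thesis
    using is_cring assms
    by (induction rule: polys_induct)
      (simp_all add: C.eval_const[OF v] C.eval_padd[OF v] C.eval_pmult[OF v] mpoly_ring_simps
        flip: pmult_eq_mult)
qed

text \<open>The uniqueness half of the universal property. The laws for composing substitutions and
  coefficient maps are derived from it.\<close>

lemma mpoly_hom_eqI:
  assumes "cring R" "cring T" "f \<in> ring_hom (mpoly_ring R m) T" "g \<in> ring_hom (mpoly_ring R m) T"
    and "\<And>c. c \<in> carrier R \<Longrightarrow> f (ring.indexed_const R c) = g (ring.indexed_const R c)"
    and "\<And>i. i < m \<Longrightarrow> f (ring.indexed_var R i) = g (ring.indexed_var R i)"
    and "P \<in> carrier (mpoly_ring R m)"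
  shows "f P = g P"
proof -
  interpret R: cring R by fact
  have "P \<in> R.polys {..<m}" using assms(7) by (simp add: mpoly_ring_simps)
  with assms(1) show ?thesis
  proof (induction rule: polys_induct)
    case (padd P P')
    then show ?case
      using ring_hom_add[OF assms(3), of P P'] ring_hom_add[OF assms(4), of P P']
      by (simp add: mpoly_ring_simps)
  next
    case (pmult P i)
    then show ?case
      using ring_hom_mult[OF assms(3), of P "R.indexed_var i"] ring_hom_mult[OF assms(4), of P "R.indexed_var i"]
        R.mpoly_var_closed[of i m] assms(6)
      by (simp add: mpoly_ring_simps R.pmult_eq_mult)
  qed (use assms in auto)
qed

section \<open>Finite sums and linear algebra over a field\<close>

lemma (in abelian_monoid) finsum_swap:
  assumes "finite A" "finite B" "\<And>i j. i \<in> A \<Longrightarrow> j \<in> B \<Longrightarrow> f i j \<in> carrier G"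
  shows "(\<Oplus>i\<in>A. \<Oplus>j\<in>B. f i j) = (\<Oplus>j\<in>B. \<Oplus>i\<in>A. f i j)"
  using assms(1,3)
proof (induction A)
  case (insert a A)
  have f: "f a \<in> B \<rightarrow> carrier G" "(\<lambda>j. \<Oplus>i\<in>A. f i j) \<in> B \<rightarrow> carrier G"
    "(\<lambda>i. \<Oplus>j\<in>B. f i j) \<in> A \<rightarrow> carrier G"
    using insert.prems by (auto intro!: finsum_closed)
  have "(\<Oplus>j\<in>B. \<Oplus>i\<in>insert a A. f i j) = (\<Oplus>j\<in>B. f a j \<oplus> (\<Oplus>i\<in>A. f i j))"
  proof (rule finsum_cong')
    fix j assume "j \<in> B"
    then show "(\<Oplus>i\<in>insert a A. f i j) = f a j \<oplus> (\<Oplus>i\<in>A. f i j)"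
      using insert by (intro finsum_insert) auto
  qed (use f in auto)
  also have "\<dots> = (\<Oplus>j\<in>B. f a j) \<oplus> (\<Oplus>j\<in>B. \<Oplus>i\<in>A. f i j)"
    by (rule finsum_addf) (use f in auto)
  also have "(\<Oplus>j\<in>B. \<Oplus>i\<in>A. f i j) = (\<Oplus>i\<in>A. \<Oplus>j\<in>B. f i j)"
    using insert by simp
  also have "(\<Oplus>j\<in>B. f a j) \<oplus> (\<Oplus>i\<in>A. \<Oplus>j\<in>B. f i j) = (\<Oplus>i\<in>insert a A. \<Oplus>j\<in>B. f i j)"
    by (rule finsum_insert[symmetric]) (use insert f in \<open>auto intro!: finsum_closed\<close>)
  finally show ?case by simp
qed simp

text \<open>Associativity \<open>f (g x) = (f g) x\<close> for a row, a matrix and a column, from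
  exchanging the two sums.\<close>

lemma (in cring) finsum_mult_assoc:
  assumes "finite A" "finite B" "\<And>t. t \<in> A \<Longrightarrow> f t \<in> carrier R"
    "\<And>t u. t \<in> A \<Longrightarrow> u \<in> B \<Longrightarrow> g t u \<in> carrier R" "\<And>u. u \<in> B \<Longrightarrow> x u \<in> carrier R"
  shows "(\<Oplus>t\<in>A. f t \<otimes> (\<Oplus>u\<in>B. g t u \<otimes> x u)) = (\<Oplus>u\<in>B. (\<Oplus>t\<in>A. f t \<otimes> g t u) \<otimes> x u)"
proof -
  have "(\<Oplus>t\<in>A. f t \<otimes> (\<Oplus>u\<in>B. g t u \<otimes> x u)) = (\<Oplus>t\<in>A. \<Oplus>u\<in>B. f t \<otimes> g t u \<otimes> x u)"
  proof (rule finsum_cong')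
    fix t assume t: "t \<in> A"
    have "f t \<otimes> (\<Oplus>u\<in>B. g t u \<otimes> x u) = (\<Oplus>u\<in>B. f t \<otimes> (g t u \<otimes> x u))"
      by (rule finsum_rdistr) (use assms t in auto)
    also have "\<dots> = (\<Oplus>u\<in>B. f t \<otimes> g t u \<otimes> x u)"
      by (rule finsum_cong') (use assms t in \<open>auto simp: m_assoc\<close>)
    finally show "f t \<otimes> (\<Oplus>u\<in>B. g t u \<otimes> x u) = (\<Oplus>u\<in>B. f t \<otimes> g t u \<otimes> x u)" .
  qed (use assms in \<open>auto intro!: finsum_closed\<close>)
  also have "\<dots> = (\<Oplus>u\<in>B. \<Oplus>t\<in>A. f t \<otimes> g t u \<otimes> x u)"
    by (rule finsum_swap) (use assms in auto)
  also have "\<dots> = (\<Oplus>u\<in>B. (\<Oplus>t\<in>A. f t \<otimes> g t u) \<otimes> x u)"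
  proof (rule finsum_cong')
    fix u assume u: "u \<in> B"
    show "(\<Oplus>t\<in>A. f t \<otimes> g t u \<otimes> x u) = (\<Oplus>t\<in>A. f t \<otimes> g t u) \<otimes> x u"
      by (rule finsum_ldistr[symmetric]) (use assms u in auto)
  qed (use assms in \<open>auto intro!: finsum_closed\<close>)
  finally show ?thesis .
qed

lemma (in cring) finsum_delta:
  assumes "finite A" "j \<in> A" "\<And>u. u \<in> A \<Longrightarrow> x u \<in> carrier R"
  shows "(\<Oplus>u\<in>A. (if j = u then \<one> else \<zero>) \<otimes> x u) = x j"
proof -
  have "(\<Oplus>u\<in>A. (if j = u then \<one> else \<zero>) \<otimes> x u) = (\<Oplus>u\<in>A. if j = u then x u else \<zero>)"
    by (rule finsum_cong') (use assms in auto)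
  also have "\<dots> = x j" by (rule finsum_singleton) (use assms in auto)
  finally show ?thesis .
qed

text \<open>Gaussian elimination by induction on the equations. A new equation that is zero on
  \<open>J\<close> costs nothing; otherwise a pivot unknown \<open>l\<close> is eliminated from the
  others, which leaves one unknown and one equation less, and \<open>x l\<close> is recovered by
  back substitution.\<close>

lemma (in field) ex_nontrivial_solution:
  assumes "finite I" "finite J" "card I < card J" "\<And>i j. A i j \<in> carrier R"
  shows "\<exists>x. (\<forall>j. x j \<in> carrier R) \<and> (\<exists>j\<in>J. x j \<noteq> \<zero>) \<and> (\<forall>i\<in>I. (\<Oplus>j\<in>J. A i j \<otimes> x j) = \<zero>)"
  using assms
proof (induction I arbitrary: J A)
  case empty
  then have "J \<noteq> {}" by auto
  then show ?case by (intro exI[of _ "\<lambda>_. \<one>"]) auto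
next
  case (insert m I)
  show ?case
  proof (cases "\<forall>j\<in>J. A m j = \<zero>")
    case True
    have "card I < card J" using insert.prems(2) insert.hyps by simp
    obtain x where x0: "\<forall>j. x j \<in> carrier R" "\<exists>j\<in>J. x j \<noteq> \<zero>" "\<forall>i\<in>I. (\<Oplus>j\<in>J. A i j \<otimes> x j) = \<zero>"
      using insert.IH[of J A, OF insert.prems(1) \<open>card I < card J\<close> insert.prems(3)]
      by (elim exE conjE) (rule that)
    note x = x0(1)[rule_format] x0(2) x0(3)[rule_format]
    have "(\<Oplus>j\<in>J. A m j \<otimes> x j) = (\<Oplus>j\<in>J. \<zero>)"
      by (rule finsum_cong') (use True x in auto)
    then show ?thesis using x by (intro exI[of _ x]) auto
  next
    case False
    then obtain l where l: "l \<in> J" "A m l \<noteq> \<zero>" by blast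
    define J' where "J' = J - {l}"
    have J': "finite J'" "l \<notin> J'" "J = insert l J'" using insert.prems l by (auto simp: J'_def)
    have "card I < card J'" using insert.prems(2) insert.hyps J' by simp
    define v where "v = inv (A m l)"
    have lU: "A m l \<in> Units R" using l insert.prems(3) by (simp add: field_Units)
    then have v: "v \<in> carrier R" "A m l \<otimes> v = \<one>" by (simp_all add: v_def)
    \<comment> \<open>Row \<open>i\<close> minus the multiple of row \<open>m\<close> that clears
      column \<open>l\<close>.\<close>
    define B where "B i j = A i j \<oplus> (\<ominus> (A i l \<otimes> v)) \<otimes> A m j" for i j
    have Bc: "B i j \<in> carrier R" for i j using insert.prems(3) v by (simp add: B_def)
    obtain x where x0: "\<forall>j. x j \<in> carrier R" "\<exists>j\<in>J'. x j \<noteq> \<zero>" "\<forall>i\<in>I. (\<Oplus>j\<in>J'. B i j \<otimes> x j) = \<zero>"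
      using insert.IH[of J' B, OF J'(1) \<open>card I < card J'\<close> Bc] by (elim exE conjE) (rule that)
    note x = x0(1)[rule_format] x0(2) x0(3)[rule_format]
    define S where "S i = (\<Oplus>j\<in>J'. A i j \<otimes> x j)" for i
    have S: "S i \<in> carrier R" for i
      unfolding S_def by (rule finsum_closed) (use insert.prems(3) x in auto)
    have Bx: "(\<Oplus>j\<in>J'. B i j \<otimes> x j) = S i \<oplus> (\<ominus> (A i l \<otimes> v)) \<otimes> S m" for i
    proof -
      have c: "\<ominus> (A i l \<otimes> v) \<in> carrier R" using insert.prems(3) v by simp
      have "(\<Oplus>j\<in>J'. B i j \<otimes> x j) = (\<Oplus>j\<in>J'. A i j \<otimes> x j \<oplus> (\<ominus> (A i l \<otimes> v)) \<otimes> (A m j \<otimes> x j))"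
      proof (rule finsum_cong')
        fix j
        show "B i j \<otimes> x j = A i j \<otimes> x j \<oplus> (\<ominus> (A i l \<otimes> v)) \<otimes> (A m j \<otimes> x j)"
          unfolding B_def using insert.prems(3) x(1) c by (simp only: l_distr m_closed m_assoc)
      qed (use insert.prems(3) x c in auto)
      also have "\<dots> = S i \<oplus> (\<Oplus>j\<in>J'. (\<ominus> (A i l \<otimes> v)) \<otimes> (A m j \<otimes> x j))"
        unfolding S_def by (rule finsum_addf) (use insert.prems(3) x c in auto)
      also have "(\<Oplus>j\<in>J'. (\<ominus> (A i l \<otimes> v)) \<otimes> (A m j \<otimes> x j)) = (\<ominus> (A i l \<otimes> v)) \<otimes> S m"
        unfolding S_def by (rule finsum_rdistr[symmetric]) (use insert.prems(3) x c J' in auto)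
      finally show ?thesis .
    qed
    \<comment> \<open>The value at \<open>l\<close> is forced by equation \<open>m\<close>.\<close>
    define y where "y = x(l := \<ominus> (v \<otimes> S m))"
    have y: "y j \<in> carrier R" for j using x(1) v S by (simp add: y_def)
    have Ay: "(\<Oplus>j\<in>J. A i j \<otimes> y j) = A i l \<otimes> (\<ominus> (v \<otimes> S m)) \<oplus> S i" for i
    proof -
      have "(\<Oplus>j\<in>J'. A i j \<otimes> y j) = S i"
        unfolding S_def by (rule finsum_cong') (use insert.prems(3) x(1) J'(2) in \<open>auto simp: y_def\<close>)
      moreover have "(\<Oplus>j\<in>J. A i j \<otimes> y j) = A i l \<otimes> y l \<oplus> (\<Oplus>j\<in>J'. A i j \<otimes> y j)"
        unfolding J'(3) by (rule finsum_insert) (use insert.prems(3) y J' in auto)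
      ultimately show ?thesis by (simp add: y_def)
    qed
    have "(\<Oplus>j\<in>J. A m j \<otimes> y j) = \<zero>"
    proof -
      have "A m l \<otimes> (\<ominus> (v \<otimes> S m)) = \<ominus> (A m l \<otimes> (v \<otimes> S m))"
        by (rule r_minus) (use insert.prems(3) v S in auto)
      also have "A m l \<otimes> (v \<otimes> S m) = (A m l \<otimes> v) \<otimes> S m"
        by (rule m_assoc[symmetric]) (use insert.prems(3) v S in auto)
      finally show ?thesis using Ay[of m] S v by (simp add: l_neg)
    qed
    moreover have "(\<Oplus>j\<in>J. A i j \<otimes> y j) = \<zero>" if "i \<in> I" for i
    proof -
      have "A i l \<otimes> (\<ominus> (v \<otimes> S m)) = (\<ominus> (A i l \<otimes> v)) \<otimes> S m"
        using insert.prems(3) v S by (simp only: r_minus l_minus m_assoc m_closed)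
      moreover have "(\<ominus> (A i l \<otimes> v)) \<otimes> S m \<in> carrier R" using insert.prems(3) v S by simp
      ultimately show ?thesis
        using Ay[of i] Bx[of i] x(3)[OF that] S[of i] by (simp only: a_comm)
    qed
    moreover have "\<exists>j\<in>J. y j \<noteq> \<zero>"
    proof -
      obtain j where "j \<in> J'" "x j \<noteq> \<zero>" using x(2) by blast
      then show ?thesis using J' by (intro bexI[of _ j]) (auto simp: y_def)
    qed
    ultimately show ?thesis using y by (intro exI[of _ y]) auto
  qed
qed

text \<open>The columns of \<open>L\<close> together with the unit vector at \<open>s\<close> are
  \<open>n + 1\<close> vectors in dimension \<open>n\<close>, hence dependent. As
  \<open>H L = 1\<close> makes \<open>L\<close> injective, the unit vector takes part in the
  relation and equals \<open>L c\<close> for some \<open>c\<close>. Then column \<open>s\<close> of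
  \<open>H\<close> is \<open>H L c = c\<close>, and \<open>L\<close> maps it to the unit
  vector.\<close>

lemma (in field) left_inverse_imp_right_inverse:
  fixes H L :: "nat \<Rightarrow> nat \<Rightarrow> 'a"
  assumes H: "\<And>i j. H i j \<in> carrier R" and L: "\<And>i j. L i j \<in> carrier R"
    and HL: "\<And>i j. i < n \<Longrightarrow> j < n \<Longrightarrow> (\<Oplus>t\<in>{..<n}. H i t \<otimes> L t j) = (if i = j then \<one> else \<zero>)"
    and "i < n" "s < n"
  shows "(\<Oplus>t\<in>{..<n}. L i t \<otimes> H t s) = (if i = s then \<one> else \<zero>)"
proof -
  have HLx: "(\<Oplus>t\<in>{..<n}. H j t \<otimes> (\<Oplus>u\<in>{..<n}. L t u \<otimes> x u)) = x j"
    if "j < n" "\<And>u. x u \<in> carrier R" for j x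
  proof -
    have "(\<Oplus>t\<in>{..<n}. H j t \<otimes> (\<Oplus>u\<in>{..<n}. L t u \<otimes> x u))
        = (\<Oplus>u\<in>{..<n}. (\<Oplus>t\<in>{..<n}. H j t \<otimes> L t u) \<otimes> x u)"
      by (rule finsum_mult_assoc) (use H L that in auto)
    also have "\<dots> = (\<Oplus>u\<in>{..<n}. (if j = u then \<one> else \<zero>) \<otimes> x u)"
      by (rule finsum_cong') (use HL that in auto)
    also have "\<dots> = x j" by (rule finsum_delta) (use that in auto)
    finally show ?thesis .
  qed
  \<comment> \<open>The matrix \<open>L\<close> with the unit vector at \<open>s\<close> appended as
    column \<open>n\<close>.\<close>
  define A where "A i j = (if j < n then L i j else if i = s then \<one> else \<zero>)" for i j
  have A: "A i j \<in> carrier R" for i j using L by (simp add: A_def)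
  have "card {..<n} < card {..n}" by simp
  obtain x where x0: "\<forall>j. x j \<in> carrier R" "\<exists>j\<in>{..n}. x j \<noteq> \<zero>"
    "\<forall>i\<in>{..<n}. (\<Oplus>j\<in>{..n}. A i j \<otimes> x j) = \<zero>"
    using ex_nontrivial_solution[of "{..<n}" "{..n}" A, OF finite_lessThan finite_atMost \<open>card {..<n} < card {..n}\<close> A]
    by (elim exE conjE) (rule that)
  note x = x0(1)[rule_format] x0(2) x0(3)[rule_format]
  define Lx where "Lx i = (\<Oplus>u\<in>{..<n}. L i u \<otimes> x u)" for i
  have Lx: "Lx i \<in> carrier R" for i unfolding Lx_def by (rule finsum_closed) (use L x in auto)
  have rel: "(if i = s then \<one> else \<zero>) \<otimes> x n \<oplus> Lx i = \<zero>" if "i < n" for i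
  proof -
    have "(\<Oplus>j\<in>{..<n}. A i j \<otimes> x j) = Lx i"
      unfolding Lx_def by (rule finsum_cong') (use L x in \<open>auto simp: A_def\<close>)
    moreover have "{..n} = insert n {..<n}" by auto
    then have "(\<Oplus>j\<in>{..n}. A i j \<otimes> x j) = A i n \<otimes> x n \<oplus> (\<Oplus>j\<in>{..<n}. A i j \<otimes> x j)"
      using A x(1) by (simp add: finsum_insert Pi_def)
    ultimately show ?thesis using x(3)[of i] that by (simp add: A_def)
  qed
  \<comment> \<open>A relation among the columns of \<open>L\<close> alone is trivial, because
    \<open>x = H (L x)\<close>.\<close>
  have xn: "x n \<noteq> \<zero>"
  proof
    assume xn0: "x n = \<zero>"
    have "Lx t = \<zero>" if "t < n" for t using rel[OF that] xn0 Lx[of t] by (auto split: if_splits)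
    have "x j = \<zero>" if "j < n" for j
    proof -
      have "x j = (\<Oplus>t\<in>{..<n}. H j t \<otimes> Lx t)" using HLx[OF that x(1)] by (simp add: Lx_def)
      also have "\<dots> = (\<Oplus>t\<in>{..<n}. \<zero>)"
        by (rule finsum_cong') (use H \<open>\<And>t. t < n \<Longrightarrow> Lx t = \<zero>\<close> in auto)
      finally show ?thesis by simp
    qed
    then show False using x(2) xn0 by (metis atMost_iff le_neq_implies_less)
  qed
  then have xnU: "x n \<in> Units R" using x(1) by (simp add: field_Units)
  \<comment> \<open>The relation solved for the appended column.\<close>
  define c where "c t = \<ominus> (inv (x n) \<otimes> x t)" for t
  have c: "c t \<in> carrier R" for t using x(1) xnU by (simp add: c_def)
  have Lc: "(\<Oplus>u\<in>{..<n}. L i u \<otimes> c u) = (if i = s then \<one> else \<zero>)" if "i < n" for i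
  proof -
    have d: "\<ominus> (inv (x n)) \<in> carrier R" using xnU by simp
    have "(\<Oplus>u\<in>{..<n}. L i u \<otimes> c u) = (\<Oplus>u\<in>{..<n}. (\<ominus> (inv (x n))) \<otimes> (L i u \<otimes> x u))"
    proof (rule finsum_cong')
      fix u
      show "L i u \<otimes> c u = (\<ominus> (inv (x n))) \<otimes> (L i u \<otimes> x u)"
        unfolding c_def using L[of i u] x(1)[of u] xnU by (simp add: l_minus r_minus m_ac)
    qed (use L x(1) d in auto)
    also have "\<dots> = (\<ominus> (inv (x n))) \<otimes> Lx i"
      unfolding Lx_def by (rule finsum_rdistr[symmetric]) (use L x(1) d in auto)
    also have "Lx i = \<ominus> ((if i = s then \<one> else \<zero>) \<otimes> x n)"
      using sum_zero_eq_neg[OF Lx, of "(if i = s then \<one> else \<zero>) \<otimes> x n" i] rel[OF that] x(1)[of n] Lx[of i]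
      by (simp add: a_comm split: if_splits)
    finally show ?thesis using xnU x(1)[of n] by (simp add: l_minus r_minus)
  qed
  have "H j s = c j" if "j < n" for j
  proof -
    have "c j = (\<Oplus>t\<in>{..<n}. H j t \<otimes> (\<Oplus>u\<in>{..<n}. L t u \<otimes> c u))" using HLx[OF that c] by simp
    also have "\<dots> = (\<Oplus>t\<in>{..<n}. (if s = t then \<one> else \<zero>) \<otimes> H j t)"
      by (rule finsum_cong') (use H Lc in \<open>auto simp: m_comm\<close>)
    also have "\<dots> = H j s" by (rule finsum_delta) (use H assms(5) in auto)
    finally show ?thesis by simp
  qed
  then have "(\<Oplus>t\<in>{..<n}. L i t \<otimes> H t s) = (\<Oplus>t\<in>{..<n}. L i t \<otimes> c t)"
    by (intro finsum_cong') (use L H c in auto)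
  then show ?thesis using Lc[OF assms(4)] by simp
qed

abbreviation mpolys :: "('a, 'x) ring_scheme \<Rightarrow> nat \<Rightarrow> (nat multiset \<Rightarrow> 'a) set"
  where "mpolys R n \<equiv> carrier (mpoly_ring R n)"

lemma (in abelian_group) add_minus_cancel:
  assumes "x \<in> carrier G" "y \<in> carrier G"
  shows "x \<oplus> (y \<ominus> x) = y"
proof -
  have "x \<oplus> (y \<oplus> \<ominus> x) = (y \<oplus> \<ominus> x) \<oplus> x" by (rule a_comm) (use assms in auto)
  also have "\<dots> = y" using assms by (simp add: a_assoc l_neg)
  finally show ?thesis by (simp add: a_minus_def)
qed

section \<open>Substitutions and their coefficients of low degree\<close>

context cring
begin

lemma mpolysD: "P \<in> mpolys R n \<Longrightarrow> P \<in> polys {..<n}"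
  by (simp add: mpoly_ring_simps)

lemma mpolys_coeff: "P \<in> mpolys R n \<Longrightarrow> P u \<in> carrier R"
  using polys_closed[OF mpolysD] .

lemma subst_hom:
  assumes "y \<in> {..<n} \<rightarrow> mpolys R m"
  shows "ring_hom_cring (mpoly_ring R n) (mpoly_ring R m) (mpoly_subst R m y)"
proof -
  interpret C: ring_hom_cring R "mpoly_ring R m" indexed_const by (rule const_hom)
  interpret N: cring "mpoly_ring R n" by (rule cring_mpoly_ring)
  show ?thesis by unfold_locales (rule C.eval_hom[OF assms])
qed

lemma subst_const:
  assumes "y \<in> {..<n} \<rightarrow> mpolys R m" "c \<in> carrier R"
  shows "mpoly_subst R m y (indexed_const c) = indexed_const c"
  by (rule ring_hom_cring.eval_const[OF const_hom assms])

lemma subst_var: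
  assumes "y \<in> {..<n} \<rightarrow> mpolys R m" "i < n"
  shows "mpoly_subst R m y (indexed_var i) = y i"
  by (rule ring_hom_cring.eval_var[OF const_hom assms(1)]) (use assms(2) in simp)

lemma subst_closed:
  assumes "y \<in> {..<n} \<rightarrow> mpolys R m" "P \<in> mpolys R n"
  shows "mpoly_subst R m y P \<in> mpolys R m"
  by (rule ring_hom_closed[OF ring_hom_cring.homh[OF subst_hom[OF assms(1)]] assms(2)])

lemma const_closed: "c \<in> carrier R \<Longrightarrow> indexed_const c \<in> mpolys R n"
  by (rule ring_hom_closed[OF ring_hom_cring.homh[OF const_hom]])

lemma subst_cong:
  assumes "y \<in> {..<n} \<rightarrow> mpolys R m" "P \<in> mpolys R n" "\<And>i. i < n \<Longrightarrow> y i = z i"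
  shows "mpoly_subst R m y P = mpoly_subst R m z P"
  by (rule ring_hom_cring.eval_cong[OF const_hom mpolysD[OF assms(2)] assms(1)]) (use assms(3) in simp)

text \<open>Both sides are homomorphisms in \<open>P\<close> with the same values at constants and
  variables.\<close>

lemma subst_subst:
  assumes y: "y \<in> {..<n} \<rightarrow> mpolys R m" and z: "z \<in> {..<m} \<rightarrow> mpolys R l" and P: "P \<in> mpolys R n"
  shows "mpoly_subst R l z (mpoly_subst R m y P) = mpoly_subst R l (\<lambda>i. mpoly_subst R l z (y i)) P"
proof -
  interpret Y: ring_hom_cring "mpoly_ring R n" "mpoly_ring R m" "mpoly_subst R m y" by (rule subst_hom[OF y])
  interpret Z: ring_hom_cring "mpoly_ring R m" "mpoly_ring R l" "mpoly_subst R l z" by (rule subst_hom[OF z])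
  have w: "(\<lambda>i. mpoly_subst R l z (y i)) \<in> {..<n} \<rightarrow> mpolys R l"
    using y by (auto intro!: subst_closed[OF z])
  interpret W: ring_hom_cring "mpoly_ring R n" "mpoly_ring R l" "mpoly_subst R l (\<lambda>i. mpoly_subst R l z (y i))"
    by (rule subst_hom[OF w])
  have ZY: "(\<lambda>P. mpoly_subst R l z (mpoly_subst R m y P)) \<in> ring_hom (mpoly_ring R n) (mpoly_ring R l)"
    using ring_hom_trans[OF Y.homh Z.homh] by (simp add: comp_def)
  show ?thesis
    by (rule mpoly_hom_eqI[OF is_cring cring_mpoly_ring ZY W.homh _ _ P])
      (simp_all add: subst_const[OF y] subst_const[OF z] subst_const[OF w] subst_var[OF y] subst_var[OF w])
qed

lemma mult_const_coeff:
  assumes "c \<in> carrier R" "P \<in> mpolys R n"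
  shows "(indexed_const c \<otimes>\<^bsub>mpoly_ring R n\<^esub> P) u = c \<otimes> P u"
  using mpoly_mult_const[OF assms(1) polys_coeff[OF mpolysD[OF assms(2)]]]
  by (simp add: mpoly_ring_simps)

lemma add_coeff: "(P \<oplus>\<^bsub>mpoly_ring R n\<^esub> Q) u = P u \<oplus> Q u"
  by (simp add: mpoly_ring_simps indexed_padd_def)

lemma zero_coeff: "\<zero>\<^bsub>mpoly_ring R n\<^esub> u = \<zero>"
  by (simp add: mpoly_ring_simps indexed_const_def)

lemma minus_coeff:
  assumes "P \<in> mpolys R n"
  shows "(\<ominus>\<^bsub>mpoly_ring R n\<^esub> P) u = \<ominus> P u"
proof -
  interpret M: cring "mpoly_ring R n" by (rule cring_mpoly_ring)
  have "(\<ominus>\<^bsub>mpoly_ring R n\<^esub> P) u \<oplus> P u = \<zero>"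
    using add_coeff[of n "\<ominus>\<^bsub>mpoly_ring R n\<^esub> P" P u] M.l_neg[OF assms] zero_coeff[of n u] by simp
  then show ?thesis
    using minus_equality[of "(\<ominus>\<^bsub>mpoly_ring R n\<^esub> P) u" "P u"] mpolys_coeff[OF assms]
      mpolys_coeff[OF M.a_inv_closed[OF assms]] by simp
qed

lemma diff_coeff:
  assumes "P \<in> mpolys R n" "Q \<in> mpolys R n"
  shows "(P \<ominus>\<^bsub>mpoly_ring R n\<^esub> Q) u = P u \<ominus> Q u"
  by (simp add: a_minus_def add_coeff minus_coeff[OF assms(2)])

lemma sum_coeff:
  assumes "finite A" "f \<in> A \<rightarrow> mpolys R n"
  shows "(\<Oplus>\<^bsub>mpoly_ring R n\<^esub>t\<in>A. f t) u = (\<Oplus>t\<in>A. f t u)"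
  using assms
proof (induction A)
  case empty
  interpret M: cring "mpoly_ring R n" by (rule cring_mpoly_ring)
  show ?case by (simp add: zero_coeff)
next
  case (insert a A)
  interpret M: cring "mpoly_ring R n" by (rule cring_mpoly_ring)
  have "(\<Oplus>\<^bsub>mpoly_ring R n\<^esub>t\<in>insert a A. f t) = f a \<oplus>\<^bsub>mpoly_ring R n\<^esub> (\<Oplus>\<^bsub>mpoly_ring R n\<^esub>t\<in>A. f t)"
    by (rule M.finsum_insert) (use insert in auto)
  moreover have "(\<Oplus>t\<in>insert a A. f t u) = f a u \<oplus> (\<Oplus>t\<in>A. f t u)"
    by (rule finsum_insert) (use insert mpolys_coeff in auto)
  ultimately show ?case using insert by (simp add: add_coeff)
qed

lemma mult_coeff_empty:
  assumes "P \<in> polys I" "Q \<in> polys I"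
  shows "mpoly_mult R P Q {#} = P {#} \<otimes> Q {#}"
proof -
  have "{v. v \<subseteq># {#}} = {{#} :: nat multiset}" by auto
  then show ?thesis
    using polys_closed[OF assms(1)] polys_closed[OF assms(2)] by (simp add: mpoly_mult_def a_comm)
qed

lemma mult_coeff_single:
  assumes "P \<in> polys I" "Q \<in> polys I"
  shows "mpoly_mult R P Q {#s#} = P {#} \<otimes> Q {#s#} \<oplus> P {#s#} \<otimes> Q {#}"
proof -
  have "v = {#} \<or> v = {#s#}" if "v \<subseteq># {#s#}" for v :: "nat multiset"
    using that by (cases v) (auto simp: insert_subset_eq_iff)
  then have "{v. v \<subseteq># {#s#}} = {{#}, {#s#} :: nat multiset}" by auto
  then show ?thesis
    using polys_closed[OF assms(1)] polys_closed[OF assms(2)] by (simp add: mpoly_mult_def a_comm)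
qed

text \<open>The chain rule at the origin: without constant terms in \<open>y\<close>, a monomial of
  degree at least two contributes nothing in degree at most one, so linear parts compose by matrix
  multiplication.\<close>

lemma subst_coeff_low:
  assumes y: "y \<in> {..<n} \<rightarrow> mpolys R m" and y0: "\<And>t. t < n \<Longrightarrow> y t {#} = \<zero>" and P: "P \<in> mpolys R n"
  shows "mpoly_subst R m y P {#} = P {#}"
    and "mpoly_subst R m y P {#s#} = (\<Oplus>t\<in>{..<n}. P {#t#} \<otimes> y t {#s#})"
proof -
  interpret C: ring_hom_cring R "mpoly_ring R m" indexed_const by (rule const_hom)
  have yc: "y t {#s#} \<in> carrier R" if "t < n" for t
    by (rule mpolys_coeff[of _ m]) (use y that in auto)
  have yp: "y t \<in> polys {..<m}" if "t < n" for t
    by (rule mpolysD) (use y that in auto)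
  have "mpoly_subst R m y P {#} = P {#} \<and> mpoly_subst R m y P {#s#} = (\<Oplus>t\<in>{..<n}. P {#t#} \<otimes> y t {#s#})"
    using is_cring mpolysD[OF P]
  proof (induction rule: polys_induct)
    case (const c)
    have "(\<Oplus>t\<in>{..<n}. indexed_const c {#t#} \<otimes> y t {#s#}) = (\<Oplus>t\<in>{..<n}. \<zero>)"
      by (rule finsum_cong') (use yc in \<open>auto simp: indexed_const_def\<close>)
    then show ?case using const by (simp add: C.eval_const[OF y]) (simp add: indexed_const_def)
  next
    case (padd P Q)
    note c = polys_closed[OF padd.hyps(1)] polys_closed[OF padd.hyps(2)]
    have "(\<Oplus>t\<in>{..<n}. (indexed_padd P Q) {#t#} \<otimes> y t {#s#})
        = (\<Oplus>t\<in>{..<n}. P {#t#} \<otimes> y t {#s#} \<oplus> Q {#t#} \<otimes> y t {#s#})"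
      by (rule finsum_cong') (use yc c in \<open>auto simp: indexed_padd_def l_distr\<close>)
    also have "\<dots> = (\<Oplus>t\<in>{..<n}. P {#t#} \<otimes> y t {#s#}) \<oplus> (\<Oplus>t\<in>{..<n}. Q {#t#} \<otimes> y t {#s#})"
      by (rule finsum_addf) (use yc c in auto)
    finally show ?case
      using padd.IH by (simp add: C.eval_padd[OF y padd.hyps] add_coeff) (simp add: indexed_padd_def)
  next
    case (pmult P i)
    note c = polys_closed[OF pmult.hyps(1)]
    have i: "i < n" using pmult by simp
    have sp: "mpoly_subst R m y P \<in> polys {..<m}"
      by (rule mpolysD[OF subst_closed[OF y]]) (use pmult in \<open>simp add: mpoly_ring_simps\<close>)
    have "(\<Oplus>t\<in>{..<n}. (indexed_pmult P i) {#t#} \<otimes> y t {#s#})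
        = (\<Oplus>t\<in>{..<n}. if i = t then P {#} \<otimes> y t {#s#} else \<zero>)"
      by (rule finsum_cong') (use yc c in \<open>auto simp: indexed_pmult_def\<close>)
    also have "\<dots> = P {#} \<otimes> y i {#s#}"
      by (rule finsum_singleton) (use yc c i in auto)
    finally have sum: "(\<Oplus>t\<in>{..<n}. (indexed_pmult P i) {#t#} \<otimes> y t {#s#}) = P {#} \<otimes> y i {#s#}" .
    have "mpoly_subst R m y (indexed_pmult P i) = mpoly_mult R (mpoly_subst R m y P) (y i)"
      using C.eval_pmult[OF y pmult.hyps] by (simp add: mpoly_ring_simps)
    moreover have "(\<Oplus>t\<in>{..<n}. P {#t#} \<otimes> y t {#s#}) \<in> carrier R"
      using polys_closed[OF sp, of "{#s#}"] pmult.IH by simp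
    ultimately show ?case
      using mult_coeff_empty[OF sp yp[OF i]] mult_coeff_single[OF sp yp[OF i], of s] y0[OF i]
        pmult.IH sum yc[OF i] c polys_closed[OF sp]
      by (simp add: indexed_pmult_def)
  qed
  then show "mpoly_subst R m y P {#} = P {#}"
    and "mpoly_subst R m y P {#s#} = (\<Oplus>t\<in>{..<n}. P {#t#} \<otimes> y t {#s#})" by blast+
qed

lemma var_coeff: "indexed_var i {#} = \<zero>" "indexed_var i {#s#} = (if s = i then \<one> else \<zero>)"
  by (auto simp: indexed_var_def indexed_pmult_def indexed_const_def)

text \<open>The substitution \<open>Z \<mapsto> cZ\<close> weights a monomial by its degree. In
  particular a polynomial without constant term acquires a factor \<open>c\<close>, which is what is
  divided out in \<open>coordinate_path\<close>.\<close>

lemma subst_scale_coeff: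
  assumes c: "c \<in> carrier R" and P: "P \<in> mpolys R n"
  shows "mpoly_subst R n (\<lambda>i. indexed_const c \<otimes>\<^bsub>mpoly_ring R n\<^esub> indexed_var i) P u = P u \<otimes> c [^] size u"
proof -
  interpret M: cring "mpoly_ring R n" by (rule cring_mpoly_ring)
  interpret C: ring_hom_cring R "mpoly_ring R n" indexed_const by (rule const_hom)
  define y where "y = (\<lambda>i. indexed_const c \<otimes>\<^bsub>mpoly_ring R n\<^esub> indexed_var i)"
  have y: "y \<in> {..<n} \<rightarrow> mpolys R n"
    unfolding y_def using const_closed[OF c] mpoly_var_closed by auto
  have "\<forall>u. mpoly_subst R n y P u = P u \<otimes> c [^] size u"
    using is_cring mpolysD[OF P]
  proof (induction rule: polys_induct)
    case (const d)
    then show ?case by (simp add: C.eval_const[OF y]) (simp add: indexed_const_def c)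
  next
    case (padd P Q)
    then show ?case
      using polys_closed[OF padd.hyps(1)] polys_closed[OF padd.hyps(2)] c
      by (simp add: C.eval_padd[OF y padd.hyps] add_coeff) (simp add: indexed_padd_def l_distr)
  next
    case (pmult P i)
    have i: "i < n" using pmult by simp
    have sp: "mpoly_subst R n y P \<in> mpolys R n"
      by (rule subst_closed[OF y]) (use pmult in \<open>simp add: mpoly_ring_simps\<close>)
    have "mpoly_subst R n y (indexed_pmult P i) = indexed_const c \<otimes>\<^bsub>mpoly_ring R n\<^esub> (mpoly_subst R n y P \<otimes>\<^bsub>mpoly_ring R n\<^esub> indexed_var i)"
      using C.eval_pmult[OF y pmult.hyps] sp const_closed[OF c, of n] mpoly_var_closed[OF i]
      by (simp add: y_def M.m_ac)
    also have "mpoly_subst R n y P \<otimes>\<^bsub>mpoly_ring R n\<^esub> indexed_var i = indexed_pmult (mpoly_subst R n y P) i"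
      using pmult_eq_mult[OF mpolysD[OF sp]] by (simp add: mpoly_ring_simps)
    finally have eq: "mpoly_subst R n y (indexed_pmult P i)
        = indexed_const c \<otimes>\<^bsub>mpoly_ring R n\<^esub> indexed_pmult (mpoly_subst R n y P) i" .
    have sp': "indexed_pmult (mpoly_subst R n y P) i \<in> mpolys R n"
      using indexed_pset.indexed_pmult[OF mpolysD[OF sp], of i] i by (simp add: mpoly_ring_simps)
    show ?case
    proof
      fix u
      show "mpoly_subst R n y (indexed_pmult P i) u = indexed_pmult P i u \<otimes> c [^] size u"
      proof (cases "i \<in># u")
        case True
        then have "size u = Suc (size (u - {#i#}))" by (metis size_Suc_Diff1)
        then show ?thesis
          unfolding eq mult_const_coeff[OF c sp']
          using pmult.IH True polys_closed[OF pmult.hyps(1)] c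
          by (simp add: indexed_pmult_def m_ac)
      next
        case False
        then show ?thesis
          unfolding eq mult_const_coeff[OF c sp'] using c by (simp add: indexed_pmult_def)
      qed
    qed
  qed
  then show ?thesis by (simp add: y_def)
qed

end

context ring_hom_cring
begin

lemma map_closed: "P \<in> mpolys R n \<Longrightarrow> mpoly_map h P \<in> mpolys S n"
  using map_polys by (simp add: mpoly_ring_simps)

lemma map_hom_cring: "ring_hom_cring (mpoly_ring R n) (mpoly_ring S n) (mpoly_map h)"
proof -
  interpret M: cring "mpoly_ring R n" by (rule R.cring_mpoly_ring)
  interpret N: cring "mpoly_ring S n" by (rule S.cring_mpoly_ring)
  show ?thesis by unfold_locales (rule map_hom)
qed

text \<open>Lets an identity between systems of polynomials pass from one coefficient ring to
  another; it is checked at constants and variables.\<close>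

lemma map_subst:
  assumes y: "y \<in> {..<n} \<rightarrow> mpolys R m" and P: "P \<in> mpolys R n"
  shows "mpoly_map h (mpoly_subst R m y P) = mpoly_subst S m (\<lambda>i. mpoly_map h (y i)) (mpoly_map h P)"
proof -
  interpret Y: ring_hom_cring "mpoly_ring R n" "mpoly_ring R m" "mpoly_subst R m y" by (rule R.subst_hom[OF y])
  interpret Hm: ring_hom_cring "mpoly_ring R m" "mpoly_ring S m" "mpoly_map h" by (rule map_hom_cring)
  interpret Hn: ring_hom_cring "mpoly_ring R n" "mpoly_ring S n" "mpoly_map h" by (rule map_hom_cring)
  have w: "(\<lambda>i. mpoly_map h (y i)) \<in> {..<n} \<rightarrow> mpolys S m"
    using y by (auto intro!: map_closed)
  interpret W: ring_hom_cring "mpoly_ring S n" "mpoly_ring S m" "mpoly_subst S m (\<lambda>i. mpoly_map h (y i))"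
    by (rule S.subst_hom[OF w])
  have 1: "(\<lambda>P. mpoly_map h (mpoly_subst R m y P)) \<in> ring_hom (mpoly_ring R n) (mpoly_ring S m)"
    using ring_hom_trans[OF Y.homh Hm.homh] by (simp add: comp_def)
  have 2: "(\<lambda>P. mpoly_subst S m (\<lambda>i. mpoly_map h (y i)) (mpoly_map h P)) \<in> ring_hom (mpoly_ring R n) (mpoly_ring S m)"
    using ring_hom_trans[OF Hn.homh W.homh] by (simp add: comp_def)
  show ?thesis
    by (rule mpoly_hom_eqI[OF R.is_cring S.cring_mpoly_ring 1 2 _ _ P])
      (simp_all add: R.subst_const[OF y] S.subst_const[OF w] R.subst_var[OF y] S.subst_var[OF w]
        map_const map_var)
qed

end

lemma (in ring_hom_cring) hom_lincomb:
  assumes "finite A" "c \<in> A \<rightarrow> carrier R" "y \<in> A \<rightarrow> carrier R"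
  shows "h (\<Oplus>t\<in>A. c t \<otimes> y t) = (\<Oplus>\<^bsub>S\<^esub>t\<in>A. h (c t) \<otimes>\<^bsub>S\<^esub> h (y t))"
proof -
  have "h (\<Oplus>t\<in>A. c t \<otimes> y t) = (\<Oplus>\<^bsub>S\<^esub>t\<in>A. h (c t \<otimes> y t))"
    using hom_finsum[of "\<lambda>t. c t \<otimes> y t" A] assms by (auto simp: comp_def Pi_def)
  also have "\<dots> = (\<Oplus>\<^bsub>S\<^esub>t\<in>A. h (c t) \<otimes>\<^bsub>S\<^esub> h (y t))"
  proof (rule S.finsum_cong')
    fix t assume "t \<in> A"
    then show "h (c t \<otimes> y t) = h (c t) \<otimes>\<^bsub>S\<^esub> h (y t)"
      using hom_mult[OF funcset_mem[OF assms(2)] funcset_mem[OF assms(3)]] by simp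
  qed (use assms in auto)
  finally show ?thesis .
qed

section \<open>Coordinate systems\<close>

text \<open>A row of scalars times a family of polynomials: with \<open>c\<close> a row of a matrix,
  this is how the linear part of one system acts on another.\<close>

definition lincomb :: "('a, 'x) ring_scheme \<Rightarrow> nat \<Rightarrow> (nat \<Rightarrow> 'a) \<Rightarrow> (nat \<Rightarrow> nat multiset \<Rightarrow> 'a) \<Rightarrow> nat multiset \<Rightarrow> 'a"
  where "lincomb R n c y
    = (\<Oplus>\<^bsub>mpoly_ring R n\<^esub>t\<in>{..<n}. ring.indexed_const R (c t) \<otimes>\<^bsub>mpoly_ring R n\<^esub> y t)"

context cring
begin

lemma lincomb_closed:
  assumes "\<And>t. c t \<in> carrier R" "y \<in> {..<n} \<rightarrow> mpolys R n"
  shows "lincomb R n c y \<in> mpolys R n"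
proof -
  interpret M: cring "mpoly_ring R n" by (rule cring_mpoly_ring)
  have "indexed_const (c t) \<otimes>\<^bsub>mpoly_ring R n\<^esub> y t \<in> mpolys R n" if "t < n" for t
    by (rule M.m_closed[OF const_closed[OF assms(1)]]) (use assms(2) that in auto)
  then show ?thesis unfolding lincomb_def by (intro M.finsum_closed) auto
qed

lemma lincomb_coeff:
  assumes "\<And>t. c t \<in> carrier R" "y \<in> {..<n} \<rightarrow> mpolys R n"
  shows "lincomb R n c y u = (\<Oplus>t\<in>{..<n}. c t \<otimes> y t u)"
proof -
  interpret M: cring "mpoly_ring R n" by (rule cring_mpoly_ring)
  have yt: "y t \<in> mpolys R n" if "t < n" for t using assms(2) that by auto
  have m: "indexed_const (c t) \<otimes>\<^bsub>mpoly_ring R n\<^esub> y t \<in> mpolys R n" if "t < n" for t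
    by (rule M.m_closed[OF const_closed[OF assms(1)] yt[OF that]])
  have "lincomb R n c y u = (\<Oplus>t\<in>{..<n}. (indexed_const (c t) \<otimes>\<^bsub>mpoly_ring R n\<^esub> y t) u)"
    unfolding lincomb_def by (rule sum_coeff) (use m in auto)
  also have "\<dots> = (\<Oplus>t\<in>{..<n}. c t \<otimes> y t u)"
  proof (rule finsum_cong')
    fix t assume "t \<in> {..<n}"
    then show "(indexed_const (c t) \<otimes>\<^bsub>mpoly_ring R n\<^esub> y t) u = c t \<otimes> y t u"
      by (intro mult_const_coeff assms(1) yt) simp
  qed (use assms(1) mpolys_coeff[OF yt] in auto)
  finally show ?thesis .
qed

lemma lincomb_cong:
  assumes "\<And>t. c t \<in> carrier R" "y \<in> {..<n} \<rightarrow> mpolys R n" "\<And>t. t < n \<Longrightarrow> z t = y t"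
  shows "lincomb R n c z = lincomb R n c y"
proof -
  interpret M: cring "mpoly_ring R n" by (rule cring_mpoly_ring)
  have yt: "y t \<in> mpolys R n" if "t < n" for t using assms(2) that by auto
  show ?thesis
    unfolding lincomb_def
    by (rule M.finsum_cong') (use assms(3) M.m_closed[OF const_closed[OF assms(1)] yt] in auto)
qed

lemma subst_lincomb:
  assumes "\<And>t. c t \<in> carrier R" "y \<in> {..<n} \<rightarrow> mpolys R n" "z \<in> {..<n} \<rightarrow> mpolys R n"
  shows "mpoly_subst R n z (lincomb R n c y) = lincomb R n c (\<lambda>t. mpoly_subst R n z (y t))"
proof -
  interpret Z: ring_hom_cring "mpoly_ring R n" "mpoly_ring R n" "mpoly_subst R n z"
    by (rule subst_hom[OF assms(3)])
  have "mpoly_subst R n z (lincomb R n c y) = (\<Oplus>\<^bsub>mpoly_ring R n\<^esub>t\<in>{..<n}.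
      mpoly_subst R n z (indexed_const (c t)) \<otimes>\<^bsub>mpoly_ring R n\<^esub> mpoly_subst R n z (y t))"
    unfolding lincomb_def
    by (rule Z.hom_lincomb) (use const_closed[OF assms(1)] assms(2) in auto)
  then show ?thesis
    unfolding lincomb_def by (simp only: subst_const[OF assms(3) assms(1)])
qed

lemma lincomb_assoc:
  assumes "\<And>t. f t \<in> carrier R" "\<And>t u. g t u \<in> carrier R" "y \<in> {..<n} \<rightarrow> mpolys R n"
  shows "lincomb R n f (\<lambda>t. lincomb R n (g t) y) = lincomb R n (\<lambda>u. \<Oplus>t\<in>{..<n}. f t \<otimes> g t u) y"
proof
  fix w
  have yt: "y t \<in> mpolys R n" if "t < n" for t using assms(3) that by auto
  have gy: "(\<lambda>t. lincomb R n (g t) y) \<in> {..<n} \<rightarrow> mpolys R n"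
    using lincomb_closed[OF assms(2) assms(3)] by auto
  have fg: "(\<Oplus>t\<in>{..<n}. f t \<otimes> g t u) \<in> carrier R" for u
    by (rule finsum_closed) (use assms in auto)
  have "(\<Oplus>t\<in>{..<n}. f t \<otimes> (\<Oplus>u\<in>{..<n}. g t u \<otimes> y u w))
      = (\<Oplus>u\<in>{..<n}. (\<Oplus>t\<in>{..<n}. f t \<otimes> g t u) \<otimes> y u w)"
    by (rule finsum_mult_assoc) (use assms(1,2) mpolys_coeff[OF yt] in auto)
  then show "lincomb R n f (\<lambda>t. lincomb R n (g t) y) w = lincomb R n (\<lambda>u. \<Oplus>t\<in>{..<n}. f t \<otimes> g t u) y w"
    by (simp add: lincomb_coeff[OF assms(1) gy] lincomb_coeff[OF assms(2,3)] lincomb_coeff[OF fg assms(3)])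
qed

lemma lincomb_delta:
  assumes "j < n" "y \<in> {..<n} \<rightarrow> mpolys R n" "\<And>t. c t \<in> carrier R"
    and "\<And>t. t < n \<Longrightarrow> c t = (if j = t then \<one> else \<zero>)"
  shows "lincomb R n c y = y j"
proof
  fix u
  have yt: "y t \<in> mpolys R n" if "t < n" for t using assms(2) that by auto
  have "lincomb R n c y u = (\<Oplus>t\<in>{..<n}. (if j = t then \<one> else \<zero>) \<otimes> y t u)"
    unfolding lincomb_coeff[OF assms(3,2)]
    by (rule finsum_cong') (use assms(4) mpolys_coeff[OF yt] in auto)
  also have "\<dots> = y j u"
    by (rule finsum_delta) (use assms(1) mpolys_coeff[OF yt] in auto)
  finally show "lincomb R n c y u = y j u" .
qed

end

text \<open>\<open>\<gamma>\<close> is the translated system \<open>g - g(0)\<close> multiplied by the inverse of its linear part, which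
  exists by the chain rule; the equation for \<open>g 0\<close> makes \<open>P\<close> affine at a point.\<close>

lemma (in field) normalise_coordinates:
  assumes g: "g \<in> {..<n} \<rightarrow> mpolys R n" and h: "h \<in> {..<n} \<rightarrow> mpolys R n"
    and gh: "\<And>j. j < n \<Longrightarrow> mpoly_subst R n g (h j) = indexed_var j" and n: "0 < n"
  obtains p l \<gamma> \<eta> where "p \<in> carrier R" "\<And>t. l t \<in> carrier R" "\<exists>t<n. l t \<noteq> \<zero>"
    "\<gamma> \<in> {..<n} \<rightarrow> mpolys R n" "\<eta> \<in> {..<n} \<rightarrow> mpolys R n"
    "\<And>j. j < n \<Longrightarrow> \<gamma> j {#} = \<zero>" "\<And>j. j < n \<Longrightarrow> \<eta> j {#} = \<zero>"
    "\<And>j s. j < n \<Longrightarrow> s < n \<Longrightarrow> \<gamma> j {#s#} = (if j = s then \<one> else \<zero>)"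
    "\<And>j. j < n \<Longrightarrow> mpoly_subst R n \<gamma> (\<eta> j) = indexed_var j"
    "g 0 = indexed_const p \<oplus>\<^bsub>mpoly_ring R n\<^esub> lincomb R n l \<gamma>"
proof -
  interpret M: cring "mpoly_ring R n" by (rule cring_mpoly_ring)
  have gj: "g j \<in> mpolys R n" "h j \<in> mpolys R n" if "j < n" for j using g h that by auto
  define p where "p j = (if j < n then g j {#} else \<zero>)" for j
  have p: "p j \<in> carrier R" for j using mpolys_coeff[OF gj(1)] by (simp add: p_def)
  define G where "G j = g j \<ominus>\<^bsub>mpoly_ring R n\<^esub> indexed_const (p j)" for j
  have Gj: "G j \<in> mpolys R n" if "j < n" for j
    unfolding G_def by (rule M.minus_closed[OF gj(1)[OF that] const_closed[OF p]])
  then have G: "G \<in> {..<n} \<rightarrow> mpolys R n" by auto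
  have gG: "g j = indexed_const (p j) \<oplus>\<^bsub>mpoly_ring R n\<^esub> G j" if "j < n" for j
  proof -
    have "indexed_const (p j) \<oplus>\<^bsub>mpoly_ring R n\<^esub> (g j \<ominus>\<^bsub>mpoly_ring R n\<^esub> indexed_const (p j)) = g j"
      by (rule M.add_minus_cancel[OF const_closed[OF p] gj(1)[OF that]])
    then show ?thesis by (simp add: G_def)
  qed
  have G0: "G j {#} = \<zero>" if "j < n" for j
  proof -
    have "G j {#} = g j {#} \<ominus> (indexed_const (p j) :: nat multiset \<Rightarrow> 'a) {#}"
      unfolding G_def by (rule diff_coeff[OF gj(1)[OF that] const_closed[OF p[of j]]])
    then show ?thesis using that mpolys_coeff[OF gj(1)[OF that]] by (simp add: indexed_const_def p_def)
  qed
  \<comment> \<open>Since \<open>g\<close> is the translate of \<open>G\<close> by \<open>p\<close>,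
    an inverse of \<open>G\<close> arises from \<open>h\<close> by first translating its variables
    by \<open>p\<close>.\<close>
  define tr where "tr j = indexed_const (p j) \<oplus>\<^bsub>mpoly_ring R n\<^esub> indexed_var j" for j
  have tr: "tr \<in> {..<n} \<rightarrow> mpolys R n"
    unfolding tr_def using M.a_closed[OF const_closed[OF p] mpoly_var_closed] by simp
  define H where "H j = mpoly_subst R n tr (h j)" for j
  have Hj: "H j \<in> mpolys R n" if "j < n" for j
    unfolding H_def by (rule subst_closed[OF tr gj(2)[OF that]])
  interpret GG: ring_hom_cring "mpoly_ring R n" "mpoly_ring R n" "mpoly_subst R n G"
    by (rule subst_hom[OF G])
  have Gtr: "mpoly_subst R n G (tr j) = g j" if "j < n" for j
    unfolding tr_def GG.hom_add[OF const_closed[OF p[of j]] mpoly_var_closed[OF that]]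
      subst_const[OF G p] subst_var[OF G that] gG[OF that] by (rule refl)
  have GH: "mpoly_subst R n G (H j) = indexed_var j" if "j < n" for j
  proof -
    have "mpoly_subst R n G (H j) = mpoly_subst R n (\<lambda>i. mpoly_subst R n G (tr i)) (h j)"
      unfolding H_def by (rule subst_subst[OF tr G gj(2)[OF that]])
    also have "\<dots> = mpoly_subst R n g (h j)"
      by (rule subst_cong[OF _ gj(2)[OF that] Gtr]) (use subst_closed[OF G] tr in auto)
    finally show ?thesis using gh[OF that] by simp
  qed
  \<comment> \<open>Compare constant terms in \<open>H(G(Z)) = Z\<close>: as \<open>G\<close> has
    none, that of \<open>H\<close> survives on the left.\<close>
  have H0: "H j {#} = \<zero>" if "j < n" for j
    using subst_coeff_low(1)[OF G G0 Hj[OF that]] GH[OF that] by (simp add: var_coeff)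
  \<comment> \<open>The linear parts of \<open>H\<close> and \<open>G\<close>. They are zero outside
    the range because \<open>left_inverse_imp_right_inverse\<close> asks for scalars at all
    indices.\<close>
  define Hm where "Hm j t = (if j < n then H j {#t#} else \<zero>)" for j t
  define Lm where "Lm t s = (if t < n then G t {#s#} else \<zero>)" for t s
  have Hm: "Hm j t \<in> carrier R" for j t using mpolys_coeff[OF Hj] by (simp add: Hm_def)
  have Lm: "Lm t s \<in> carrier R" for t s using mpolys_coeff[OF Gj] by (simp add: Lm_def)
  have HL: "(\<Oplus>t\<in>{..<n}. Hm j t \<otimes> Lm t s) = (if j = s then \<one> else \<zero>)" if "j < n" "s < n" for j s
  proof -
    have "(\<Oplus>t\<in>{..<n}. Hm j t \<otimes> Lm t s) = (\<Oplus>t\<in>{..<n}. H j {#t#} \<otimes> G t {#s#})"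
      by (rule finsum_cong') (use that mpolys_coeff[OF Hj] mpolys_coeff[OF Gj] in \<open>auto simp: Hm_def Lm_def\<close>)
    also have "\<dots> = mpoly_subst R n G (H j) {#s#}"
      using subst_coeff_low(2)[OF G G0 Hj[OF that(1)], of s] by simp
    finally show ?thesis using GH[OF that(1)] by (simp add: var_coeff)
  qed
  \<comment> \<open>The chain rule gives only one of the two products; the other one is what
    recovers \<open>G\<close> from \<open>\<gamma>\<close> below.\<close>
  have LH: "(\<Oplus>t\<in>{..<n}. Lm j t \<otimes> Hm t s) = (if j = s then \<one> else \<zero>)" if "j < n" "s < n" for j s
    by (rule left_inverse_imp_right_inverse[where H = Hm and L = Lm, OF Hm Lm HL that])
  define \<gamma> where "\<gamma> j = lincomb R n (Hm j) G" for j
  have \<gamma>: "\<gamma> j \<in> mpolys R n" for j unfolding \<gamma>_def by (rule lincomb_closed[OF Hm G])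
  then have \<gamma>': "\<gamma> \<in> {..<n} \<rightarrow> mpolys R n" by auto
  have \<gamma>coeff: "\<gamma> j u = (\<Oplus>t\<in>{..<n}. Hm j t \<otimes> G t u)" for j u
    unfolding \<gamma>_def by (rule lincomb_coeff[OF Hm G])
  have \<gamma>0: "\<gamma> j {#} = \<zero>" for j
  proof -
    have "\<gamma> j {#} = (\<Oplus>t\<in>{..<n}. \<zero>)"
      unfolding \<gamma>coeff by (rule finsum_cong') (use G0 Hm in auto)
    then show ?thesis by simp
  qed
  have \<gamma>1: "\<gamma> j {#s#} = (if j = s then \<one> else \<zero>)" if "j < n" "s < n" for j s
  proof -
    have "\<gamma> j {#s#} = (\<Oplus>t\<in>{..<n}. Hm j t \<otimes> Lm t s)"
      unfolding \<gamma>coeff by (rule finsum_cong') (use Hm mpolys_coeff[OF Gj] in \<open>auto simp: Lm_def\<close>)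
    then show ?thesis using HL[OF that] by simp
  qed
  have LHc: "(\<Oplus>t\<in>{..<n}. Lm j t \<otimes> Hm t u) \<in> carrier R" for j u
    by (rule finsum_closed) (use Lm Hm in auto)
  have L\<gamma>: "lincomb R n (Lm j) \<gamma> = G j" if "j < n" for j
    unfolding \<gamma>_def lincomb_assoc[OF Lm Hm G]
    by (rule lincomb_delta[OF that G LHc]) (rule LH[OF that])
  \<comment> \<open>The linear system with matrix \<open>Lm\<close>: evaluated at
    \<open>\<gamma>\<close> it returns \<open>G\<close>, so that \<open>\<eta> = H(L'(Z))\<close>
    inverts \<open>\<gamma>\<close>.\<close>
  define L' where "L' t = lincomb R n (Lm t) indexed_var" for t
  have v: "indexed_var \<in> {..<n} \<rightarrow> mpolys R n" using mpoly_var_closed by auto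
  have L': "L' t \<in> mpolys R n" for t unfolding L'_def by (rule lincomb_closed[OF Lm v])
  then have L'f: "L' \<in> {..<n} \<rightarrow> mpolys R n" by auto
  have L'0: "L' t {#} = \<zero>" for t
  proof -
    have "L' t {#} = (\<Oplus>u\<in>{..<n}. \<zero>)"
      unfolding L'_def lincomb_coeff[OF Lm v] by (rule finsum_cong') (use Lm in \<open>auto simp: var_coeff\<close>)
    then show ?thesis by simp
  qed
  define \<eta> where "\<eta> j = mpoly_subst R n L' (H j)" for j
  have \<eta>: "\<eta> j \<in> mpolys R n" if "j < n" for j
    unfolding \<eta>_def by (rule subst_closed[OF L'f Hj[OF that]])
  have \<eta>0: "\<eta> j {#} = \<zero>" if "j < n" for j
    unfolding \<eta>_def using subst_coeff_low(1)[OF L'f L'0 Hj[OF that]] H0[OF that] by simp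
  have \<gamma>L': "mpoly_subst R n \<gamma> (L' t) = G t" if "t < n" for t
  proof -
    have "mpoly_subst R n \<gamma> (L' t) = lincomb R n (Lm t) (\<lambda>u. mpoly_subst R n \<gamma> (indexed_var u))"
      unfolding L'_def by (rule subst_lincomb[OF Lm v \<gamma>'])
    also have "\<dots> = lincomb R n (Lm t) \<gamma>"
      by (rule lincomb_cong[OF Lm \<gamma>']) (rule subst_var[OF \<gamma>'])
    finally show ?thesis using L\<gamma>[OF that] by simp
  qed
  have \<gamma>\<eta>: "mpoly_subst R n \<gamma> (\<eta> j) = indexed_var j" if "j < n" for j
  proof -
    have "mpoly_subst R n \<gamma> (\<eta> j) = mpoly_subst R n (\<lambda>i. mpoly_subst R n \<gamma> (L' i)) (H j)"
      unfolding \<eta>_def by (rule subst_subst[OF L'f \<gamma>' Hj[OF that]])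
    also have "\<dots> = mpoly_subst R n G (H j)"
      by (rule subst_cong[OF _ Hj[OF that] \<gamma>L']) (use subst_closed[OF \<gamma>' L'] in auto)
    finally show ?thesis using GH[OF that] by simp
  qed
  \<comment> \<open>A zero row would contradict the first diagonal entry of
    \<open>Lm Hm = 1\<close>.\<close>
  have "\<exists>t<n. Lm 0 t \<noteq> \<zero>"
  proof (rule ccontr)
    assume "\<not> (\<exists>t<n. Lm 0 t \<noteq> \<zero>)"
    then have "(\<Oplus>t\<in>{..<n}. Lm 0 t \<otimes> Hm t 0) = (\<Oplus>t\<in>{..<n}. \<zero>)"
      by (intro finsum_cong') (use Hm in auto)
    then show False using LH[OF n n] by simp
  qed
  moreover have "g 0 = indexed_const (p 0) \<oplus>\<^bsub>mpoly_ring R n\<^esub> lincomb R n (Lm 0) \<gamma>"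
    using gG[OF n] L\<gamma>[OF n] by simp
  moreover have "\<eta> \<in> {..<n} \<rightarrow> mpolys R n" using \<eta> by auto
  ultimately show thesis
    using that[of "p 0" "Lm 0" \<gamma> \<eta>] p Lm \<gamma>' \<gamma>0 \<eta>0 \<gamma>1 \<gamma>\<eta> by blast
qed

text \<open>The segment joining the identity to a coordinate system \<open>\<gamma>\<close> tangent to it: \<open>\<gamma>(cZ)/c\<close> is
  polynomial in \<open>c\<close>, and so is the inverse system. The identity between them is checked over
  \<open>k[c]\<close>, where \<open>c\<close> can be cancelled, and then specialised.\<close>

lemma coordinate_path:
  assumes "ring_hom_cring k R \<iota>" "e \<in> carrier R"
    and \<gamma>: "\<gamma> \<in> {..<n} \<rightarrow> mpolys k n" and \<eta>: "\<eta> \<in> {..<n} \<rightarrow> mpolys k n"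
    and \<gamma>0: "\<And>j. j < n \<Longrightarrow> \<gamma> j {#} = \<zero>\<^bsub>k\<^esub>" and \<eta>0: "\<And>j. j < n \<Longrightarrow> \<eta> j {#} = \<zero>\<^bsub>k\<^esub>"
    and \<gamma>\<eta>: "\<And>j. j < n \<Longrightarrow> mpoly_subst k n \<gamma> (\<eta> j) = ring.indexed_var k j"
  defines "\<Gamma> \<equiv> \<lambda>j u. \<iota> (\<gamma> j u) \<otimes>\<^bsub>R\<^esub> e [^]\<^bsub>R\<^esub> (size u - 1)"
  obtains N where "\<Gamma> \<in> {..<n} \<rightarrow> mpolys R n" "N \<in> {..<n} \<rightarrow> mpolys R n"
    "\<And>j. j < n \<Longrightarrow> mpoly_subst R n \<Gamma> (N j) = ring.indexed_var R j"
proof -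
  interpret \<iota>: ring_hom_cring k R \<iota> by fact
  \<comment> \<open>\<open>C\<close> is the ring \<open>k[c]\<close> and \<open>Cn\<close> below is
    \<open>k[c][Z]\<close>. The parameter has to be an indeterminate here, since the element
    \<open>e\<close> may be a zero divisor or zero.\<close>
  define C where "C = mpoly_ring k 1"
  define co where "co = (\<iota>.R.indexed_const :: 'a \<Rightarrow> nat multiset \<Rightarrow> 'a)"
  interpret co: ring_hom_cring k C co unfolding C_def co_def by (rule \<iota>.R.const_hom)
  define c where "c = \<iota>.R.indexed_var (0 :: nat)"
  have c: "c \<in> carrier C" unfolding c_def C_def by (rule \<iota>.R.mpoly_var_closed) simp
  \<comment> \<open>Multiplication by the variable only shifts coefficients from \<open>u\<close> to
    \<open>add_mset 0 u\<close>.\<close>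
  have c_cancel: "x = y" if "x \<in> carrier C" "y \<in> carrier C" "c \<otimes>\<^bsub>C\<^esub> x = c \<otimes>\<^bsub>C\<^esub> y" for x y
  proof -
    have pm: "c \<otimes>\<^bsub>C\<^esub> x = \<iota>.R.indexed_pmult x 0" if "x \<in> carrier C" for x
    proof -
      have "c \<otimes>\<^bsub>C\<^esub> x = x \<otimes>\<^bsub>C\<^esub> c" by (rule co.S.m_comm[OF c that])
      then show ?thesis
        using \<iota>.R.pmult_eq_mult[of x "{..<1}" 0] that by (simp add: C_def c_def mpoly_ring_simps)
    qed
    have "x u = y u" for u
      using fun_cong[OF that(3), of "add_mset 0 u"] pm[OF that(1)] pm[OF that(2)]
      by (simp add: \<iota>.R.indexed_pmult_def)
    then show ?thesis by blast
  qed
  define Cn where "Cn = mpoly_ring C n"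
  interpret Cn: cring Cn unfolding Cn_def by (rule co.S.cring_mpoly_ring)
  define cc where "cc = (co.S.indexed_const c :: nat multiset \<Rightarrow> nat multiset \<Rightarrow> 'a)"
  have cc: "cc \<in> carrier Cn" unfolding cc_def Cn_def by (rule co.S.const_closed[OF c])
  have cc_cancel: "P = Q" if "P \<in> carrier Cn" "Q \<in> carrier Cn" "cc \<otimes>\<^bsub>Cn\<^esub> P = cc \<otimes>\<^bsub>Cn\<^esub> Q" for P Q
  proof
    fix u
    have "c \<otimes>\<^bsub>C\<^esub> P u = c \<otimes>\<^bsub>C\<^esub> Q u"
      using fun_cong[OF that(3), of u] co.S.mult_const_coeff[OF c, of P n u] co.S.mult_const_coeff[OF c, of Q n u] that
      by (simp add: Cn_def cc_def)
    then show "P u = Q u"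
      using c_cancel co.S.mpolys_coeff[of P n u] co.S.mpolys_coeff[of Q n u] that by (simp add: Cn_def)
  qed
  \<comment> \<open>\<open>D q\<close> is \<open>q(cZ)/c\<close>, coefficient by
    coefficient.\<close>
  define D where "D q = (\<lambda>u. co (q u) \<otimes>\<^bsub>C\<^esub> c [^]\<^bsub>C\<^esub> (size u - 1))" for q :: "nat multiset \<Rightarrow> 'a"
  have D: "D q \<in> carrier Cn" if q: "q \<in> mpolys k n" for q
  proof -
    have qp: "q \<in> \<iota>.R.polys {..<n}" by (rule \<iota>.R.mpolysD[OF q])
    have qc: "q u \<in> carrier k" for u by (rule \<iota>.R.polys_closed[OF qp])
    have nz: "q u \<noteq> \<zero>\<^bsub>k\<^esub>" if "D q u \<noteq> \<zero>\<^bsub>C\<^esub>" for u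
      using that c by (auto simp: D_def)
    have "D q \<in> co.S.polys {..<n}"
    proof (rule co.S.polysI)
      show "finite {u. D q u \<noteq> \<zero>\<^bsub>C\<^esub>}"
        by (rule finite_subset[OF _ \<iota>.R.polys_finite_support[OF qp]]) (use nz in blast)
      show "D q u \<in> carrier C" for u using qc c by (simp add: D_def)
      show "set_mset u \<subseteq> {..<n}" if "D q u \<noteq> \<zero>\<^bsub>C\<^esub>" for u
        by (rule \<iota>.R.polys_support[OF qp nz[OF that]])
    qed
    then show ?thesis by (simp add: Cn_def mpoly_ring_simps)
  qed
  define sc where "sc i = cc \<otimes>\<^bsub>Cn\<^esub> co.S.indexed_var i" for i
  have var: "co.S.indexed_var i \<in> carrier Cn" if "i < n" for i
    unfolding Cn_def by (rule co.S.mpoly_var_closed[OF that])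
  have sc: "sc \<in> {..<n} \<rightarrow> mpolys C n"
    using Cn.m_closed[OF cc var] unfolding sc_def by (simp add: Cn_def)
  have mc: "mpoly_map co q \<in> mpolys C n" if "q \<in> mpolys k n" for q
    by (rule co.map_closed[OF that])
  \<comment> \<open>The condition on \<open>q {#}\<close> makes up for the truncated difference
    \<open>size u - 1\<close>: at the empty monomial a surplus factor \<open>c\<close> would
    appear.\<close>
  have cD: "cc \<otimes>\<^bsub>Cn\<^esub> D q = mpoly_subst C n sc (mpoly_map co q)"
    if q: "q \<in> mpolys k n" and q0: "q {#} = \<zero>\<^bsub>k\<^esub>" for q
  proof
    fix u
    have qc: "q u \<in> carrier k" by (rule \<iota>.R.mpolys_coeff[OF q])
    have "(cc \<otimes>\<^bsub>Cn\<^esub> D q) u = c \<otimes>\<^bsub>C\<^esub> D q u"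
      unfolding cc_def Cn_def by (rule co.S.mult_const_coeff[OF c]) (use D[OF q] in \<open>simp add: Cn_def\<close>)
    also have "\<dots> = co (q u) \<otimes>\<^bsub>C\<^esub> c [^]\<^bsub>C\<^esub> size u"
    proof (cases u)
      case empty
      then show ?thesis using q0 c by (simp add: D_def)
    next
      case (add x v)
      then show ?thesis using qc c by (simp add: D_def co.S.m_ac)
    qed
    also have "\<dots> = mpoly_subst C n sc (mpoly_map co q) u"
      unfolding sc_def cc_def Cn_def co.S.subst_scale_coeff[OF c mc[OF q]] by (simp add: mpoly_map_apply)
    finally show "(cc \<otimes>\<^bsub>Cn\<^esub> D q) u = mpoly_subst C n sc (mpoly_map co q) u" .
  qed
  have \<gamma>j: "\<gamma> j \<in> mpolys k n" "\<eta> j \<in> mpolys k n" if "j < n" for j using \<gamma> \<eta> that by auto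
  define G where "G j = D (\<gamma> j)" for j
  have G: "G \<in> {..<n} \<rightarrow> mpolys C n" using D \<gamma>j by (auto simp: G_def Cn_def)
  interpret SG: ring_hom_cring Cn Cn "mpoly_subst C n G"
    unfolding Cn_def by (rule co.S.subst_hom[OF G])
  \<comment> \<open>With \<open>G = \<gamma>(cZ)/c\<close>, multiplication by \<open>c\<close> gives
    \<open>c (D \<eta>)(G) = \<eta>(cG) = \<eta>(\<gamma>(cZ)) = cZ\<close>, and \<open>c\<close> is
    cancelled.\<close>
  have key: "mpoly_subst C n G (D (\<eta> j)) = co.S.indexed_var j" if j: "j < n" for j
  proof (rule cc_cancel)
    have Deta: "D (\<eta> j) \<in> carrier Cn" by (rule D[OF \<gamma>j(2)[OF j]])
    show "mpoly_subst C n G (D (\<eta> j)) \<in> carrier Cn" using Deta by simp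
    show "co.S.indexed_var j \<in> carrier Cn" by (rule var[OF j])
    have Gsc: "mpoly_subst C n G (sc i) = mpoly_subst C n sc (mpoly_map co (\<gamma> i))" if "i < n" for i
    proof -
      have "mpoly_subst C n G (sc i) = mpoly_subst C n G cc \<otimes>\<^bsub>Cn\<^esub> mpoly_subst C n G (co.S.indexed_var i)"
        unfolding sc_def by (rule SG.hom_mult[OF cc var[OF that]])
      also have "\<dots> = cc \<otimes>\<^bsub>Cn\<^esub> G i"
        unfolding cc_def co.S.subst_const[OF G c] co.S.subst_var[OF G that] by (rule refl)
      finally show ?thesis using cD[OF \<gamma>j(1)[OF that] \<gamma>0[OF that]] by (simp add: G_def)
    qed
    have mg: "(\<lambda>i. mpoly_map co (\<gamma> i)) \<in> {..<n} \<rightarrow> mpolys C n" using mc \<gamma>j by auto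
    have me: "mpoly_map co (\<eta> j) \<in> mpolys C n" by (rule mc[OF \<gamma>j(2)[OF j]])
    have "cc \<otimes>\<^bsub>Cn\<^esub> mpoly_subst C n G (D (\<eta> j)) = mpoly_subst C n G cc \<otimes>\<^bsub>Cn\<^esub> mpoly_subst C n G (D (\<eta> j))"
      unfolding cc_def co.S.subst_const[OF G c] by (rule refl)
    also have "\<dots> = mpoly_subst C n G (cc \<otimes>\<^bsub>Cn\<^esub> D (\<eta> j))"
      by (rule SG.hom_mult[OF cc Deta, symmetric])
    also have "\<dots> = mpoly_subst C n G (mpoly_subst C n sc (mpoly_map co (\<eta> j)))"
      unfolding cD[OF \<gamma>j(2)[OF j] \<eta>0[OF j]] by (rule refl)
    also have "\<dots> = mpoly_subst C n (\<lambda>i. mpoly_subst C n G (sc i)) (mpoly_map co (\<eta> j))"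
      by (rule co.S.subst_subst[OF sc G me])
    also have "\<dots> = mpoly_subst C n (\<lambda>i. mpoly_subst C n sc (mpoly_map co (\<gamma> i))) (mpoly_map co (\<eta> j))"
      by (rule co.S.subst_cong[OF _ me Gsc]) (use co.S.subst_closed[OF G] sc in auto)
    also have "\<dots> = mpoly_subst C n sc (mpoly_subst C n (\<lambda>i. mpoly_map co (\<gamma> i)) (mpoly_map co (\<eta> j)))"
      by (rule co.S.subst_subst[OF mg sc me, symmetric])
    also have "mpoly_subst C n (\<lambda>i. mpoly_map co (\<gamma> i)) (mpoly_map co (\<eta> j)) = mpoly_map co (mpoly_subst k n \<gamma> (\<eta> j))"
      by (rule co.map_subst[OF \<gamma> \<gamma>j(2)[OF j], symmetric])
    also have "\<dots> = co.S.indexed_var j" unfolding \<gamma>\<eta>[OF j] by (rule co.map_var)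
    also have "mpoly_subst C n sc (co.S.indexed_var j) = cc \<otimes>\<^bsub>Cn\<^esub> co.S.indexed_var j"
      unfolding co.S.subst_var[OF sc j] sc_def by (rule refl)
    finally show "cc \<otimes>\<^bsub>Cn\<^esub> mpoly_subst C n G (D (\<eta> j)) = cc \<otimes>\<^bsub>Cn\<^esub> co.S.indexed_var j" .
  qed
  \<comment> \<open>The specialisation of \<open>c\<close> to \<open>e\<close>, with coefficients
    carried along \<open>\<iota>\<close>.\<close>
  define E where "E = mpoly_eval k R \<iota> (\<lambda>_. e)"
  have ef: "(\<lambda>_. e) \<in> {..<1} \<rightarrow> carrier R" using assms(2) by auto
  have "E \<in> ring_hom C R" unfolding E_def C_def by (rule \<iota>.eval_hom[OF ef])
  then interpret E: ring_hom_cring C R E by unfold_locales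
  have Eco: "E (co x) = \<iota> x" if "x \<in> carrier k" for x
    unfolding E_def co_def by (rule \<iota>.eval_const[OF ef that])
  have Ec: "E c = e" unfolding E_def c_def by (rule \<iota>.eval_var[OF ef]) simp
  have ED: "mpoly_map E (D q) = (\<lambda>u. \<iota> (q u) \<otimes>\<^bsub>R\<^esub> e [^]\<^bsub>R\<^esub> (size u - 1))" if "q \<in> mpolys k n" for q
  proof
    fix u
    have qc: "q u \<in> carrier k" by (rule \<iota>.R.mpolys_coeff[OF that])
    show "mpoly_map E (D q) u = \<iota> (q u) \<otimes>\<^bsub>R\<^esub> e [^]\<^bsub>R\<^esub> (size u - 1)"
      using qc c Eco[OF qc] Ec by (simp add: mpoly_map_apply D_def)
  qed
  define N where "N j = mpoly_map E (D (\<eta> j))" for j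
  have mE: "mpoly_map E Q \<in> mpolys R n" if "Q \<in> mpolys C n" for Q
    by (rule E.map_closed[OF that])
  have \<Gamma>E: "\<Gamma> j = mpoly_map E (G j)" if "j < n" for j
    unfolding \<Gamma>_def G_def ED[OF \<gamma>j(1)[OF that]] by (rule refl)
  have Gj: "G j \<in> mpolys C n" if "j < n" for j using G that by auto
  have 1: "\<Gamma> \<in> {..<n} \<rightarrow> mpolys R n" using \<Gamma>E mE[OF Gj] by auto
  have Dn: "D (\<eta> j) \<in> mpolys C n" if "j < n" for j using D[OF \<gamma>j(2)[OF that]] by (simp add: Cn_def)
  have 2: "N \<in> {..<n} \<rightarrow> mpolys R n" using mE[OF Dn] by (auto simp: N_def)
  have 3: "mpoly_subst R n \<Gamma> (N j) = \<iota>.S.indexed_var j" if j: "j < n" for j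
  proof -
    have Nj: "N j \<in> mpolys R n" using 2 j by auto
    have "mpoly_subst R n \<Gamma> (N j) = mpoly_subst R n (\<lambda>i. mpoly_map E (G i)) (N j)"
      by (rule \<iota>.S.subst_cong[OF 1 Nj \<Gamma>E])
    also have "\<dots> = mpoly_map E (mpoly_subst C n G (D (\<eta> j)))"
      unfolding N_def by (rule E.map_subst[OF G Dn[OF j], symmetric])
    also have "\<dots> = \<iota>.S.indexed_var j" unfolding key[OF j] by (rule E.map_var)
    finally show ?thesis .
  qed
  show thesis by (rule that[OF 1 2 3])
qed

section \<open>Solving for a variable modulo \<open>a\<close>\<close>

text \<open>\<open>K l\<close> is generated by \<open>a\<close> and the products of the
  \<open>c t\<close> of degree \<open>l\<close>. A factor \<open>c t\<close> leads one level up, and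
  by the pigeonhole principle the chain ends inside \<open>PIdl a\<close>. The levels measure the
  progress of the iteration in \<open>solve_mod\<close>.\<close>

lemma (in cring) nilpotent_chain:
  assumes "finite T" "c \<in> T \<rightarrow> carrier R" "a \<in> carrier R"
    and nil: "\<And>t. t \<in> T \<Longrightarrow> \<exists>N::nat. c t [^] N \<in> PIdl a"
  obtains K :: "nat \<Rightarrow> 'a set" and d where "\<And>l. ideal (K l) R" "\<And>l. PIdl a \<subseteq> K l" "K 0 = carrier R"
    "K d \<subseteq> PIdl a" "\<And>l t x. t \<in> T \<Longrightarrow> x \<in> K l \<Longrightarrow> c t \<otimes> x \<in> K (Suc l)"
proof -
  have PI: "ideal (PIdl a) R" by (rule cgenideal_ideal[OF assms(3)])
  interpret PI: ideal "PIdl a" R by (rule PI)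
  have c: "c t \<in> carrier R" if "t \<in> T" for t using assms(2) that by auto
  define m where "m f = (\<Otimes>t\<in>T. c t [^] (f t :: nat))" for f
  have m: "m f \<in> carrier R" for f unfolding m_def by (rule finprod_closed) (use c in auto)
  have m_step: "m f = c t [^] f t \<otimes> (\<Otimes>s\<in>T - {t}. c s [^] f s)" if "t \<in> T" for f t
  proof -
    have "m f = (\<Otimes>s\<in>insert t (T - {t}). c s [^] f s)" unfolding m_def using that by (simp add: insert_absorb)
    also have "\<dots> = c t [^] f t \<otimes> (\<Otimes>s\<in>T - {t}. c s [^] f s)"
      by (rule finprod_insert) (use assms(1) c that in auto)
    finally show ?thesis .
  qed
  have rest: "(\<Otimes>s\<in>T - {t}. c s [^] (f s :: nat)) \<in> carrier R" for f t
    by (rule finprod_closed) (use c in auto)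
  define gen where "gen l = PIdl a \<union> {m f | f. sum f T = l}" for l
  define K where "K l = Idl (gen l)" for l
  have gen: "gen l \<subseteq> carrier R" for l unfolding gen_def using m PI.a_subset by blast
  have K: "ideal (K l) R" for l unfolding K_def by (rule genideal_ideal[OF gen])
  have aK: "PIdl a \<subseteq> K l" for l
    using genideal_self[OF gen, of l] unfolding K_def gen_def by blast
  have mK: "m f \<in> K (sum f T)" for f
  proof -
    have "m f \<in> gen (sum f T)" unfolding gen_def by blast
    then show ?thesis using genideal_self[OF gen] unfolding K_def by blast
  qed
  have K0: "K 0 = carrier R"
  proof -
    have "m (\<lambda>_. 0) = (\<Otimes>t\<in>T. \<one>)" unfolding m_def by (rule finprod_cong') (use c in auto)
    then have "\<one> \<in> K 0" using mK[of "\<lambda>_. 0"] by simp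
    then show ?thesis by (rule ideal.one_imp_carrier[OF K])
  qed
  have step: "c t \<otimes> x \<in> K (Suc l)" if t: "t \<in> T" and x: "x \<in> K l" for t x l
  proof -
    interpret KS: ideal "K (Suc l)" R by (rule K)
    \<comment> \<open>The quotient ideal of \<open>K (Suc l)\<close> by \<open>c t\<close>: being an
      ideal, it contains \<open>K l\<close> as soon as it contains the generators.\<close>
    define Q where "Q = {y \<in> carrier R. c t \<otimes> y \<in> K (Suc l)}"
    have "ideal Q R"
    proof (rule idealI[OF ring_axioms])
      show "subgroup Q (add_monoid R)"
      proof (rule add.subgroupI)
        show "Q \<subseteq> carrier R" by (auto simp: Q_def)
        show "Q \<noteq> {}" using KS.zero_closed c[OF t] by (auto simp: Q_def intro!: exI[of _ \<zero>])
        show "\<ominus> y \<in> Q" if "y \<in> Q" for y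
          using that KS.a_inv_closed[of "c t \<otimes> y"] c[OF t] by (simp add: Q_def r_minus)
        show "y \<oplus> z \<in> Q" if "y \<in> Q" "z \<in> Q" for y z
          using that KS.a_closed[of "c t \<otimes> y" "c t \<otimes> z"] c[OF t] by (simp add: Q_def r_distr)
      qed
      fix y z assume y: "y \<in> Q" and z: "z \<in> carrier R"
      have yc: "y \<in> carrier R" "c t \<otimes> y \<in> K (Suc l)" using y by (auto simp: Q_def)
      have "z \<otimes> (c t \<otimes> y) \<in> K (Suc l)" by (rule KS.I_l_closed[OF yc(2) z])
      then have "c t \<otimes> (z \<otimes> y) \<in> K (Suc l)" using c[OF t] yc(1) z by (simp add: m_lcomm)
      then show "z \<otimes> y \<in> Q" "y \<otimes> z \<in> Q" using yc(1) z by (simp_all add: Q_def m_comm)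
    qed
    moreover have "gen l \<subseteq> Q"
    proof
      fix y assume "y \<in> gen l"
      then consider "y \<in> PIdl a" | f where "y = m f" "sum f T = l" by (auto simp: gen_def)
      then show "y \<in> Q"
      proof cases
        case 1
        then have "c t \<otimes> y \<in> PIdl a" by (rule PI.I_l_closed[OF _ c[OF t]])
        then show ?thesis using aK PI.Icarr[OF 1] by (auto simp: Q_def)
      next
        case 2
        define g where "g = f(t := Suc (f t))"
        have "(\<Otimes>s\<in>T - {t}. c s [^] g s) = (\<Otimes>s\<in>T - {t}. c s [^] f s)"
          by (rule finprod_cong') (use c in \<open>auto simp: g_def\<close>)
        then have "m g = c t \<otimes> m f"
          unfolding m_step[OF t, of g] m_step[OF t, of f] using c[OF t] rest[of f t]
          by (simp add: g_def m_ac)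
        moreover have "sum g T = Suc l"
        proof -
          have "sum g T = g t + sum g (T - {t})" "sum f T = f t + sum f (T - {t})"
            using assms(1) t by (auto intro: sum.remove)
          moreover have "sum g (T - {t}) = sum f (T - {t})"
            by (rule sum.cong) (auto simp: g_def)
          ultimately show ?thesis using 2(2) by (simp add: g_def)
        qed
        ultimately show ?thesis using mK[of g] m[of f] 2(1) by (simp add: Q_def)
      qed
    qed
    ultimately have "K l \<subseteq> Q" unfolding K_def by (rule genideal_minimal)
    then show ?thesis using x by (auto simp: Q_def)
  qed
  obtain N where N: "\<And>t. t \<in> T \<Longrightarrow> c t [^] (N t :: nat) \<in> PIdl a" using nil by metis
  \<comment> \<open>One more than the sum of the nilpotency exponents, so that some exponent in a
    monomial of degree \<open>d\<close> exceeds its bound.\<close>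
  define d where "d = Suc (sum N T)"
  have "K d \<subseteq> PIdl a"
    unfolding K_def
  proof (rule genideal_minimal[OF PI])
    show "gen d \<subseteq> PIdl a"
    proof
      fix y assume "y \<in> gen d"
      then consider "y \<in> PIdl a" | f where "y = m f" "sum f T = d" by (auto simp: gen_def)
      then show "y \<in> PIdl a"
      proof cases
        case 2
        have "\<exists>t\<in>T. N t < f t"
        proof (rule ccontr)
          assume "\<not> (\<exists>t\<in>T. N t < f t)"
          then have "sum f T \<le> sum N T" by (intro sum_mono) (auto simp: not_less)
          then show False using 2(2) by (simp add: d_def)
        qed
        then obtain t where t: "t \<in> T" "N t < f t" by blast
        have "c t [^] f t = c t [^] N t \<otimes> c t [^] (f t - N t)"
          using c[OF t(1)] t(2) by (simp add: nat_pow_mult)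
        then have "c t [^] f t \<in> PIdl a"
          using PI.I_r_closed[OF N[OF t(1)], of "c t [^] (f t - N t)"] c[OF t(1)] by simp
        then show ?thesis
          unfolding 2(1) m_step[OF t(1)] by (rule PI.I_r_closed[OF _ rest])
      qed
    qed
  qed
  then show thesis by (rule that[OF K aK K0 _ step])
qed

text \<open>A finite geometric series in \<open>\<one> \<ominus> x\<close>. If a power of this
  element lies in an ideal, the lemma provides an inverse of \<open>x\<close> modulo the
  ideal.\<close>

lemma (in cring) unit_mod_nilpotent:
  assumes "x \<in> carrier R"
  shows "\<exists>y\<in>carrier R. x \<otimes> y = \<one> \<ominus> (\<one> \<ominus> x) [^] (N::nat)"
proof (induction N)
  case 0
  show ?case using assms by (intro bexI[of _ \<zero>]) (simp_all add: minus_eq r_neg)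
next
  case (Suc N)
  then obtain y where y: "y \<in> carrier R" "x \<otimes> y = \<one> \<ominus> (\<one> \<ominus> x) [^] N" by blast
  define z where "z = (\<one> \<ominus> x) [^] N"
  have z: "z \<in> carrier R" using assms by (simp add: z_def)
  have "x \<otimes> (y \<oplus> z) = (\<one> \<ominus> z) \<oplus> x \<otimes> z"
    using assms y z by (simp add: r_distr z_def)
  also have "\<dots> = \<one> \<ominus> (z \<ominus> x \<otimes> z)"
    using assms z by (simp add: a_minus_def minus_add a_assoc)
  also have "z \<ominus> x \<otimes> z = z \<otimes> (\<one> \<ominus> x)"
    using assms z by (simp add: a_minus_def r_distr r_minus m_comm)
  also have "\<dots> = (\<one> \<ominus> x) [^] Suc N" by (simp add: z_def)
  finally show ?case using y z by blast
qed

section \<open>Subrings, congruences and images of coordinates\<close>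

context cring
begin

lemma subst_in_subring:
  assumes C: "subring C (mpoly_ring R m)" and const: "\<And>c. c \<in> carrier R \<Longrightarrow> indexed_const c \<in> C"
    and y: "\<And>i. i < n \<Longrightarrow> y i \<in> C" and P: "P \<in> mpolys R n"
  shows "mpoly_subst R m y P \<in> C"
proof -
  interpret M: cring "mpoly_ring R m" by (rule cring_mpoly_ring)
  interpret co: ring_hom_cring R "mpoly_ring R m" indexed_const by (rule const_hom)
  have y': "y \<in> {..<n} \<rightarrow> mpolys R m" using y subringE(1)[OF C] by auto
  show ?thesis
    using is_cring mpolysD[OF P]
  proof (induction rule: polys_induct)
    case (const c)
    then show ?case using assms(2) by (simp add: co.eval_const[OF y'])
  next
    case (padd P Q)
    then show ?case using subringE(7)[OF C] by (simp add: co.eval_padd[OF y' padd.hyps])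
  next
    case (pmult P i)
    then show ?case using subringE(6)[OF C] y by (simp add: co.eval_pmult[OF y' pmult.hyps])
  qed
qed

text \<open>The set \<open>J\<close> is an ideal of the subring \<open>C\<close>, not of the whole
  ring. This generality is for \<open>coordinate_of_inverse_mod\<close>, where the correction term
  must be expressible by the generators of \<open>C\<close>.\<close>

lemma subst_congruent:
  assumes C: "subring C (mpoly_ring R m)" and const: "\<And>c. c \<in> carrier R \<Longrightarrow> indexed_const c \<in> C"
    and J: "J \<subseteq> C" "\<zero>\<^bsub>mpoly_ring R m\<^esub> \<in> J"
    and Jadd: "\<And>i j. i \<in> J \<Longrightarrow> j \<in> J \<Longrightarrow> i \<oplus>\<^bsub>mpoly_ring R m\<^esub> j \<in> J"
    and Jmult: "\<And>x j. x \<in> C \<Longrightarrow> j \<in> J \<Longrightarrow> x \<otimes>\<^bsub>mpoly_ring R m\<^esub> j \<in> J"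
    and y: "\<And>i. i < n \<Longrightarrow> y i \<in> C" and z: "\<And>i. i < n \<Longrightarrow> z i \<in> C"
    and yz: "\<And>i. i < n \<Longrightarrow> \<exists>j\<in>J. y i = z i \<oplus>\<^bsub>mpoly_ring R m\<^esub> j"
    and P: "P \<in> mpolys R n"
  shows "\<exists>j\<in>J. mpoly_subst R m y P = mpoly_subst R m z P \<oplus>\<^bsub>mpoly_ring R m\<^esub> j"
proof -
  define M where "M = mpoly_ring R m"
  interpret M: cring M unfolding M_def by (rule cring_mpoly_ring)
  interpret co: ring_hom_cring R M indexed_const unfolding M_def by (rule const_hom)
  have CM: "C \<subseteq> carrier M" using subringE(1)[OF C] by (simp add: M_def)
  have y': "y \<in> {..<n} \<rightarrow> carrier M" and z': "z \<in> {..<n} \<rightarrow> carrier M" using y z CM by auto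
  have zC: "mpoly_eval R M indexed_const z P \<in> C" if "P \<in> mpolys R n" for P
    using subst_in_subring[OF C const z that] by (simp add: M_def)
  have JM: "j \<in> carrier M" if "j \<in> J" for j using J(1) CM that by blast
  note J' = Jadd[folded M_def] Jmult[folded M_def]
  have "\<exists>j\<in>J. mpoly_eval R M indexed_const y P = mpoly_eval R M indexed_const z P \<oplus>\<^bsub>M\<^esub> j"
    using is_cring mpolysD[OF P]
  proof (induction rule: polys_induct)
    case (const c)
    then show ?case using J(2)[folded M_def] co.hom_closed[OF const]
      by (intro bexI[of _ "\<zero>\<^bsub>M\<^esub>"]) (simp_all add: co.eval_const[OF y'] co.eval_const[OF z'])
  next
    case (padd P Q)
    then obtain j k where jk: "j \<in> J" "mpoly_eval R M indexed_const y P = mpoly_eval R M indexed_const z P \<oplus>\<^bsub>M\<^esub> j"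
      "k \<in> J" "mpoly_eval R M indexed_const y Q = mpoly_eval R M indexed_const z Q \<oplus>\<^bsub>M\<^esub> k" by blast
    have cl: "mpoly_eval R M indexed_const z P \<in> carrier M" "mpoly_eval R M indexed_const z Q \<in> carrier M"
      using co.eval_closed[OF z'] padd.hyps by auto
    have "mpoly_eval R M indexed_const y (indexed_padd P Q) = mpoly_eval R M indexed_const z (indexed_padd P Q) \<oplus>\<^bsub>M\<^esub> (j \<oplus>\<^bsub>M\<^esub> k)"
      unfolding co.eval_padd[OF y' padd.hyps] co.eval_padd[OF z' padd.hyps] jk(2,4)
      using cl JM[OF jk(1)] JM[OF jk(3)] by (simp add: M.a_ac)
    then show ?case using J'(1)[OF jk(1,3)] by blast
  next
    case (pmult P i)
    then obtain j where j: "j \<in> J" "mpoly_eval R M indexed_const y P = mpoly_eval R M indexed_const z P \<oplus>\<^bsub>M\<^esub> j" by blast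
    have i: "i < n" using pmult.hyps by simp
    obtain k where k: "k \<in> J" "y i = z i \<oplus>\<^bsub>M\<^esub> k" using yz[OF i] by (auto simp: M_def)
    define Q where "Q = mpoly_eval R M indexed_const z P"
    have Q: "Q \<in> C" unfolding Q_def by (rule zC) (use pmult.hyps in \<open>simp add: mpoly_ring_simps\<close>)
    have cl: "Q \<in> carrier M" "z i \<in> carrier M" "y i \<in> carrier M" "j \<in> carrier M" "k \<in> carrier M"
      using Q CM y z i JM j(1) k(1) by auto
    \<comment> \<open>Each product in the error has one factor in \<open>C\<close> and one in
      \<open>J\<close>, because \<open>Q\<close> and \<open>y i\<close> both lie in
      \<open>C\<close>.\<close>
    have "(Q \<oplus>\<^bsub>M\<^esub> j) \<otimes>\<^bsub>M\<^esub> y i = Q \<otimes>\<^bsub>M\<^esub> y i \<oplus>\<^bsub>M\<^esub> y i \<otimes>\<^bsub>M\<^esub> j"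
      using cl M.m_comm[of j "y i"] by (simp add: M.l_distr)
    also have "Q \<otimes>\<^bsub>M\<^esub> y i = Q \<otimes>\<^bsub>M\<^esub> z i \<oplus>\<^bsub>M\<^esub> Q \<otimes>\<^bsub>M\<^esub> k"
      unfolding k(2) using cl by (simp add: M.r_distr)
    finally have "(Q \<oplus>\<^bsub>M\<^esub> j) \<otimes>\<^bsub>M\<^esub> y i = Q \<otimes>\<^bsub>M\<^esub> z i \<oplus>\<^bsub>M\<^esub> (Q \<otimes>\<^bsub>M\<^esub> k \<oplus>\<^bsub>M\<^esub> y i \<otimes>\<^bsub>M\<^esub> j)"
      using cl by (simp add: M.a_assoc)
    moreover have "Q \<otimes>\<^bsub>M\<^esub> k \<oplus>\<^bsub>M\<^esub> y i \<otimes>\<^bsub>M\<^esub> j \<in> J"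
      by (rule J'(1)[OF J'(2)[OF Q k(1)] J'(2)[OF y[OF i] j(1)]])
    ultimately show ?case
      unfolding co.eval_pmult[OF y' pmult.hyps] co.eval_pmult[OF z' pmult.hyps] j(2) Q_def[symmetric] by blast
  qed
  then show ?thesis by (simp add: M_def)
qed

lemma subst_congruent_ideal:
  assumes "ideal J (mpoly_ring R m)" "y \<in> {..<n} \<rightarrow> mpolys R m" "z \<in> {..<n} \<rightarrow> mpolys R m"
    and yz: "\<And>i. i < n \<Longrightarrow> y i \<ominus>\<^bsub>mpoly_ring R m\<^esub> z i \<in> J" and P: "P \<in> mpolys R n"
  shows "mpoly_subst R m y P \<ominus>\<^bsub>mpoly_ring R m\<^esub> mpoly_subst R m z P \<in> J"
proof -
  interpret M: cring "mpoly_ring R m" by (rule cring_mpoly_ring)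
  interpret J: ideal J "mpoly_ring R m" by fact
  have "\<exists>j\<in>J. mpoly_subst R m y P = mpoly_subst R m z P \<oplus>\<^bsub>mpoly_ring R m\<^esub> j"
  proof (rule subst_congruent[OF M.carrier_is_subring const_closed J.a_subset J.zero_closed J.a_closed _ _ _ _ P])
    show "x \<otimes>\<^bsub>mpoly_ring R m\<^esub> j \<in> J" if "x \<in> mpolys R m" "j \<in> J" for x j
      by (rule J.I_l_closed[OF that(2,1)])
    show "y i \<in> mpolys R m" "z i \<in> mpolys R m" if "i < n" for i using assms(2,3) that by auto
    show "\<exists>j\<in>J. y i = z i \<oplus>\<^bsub>mpoly_ring R m\<^esub> j" if "i < n" for i
    proof (rule bexI[OF _ yz[OF that]])
      have "y i \<in> mpolys R m" "z i \<in> mpolys R m" using assms(2,3) that by auto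
      then show "y i = z i \<oplus>\<^bsub>mpoly_ring R m\<^esub> (y i \<ominus>\<^bsub>mpoly_ring R m\<^esub> z i)"
        by (rule M.add_minus_cancel[symmetric, rotated])
    qed
  qed
  then obtain j where j: "j \<in> J" "mpoly_subst R m y P = mpoly_subst R m z P \<oplus>\<^bsub>mpoly_ring R m\<^esub> j" by blast
  have zP: "mpoly_subst R m z P \<in> mpolys R m" by (rule subst_closed[OF assms(3) P])
  have jc: "j \<in> mpolys R m" by (rule J.Icarr[OF j(1)])
  have "mpoly_subst R m z P \<oplus>\<^bsub>mpoly_ring R m\<^esub> j \<ominus>\<^bsub>mpoly_ring R m\<^esub> mpoly_subst R m z P = j"
    using zP jc M.add_minus_cancel[OF zP] by (simp add: a_minus_def M.a_assoc)
  then show ?thesis using j by simp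
qed

lemma mpolys_mono: "P \<in> mpolys R n \<Longrightarrow> n \<le> m \<Longrightarrow> P \<in> mpolys R m"
  using polys_mono[of P "{..<n}" "{..<m}"] by (simp add: mpoly_ring_simps)

lemma subst_var_incl:
  assumes "P \<in> mpolys R n" "n \<le> m"
  shows "mpoly_subst R m indexed_var P = P"
  by (rule subst_var_id[OF mpolysD[OF mpolys_mono[OF assms]]])

text \<open>The target ring is part of the notation; composing with the inclusion of variables shows
  that enlarging it changes nothing.\<close>

lemma subst_incl:
  assumes "y \<in> {..<n} \<rightarrow> mpolys R n" "P \<in> mpolys R n" "n \<le> m"
  shows "mpoly_subst R m y P = mpoly_subst R n y P"
proof -
  have v: "indexed_var \<in> {..<n} \<rightarrow> mpolys R m" using mpoly_var_closed assms(3) by auto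
  have yi: "y i \<in> mpolys R n" if "i < n" for i using assms(1) that by auto
  have "mpoly_subst R n y P = mpoly_subst R m indexed_var (mpoly_subst R n y P)"
    by (rule subst_var_incl[OF subst_closed[OF assms(1,2)] assms(3), symmetric])
  also have "\<dots> = mpoly_subst R m (\<lambda>i. mpoly_subst R m indexed_var (y i)) P"
    by (rule subst_subst[OF assms(1) v assms(2)])
  also have "\<dots> = mpoly_subst R m y P"
    by (rule subst_cong[OF _ assms(2)]) (use subst_closed[OF v yi] subst_var_incl[OF yi assms(3)] in auto)
  finally show ?thesis by simp
qed

lemma vars_generate:
  assumes "subring C (mpoly_ring R m)" "\<And>c. c \<in> carrier R \<Longrightarrow> indexed_const c \<in> C" "\<And>i. i < m \<Longrightarrow> indexed_var i \<in> C"
  shows "C = mpolys R m"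
proof
  show "C \<subseteq> mpolys R m" by (rule subringE(1)[OF assms(1)])
  show "mpolys R m \<subseteq> C"
  proof
    fix P assume P: "P \<in> mpolys R m"
    have "mpoly_subst R m indexed_var P \<in> C" by (rule subst_in_subring[OF assms P])
    then show "P \<in> C" by (simp add: subst_var_id[OF mpolysD[OF P]])
  qed
qed

end

lemma generate_ring_hom:
  assumes "ring_hom_ring R S f" "K \<subseteq> carrier R" "x \<in> generate_ring R K"
  shows "f x \<in> generate_ring S (f ` K)"
proof -
  interpret f: ring_hom_ring R S f by fact
  show ?thesis
    using assms(3)
  proof (induction rule: generate_ring.induct)
    case one
    then show ?case by (simp add: generate_ring.one)
  next
    case (incl h)
    then show ?case by (blast intro: generate_ring.incl)
  next
    case (a_inv h)
    then have "h \<in> carrier R" using f.R.generate_ring_in_carrier[OF assms(2)] by blast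
    with a_inv show ?case by (simp add: generate_ring.a_inv)
  next
    case (eng_add x y)
    then have "x \<in> carrier R" "y \<in> carrier R" using f.R.generate_ring_in_carrier[OF assms(2)] by blast+
    with eng_add show ?case by (simp add: generate_ring.eng_add)
  next
    case (eng_mult x y)
    then have "x \<in> carrier R" "y \<in> carrier R" using f.R.generate_ring_in_carrier[OF assms(2)] by blast+
    with eng_mult show ?case by (simp add: generate_ring.eng_mult)
  qed
qed

text \<open>The substitution is surjective, since \<open>N\<close> provides preimages of the
  variables. It fixes constants and so carries a generating set of the required shape to another
  one.\<close>

lemma (in cring) coordinate_image:
  assumes "is_coordinate R m F"
    and Y: "Y \<in> {..<m} \<rightarrow> mpolys R m" and N: "N \<in> {..<m} \<rightarrow> mpolys R m"
    and YN: "\<And>j. j < m \<Longrightarrow> mpoly_subst R m Y (N j) = indexed_var j"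
  shows "is_coordinate R m (mpoly_subst R m Y F)"
proof -
  interpret M: cring "mpoly_ring R m" by (rule cring_mpoly_ring)
  interpret Y: ring_hom_cring "mpoly_ring R m" "mpoly_ring R m" "mpoly_subst R m Y" by (rule subst_hom[OF Y])
  have Yr: "ring_hom_ring (mpoly_ring R m) (mpoly_ring R m) (mpoly_subst R m Y)"
    by (rule ring_hom_ringI2[OF M.ring_axioms M.ring_axioms Y.homh])
  obtain G where F: "m \<ge> 1" "F \<in> mpolys R m" and G: "G ` {2..m} \<subseteq> mpolys R m"
    and gen: "mpolys R m = generate_ring (mpoly_ring R m) (indexed_const ` carrier R \<union> insert F (G ` {2..m}))"
    using assms(1) by (auto simp: is_coordinate_def)
  let ?K = "indexed_const ` carrier R \<union> insert F (G ` {2..m})"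
  let ?f = "mpoly_subst R m Y"
  have K: "?K \<subseteq> mpolys R m" using F G const_closed by auto
  have fK: "?f ` ?K = indexed_const ` carrier R \<union> insert (?f F) ((\<lambda>i. ?f (G i)) ` {2..m})"
  proof -
    have "?f ` (indexed_const ` carrier R) = indexed_const ` carrier R"
      using subst_const[OF Y] by (auto simp: image_image)
    then show ?thesis by (auto simp: image_Un image_image)
  qed
  have sub: "?f ` ?K \<subseteq> mpolys R m" using K by auto
  have "generate_ring (mpoly_ring R m) (?f ` ?K) = mpolys R m"
  proof (rule vars_generate[OF M.generate_ring_is_subring[OF sub]])
    show "indexed_const c \<in> generate_ring (mpoly_ring R m) (?f ` ?K)" if "c \<in> carrier R" for c
      by (rule generate_ring.incl) (use that fK in blast)
    show "indexed_var i \<in> generate_ring (mpoly_ring R m) (?f ` ?K)" if "i < m" for i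
    proof -
      have "N i \<in> generate_ring (mpoly_ring R m) ?K" using N that gen by blast
      then have "?f (N i) \<in> generate_ring (mpoly_ring R m) (?f ` ?K)"
        by (rule generate_ring_hom[OF Yr K])
      then show ?thesis using YN[OF that] by simp
    qed
  qed
  moreover have "(\<lambda>i. ?f (G i)) ` {2..m} \<subseteq> mpolys R m" using G by auto
  ultimately show ?thesis
    unfolding is_coordinate_def fK using F Y.hom_closed[OF F(2)] by (intro conjI exI[of _ "\<lambda>i. ?f (G i)"]) auto
qed

text \<open>The difference of two Newton steps for \<open>P = s\<close>, where \<open>P\<close>
  takes the value \<open>b + v x + p\<close> at \<open>x\<close> and \<open>b + v y + q\<close> at
  \<open>y\<close>. On the right, \<open>v u - 1\<close> will be a multiple of \<open>a\<close>, and
  \<open>p - q\<close>, the change of the perturbation, will lie one level deeper than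
  \<open>x - y\<close>.\<close>

lemma (in cring) contraction_identity:
  assumes "x \<in> carrier R" "y \<in> carrier R" "s \<in> carrier R" "b \<in> carrier R" "p \<in> carrier R" "q \<in> carrier R"
    "u \<in> carrier R" "v \<in> carrier R"
  shows "(x \<ominus> u \<otimes> ((b \<oplus> v \<otimes> x \<oplus> p) \<ominus> s)) \<ominus> (y \<ominus> u \<otimes> ((b \<oplus> v \<otimes> y \<oplus> q) \<ominus> s))
    = \<ominus> ((v \<otimes> u \<ominus> \<one>) \<otimes> (x \<ominus> y)) \<ominus> u \<otimes> (p \<ominus> q)"
  using assms by algebra

lemma (in cring) lincomb_diff_mem:
  assumes "ideal K R" "finite T" "\<And>t. t \<in> T \<Longrightarrow> c t \<in> carrier R" "\<And>t. t \<in> T \<Longrightarrow> f t \<in> carrier R"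
    "\<And>t. t \<in> T \<Longrightarrow> g t \<in> carrier R" "\<And>t. t \<in> T \<Longrightarrow> c t \<otimes> (f t \<ominus> g t) \<in> K"
  shows "(\<Oplus>t\<in>T. c t \<otimes> f t) \<ominus> (\<Oplus>t\<in>T. c t \<otimes> g t) \<in> K"
  using assms(2-)
proof (induction T)
  case empty
  interpret K: ideal K R by fact
  show ?case by (simp add: minus_eq)
next
  case (insert t T)
  interpret K: ideal K R by fact
  define S where "S = (\<Oplus>t\<in>T. c t \<otimes> f t)"
  define S' where "S' = (\<Oplus>t\<in>T. c t \<otimes> g t)"
  have S: "S \<in> carrier R" "S' \<in> carrier R" unfolding S_def S'_def using insert.prems by (auto intro!: finsum_closed)
  have t: "c t \<in> carrier R" "f t \<in> carrier R" "g t \<in> carrier R" "c t \<otimes> (f t \<ominus> g t) \<in> K" using insert.prems by auto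
  have "(\<Oplus>t\<in>insert t T. c t \<otimes> f t) = c t \<otimes> f t \<oplus> S"
    unfolding S_def by (rule finsum_insert) (use insert in auto)
  moreover have "(\<Oplus>t\<in>insert t T. c t \<otimes> g t) = c t \<otimes> g t \<oplus> S'"
    unfolding S'_def by (rule finsum_insert) (use insert in auto)
  moreover have "(c t \<otimes> f t \<oplus> S) \<ominus> (c t \<otimes> g t \<oplus> S') = c t \<otimes> (f t \<ominus> g t) \<oplus> (S \<ominus> S')"
    using t(1-3) S by algebra
  moreover have "S \<ominus> S' \<in> K" unfolding S_def S'_def using insert by auto
  ultimately show ?case using K.a_closed[OF t(4)] by simp
qed

text \<open>Modulo \<open>a\<close> and nilpotents, \<open>P\<close> is affine with unit coefficient at the variable \<open>0\<close>. Hence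
  \<open>P = s\<close> can be solved for this variable by a fixed point iteration, which stops modulo \<open>a\<close>.\<close>

lemma (in cring) solve_mod:
  assumes a: "a \<in> carrier R" and u: "u \<in> carrier R" and w: "w \<in> carrier R" and l: "\<And>t. l t \<in> carrier R"
    and lu: "l 0 \<otimes> u = \<one> \<oplus> a \<otimes> w" and p: "p \<in> carrier R"
    and T: "finite T" and c: "\<And>t. t \<in> T \<Longrightarrow> c t \<in> carrier R" and m: "\<And>t. t \<in> T \<Longrightarrow> m t \<in> mpolys R n"
    and nil: "\<And>t. t \<in> T \<Longrightarrow> \<exists>N::nat. c t [^] N \<in> PIdl a" and n: "0 < n"
    and P: "P = indexed_const p \<oplus>\<^bsub>mpoly_ring R n\<^esub> lincomb R n l indexed_var \<oplus>\<^bsub>mpoly_ring R n\<^esub>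
      (\<Oplus>\<^bsub>mpoly_ring R n\<^esub>t\<in>T. indexed_const (c t) \<otimes>\<^bsub>mpoly_ring R n\<^esub> m t)"
  obtains h Q Q' where "h \<in> mpolys R n" "Q \<in> mpolys R n" "Q' \<in> mpolys R n"
    "mpoly_subst R n (indexed_var(0 := h)) P = indexed_var 0 \<oplus>\<^bsub>mpoly_ring R n\<^esub> indexed_const a \<otimes>\<^bsub>mpoly_ring R n\<^esub> Q"
    "mpoly_subst R n (indexed_var(0 := P)) h = indexed_var 0 \<oplus>\<^bsub>mpoly_ring R n\<^esub> indexed_const a \<otimes>\<^bsub>mpoly_ring R n\<^esub> Q'"
proof -
  define M where "M = mpoly_ring R n"
  interpret M: cring M unfolding M_def by (rule cring_mpoly_ring)
  define co where "co = (indexed_const :: 'a \<Rightarrow> nat multiset \<Rightarrow> 'a)"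
  interpret co: ring_hom_cring R M co unfolding M_def co_def by (rule const_hom)
  define x where "x = (indexed_var :: nat \<Rightarrow> nat multiset \<Rightarrow> 'a)"
  have x: "x i \<in> carrier M" if "i < n" for i unfolding x_def M_def by (rule mpoly_var_closed[OF that])
  have x0: "x 0 \<in> carrier M" by (rule x[OF n])
  have mM: "m t \<in> carrier M" if "t \<in> T" for t using m[OF that] by (simp add: M_def)
  \<comment> \<open>Substitution of \<open>\<alpha>\<close> for the variable \<open>0\<close>, with
    the other variables kept as parameters.\<close>
  define S where "S \<alpha> = mpoly_eval R M co (x(0 := \<alpha>))" for \<alpha>
  have env: "x(0 := \<alpha>) \<in> {..<n} \<rightarrow> mpolys R n" if "\<alpha> \<in> carrier M" for \<alpha>
    using x that by (auto simp: M_def)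
  have S_eq: "S \<alpha> Q = mpoly_subst R n (x(0 := \<alpha>)) Q" for \<alpha> Q
    by (simp add: S_def M_def co_def)
  have S_hom: "ring_hom_cring M M (S \<alpha>)" if "\<alpha> \<in> carrier M" for \<alpha>
    using subst_hom[OF env[OF that]] by (simp add: S_def M_def co_def)
  have S_closed: "S \<alpha> Q \<in> carrier M" if "\<alpha> \<in> carrier M" "Q \<in> carrier M" for \<alpha> Q
    by (rule ring_hom_closed[OF ring_hom_cring.homh[OF S_hom[OF that(1)]] that(2)])
  have S_co: "S \<alpha> (co r) = co r" if "\<alpha> \<in> carrier M" "r \<in> carrier R" for \<alpha> r
    unfolding S_eq co_def by (rule subst_const[OF env[OF that(1)] that(2)])
  have S_x: "S \<alpha> (x i) = (x(0 := \<alpha>)) i" if "\<alpha> \<in> carrier M" "i < n" for \<alpha> i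
    unfolding S_eq by (subst (2) x_def) (rule subst_var[OF env[OF that(1)] that(2)])
  have S_id: "S (x 0) Q = Q" if "Q \<in> carrier M" for Q
  proof -
    have "x(0 := x 0) = indexed_var" by (simp add: x_def)
    then show ?thesis unfolding S_eq by (simp only: subst_var_id[OF mpolysD[OF that[unfolded M_def]]])
  qed
  have S_S: "S \<beta> (S \<alpha> Q) = S (S \<beta> \<alpha>) Q" if "\<alpha> \<in> carrier M" "\<beta> \<in> carrier M" "Q \<in> carrier M" for \<alpha> \<beta> Q
  proof -
    have Q: "Q \<in> mpolys R n" using that(3) by (simp add: M_def)
    have "S \<beta> (S \<alpha> Q) = mpoly_subst R n (\<lambda>i. S \<beta> ((x(0 := \<alpha>)) i)) Q"
      unfolding S_eq by (rule subst_subst[OF env[OF that(1)] env[OF that(2)] Q])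
    also have "\<dots> = mpoly_subst R n (x(0 := S \<beta> \<alpha>)) Q"
    proof (rule subst_cong[OF _ Q])
      show eq: "S \<beta> ((x(0 := \<alpha>)) i) = (x(0 := S \<beta> \<alpha>)) i" if "i < n" for i
        using S_x[OF \<open>\<beta> \<in> carrier M\<close> that] by simp
      show "(\<lambda>i. S \<beta> ((x(0 := \<alpha>)) i)) \<in> {..<n} \<rightarrow> mpolys R n"
        using env[OF S_closed[OF that(2,1)]] eq by (simp add: Pi_iff)
    qed
    finally show ?thesis unfolding S_eq .
  qed
  define A where "A = co a"
  define U where "U = co u"
  define V where "V = co (l 0)"
  have AUV: "A \<in> carrier M" "U \<in> carrier M" "V \<in> carrier M" using a u l by (simp_all add: A_def U_def V_def)
  define rest where "rest = (\<Oplus>\<^bsub>M\<^esub>t\<in>{..<n} - {0}. co (l t) \<otimes>\<^bsub>M\<^esub> x t)"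
  have rest: "rest \<in> carrier M" unfolding rest_def by (rule M.finsum_closed) (use l x in auto)
  define N0 where "N0 = (\<Oplus>\<^bsub>M\<^esub>t\<in>T. co (c t) \<otimes>\<^bsub>M\<^esub> m t)"
  have N0: "N0 \<in> carrier M" unfolding N0_def by (rule M.finsum_closed) (use c mM in auto)
  have xf: "x \<in> {..<n} \<rightarrow> mpolys R n" using x by (auto simp: M_def)
  have PM: "P = co p \<oplus>\<^bsub>M\<^esub> lincomb R n l x \<oplus>\<^bsub>M\<^esub> N0"
    unfolding P M_def N0_def co_def x_def by (rule refl)
  have lin: "lincomb R n l x \<in> carrier M" unfolding M_def by (rule lincomb_closed[OF l xf])
  have PC: "P \<in> carrier M" unfolding PM using p lin N0 by simp
  \<comment> \<open>The part of \<open>P\<close> that is constant in the variable \<open>0\<close>,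
    apart from the perturbation \<open>N0\<close>.\<close>
  define B where "B = co p \<oplus>\<^bsub>M\<^esub> rest"
  have B: "B \<in> carrier M" using p rest by (simp add: B_def)
  have SP: "S \<alpha> P = B \<oplus>\<^bsub>M\<^esub> V \<otimes>\<^bsub>M\<^esub> \<alpha> \<oplus>\<^bsub>M\<^esub> S \<alpha> N0" if \<alpha>: "\<alpha> \<in> carrier M" for \<alpha>
  proof -
    interpret S: ring_hom_cring M M "S \<alpha>" by (rule S_hom[OF \<alpha>])
    have "S \<alpha> (lincomb R n l x) = lincomb R n l (\<lambda>t. S \<alpha> (x t))"
      unfolding S_eq by (rule subst_lincomb[OF l xf env[OF \<alpha>]])
    also have "\<dots> = lincomb R n l (x(0 := \<alpha>))"
      by (rule lincomb_cong[OF l env[OF \<alpha>]]) (rule S_x[OF \<alpha>])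
    also have "\<dots> = (\<Oplus>\<^bsub>M\<^esub>t\<in>insert 0 ({..<n} - {0}). co (l t) \<otimes>\<^bsub>M\<^esub> (x(0 := \<alpha>)) t)"
      unfolding lincomb_def M_def co_def using n by (simp add: insert_absorb)
    also have "\<dots> = co (l 0) \<otimes>\<^bsub>M\<^esub> (x(0 := \<alpha>)) 0 \<oplus>\<^bsub>M\<^esub> (\<Oplus>\<^bsub>M\<^esub>t\<in>{..<n} - {0}. co (l t) \<otimes>\<^bsub>M\<^esub> (x(0 := \<alpha>)) t)"
      by (rule M.finsum_insert) (use l x \<alpha> in auto)
    also have "(\<Oplus>\<^bsub>M\<^esub>t\<in>{..<n} - {0}. co (l t) \<otimes>\<^bsub>M\<^esub> (x(0 := \<alpha>)) t) = rest"
      unfolding rest_def by (rule M.finsum_cong') (use l x in auto)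
    finally have "S \<alpha> (lincomb R n l x) = V \<otimes>\<^bsub>M\<^esub> \<alpha> \<oplus>\<^bsub>M\<^esub> rest" by (simp add: V_def)
    then have "S \<alpha> P = co p \<oplus>\<^bsub>M\<^esub> (V \<otimes>\<^bsub>M\<^esub> \<alpha> \<oplus>\<^bsub>M\<^esub> rest) \<oplus>\<^bsub>M\<^esub> S \<alpha> N0"
      unfolding PM using p lin N0 S_co[OF \<alpha> p] by simp
    also have "\<dots> = B \<oplus>\<^bsub>M\<^esub> V \<otimes>\<^bsub>M\<^esub> \<alpha> \<oplus>\<^bsub>M\<^esub> S \<alpha> N0"
      unfolding B_def using p rest AUV \<alpha> S_closed[OF \<alpha> N0] by (simp add: M.a_ac)
    finally show ?thesis .
  qed
  have SN0: "S \<alpha> N0 = (\<Oplus>\<^bsub>M\<^esub>t\<in>T. co (c t) \<otimes>\<^bsub>M\<^esub> S \<alpha> (m t))" if \<alpha>: "\<alpha> \<in> carrier M" for \<alpha>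
  proof -
    interpret S: ring_hom_cring M M "S \<alpha>" by (rule S_hom[OF \<alpha>])
    have "S \<alpha> N0 = (\<Oplus>\<^bsub>M\<^esub>t\<in>T. S \<alpha> (co (c t)) \<otimes>\<^bsub>M\<^esub> S \<alpha> (m t))"
      unfolding N0_def by (rule S.hom_lincomb[OF T]) (use c mM in auto)
    also have "\<dots> = (\<Oplus>\<^bsub>M\<^esub>t\<in>T. co (c t) \<otimes>\<^bsub>M\<^esub> S \<alpha> (m t))"
      by (rule M.finsum_cong') (use S_co[OF \<alpha> c] c S_closed[OF \<alpha> mM] in auto)
    finally show ?thesis .
  qed
  have nilM: "\<exists>N::nat. co (c t) [^]\<^bsub>M\<^esub> N \<in> PIdl\<^bsub>M\<^esub> A" if t: "t \<in> T" for t
  proof -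
    obtain N :: nat where "c t [^] N \<in> PIdl a" using nil[OF t] by blast
    then obtain r where r: "r \<in> carrier R" "c t [^] N = r \<otimes> a" unfolding cgenideal_def by blast
    have "co (c t) [^]\<^bsub>M\<^esub> N = co r \<otimes>\<^bsub>M\<^esub> A"
      using r a co.hom_pow[OF c[OF t], of N] by (simp add: A_def)
    then show ?thesis using r(1) co.hom_closed[OF r(1)] unfolding cgenideal_def by blast
  qed
  obtain K d where K: "\<And>l. ideal (K l) M" "\<And>l. PIdl\<^bsub>M\<^esub> A \<subseteq> K l" "K 0 = carrier M" "K d \<subseteq> PIdl\<^bsub>M\<^esub> A"
    "\<And>l t y. t \<in> T \<Longrightarrow> y \<in> K l \<Longrightarrow> co (c t) \<otimes>\<^bsub>M\<^esub> y \<in> K (Suc l)"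
  proof (rule M.nilpotent_chain[OF T _ AUV(1) nilM])
    show "(\<lambda>t. co (c t)) \<in> T \<rightarrow> carrier M" using c by auto
  qed (assumption | rule that)+
  have WA: "V \<otimes>\<^bsub>M\<^esub> U \<ominus>\<^bsub>M\<^esub> \<one>\<^bsub>M\<^esub> = co w \<otimes>\<^bsub>M\<^esub> A"
  proof -
    have "V \<otimes>\<^bsub>M\<^esub> U = \<one>\<^bsub>M\<^esub> \<oplus>\<^bsub>M\<^esub> A \<otimes>\<^bsub>M\<^esub> co w"
      using co.hom_mult[OF l[of 0] u] lu a w by (simp add: V_def U_def A_def)
    moreover have "\<one>\<^bsub>M\<^esub> \<oplus>\<^bsub>M\<^esub> A \<otimes>\<^bsub>M\<^esub> co w \<ominus>\<^bsub>M\<^esub> \<one>\<^bsub>M\<^esub> = co w \<otimes>\<^bsub>M\<^esub> A"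
    proof -
      have "co w \<in> carrier M" using w by simp
      then show ?thesis using AUV(1) by algebra
    qed
    ultimately show ?thesis by simp
  qed
  have A_mem: "y \<otimes>\<^bsub>M\<^esub> A \<in> PIdl\<^bsub>M\<^esub> A" if "y \<in> carrier M" for y
    using that unfolding cgenideal_def by blast
  \<comment> \<open>A Newton step for \<open>P = s\<close> with slope \<open>V\<close>, whose
    inverse modulo \<open>a\<close> is \<open>U\<close>. The target \<open>s\<close> is a parameter
    because the iteration is used with the two targets \<open>x 0\<close> and
    \<open>P\<close>.\<close>
  define \<Phi> where "\<Phi> s \<alpha> = \<alpha> \<ominus>\<^bsub>M\<^esub> U \<otimes>\<^bsub>M\<^esub> (S \<alpha> P \<ominus>\<^bsub>M\<^esub> s)" for s \<alpha>
  have \<Phi>_closed: "\<Phi> s \<alpha> \<in> carrier M" if "s \<in> carrier M" "\<alpha> \<in> carrier M" for s \<alpha>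
    unfolding \<Phi>_def using that AUV S_closed[OF that(2) PC] by simp
  \<comment> \<open>Substitution preserves congruence modulo \<open>K j\<close>, and the
    coefficients \<open>c t\<close> of the perturbation lift the difference to
    \<open>K (Suc j)\<close>. The other term is a multiple of \<open>a\<close> and so lies in every
    level.\<close>
  have contraction: "\<Phi> s \<alpha> \<ominus>\<^bsub>M\<^esub> \<Phi> s \<beta> \<in> K (Suc j)"
    if s: "s \<in> carrier M" and \<alpha>: "\<alpha> \<in> carrier M" and \<beta>: "\<beta> \<in> carrier M" and d: "\<alpha> \<ominus>\<^bsub>M\<^esub> \<beta> \<in> K j" for s \<alpha> \<beta> j
  proof -
    interpret KS: ideal "K (Suc j)" M by (rule K(1))
    have m_diff: "S \<alpha> Q \<ominus>\<^bsub>M\<^esub> S \<beta> Q \<in> K j" if "Q \<in> carrier M" for Q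
      unfolding S_eq M_def
    proof (rule subst_congruent_ideal[OF K(1)[unfolded M_def] env[OF \<alpha>] env[OF \<beta>]])
      show "Q \<in> mpolys R n" using that by (simp add: M_def)
      interpret Kj: ideal "K j" M by (rule K(1))
      show "(x(0 := \<alpha>)) i \<ominus>\<^bsub>mpoly_ring R n\<^esub> (x(0 := \<beta>)) i \<in> K j" if "i < n" for i
        using d x[OF that] Kj.zero_closed by (auto simp: M_def[symmetric] M.minus_eq M.r_neg)
    qed
    have "S \<alpha> N0 \<ominus>\<^bsub>M\<^esub> S \<beta> N0 \<in> K (Suc j)"
      unfolding SN0[OF \<alpha>] SN0[OF \<beta>]
      by (rule M.lincomb_diff_mem[OF K(1) T])
        (use c S_closed[OF \<alpha> mM] S_closed[OF \<beta> mM] K(5)[OF _ m_diff[OF mM]] in auto)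
    then have 1: "U \<otimes>\<^bsub>M\<^esub> (S \<alpha> N0 \<ominus>\<^bsub>M\<^esub> S \<beta> N0) \<in> K (Suc j)" by (rule KS.I_l_closed[OF _ AUV(2)])
    have "co w \<otimes>\<^bsub>M\<^esub> A \<in> K (Suc j)" using A_mem[of "co w"] w K(2) by auto
    then have 2: "(co w \<otimes>\<^bsub>M\<^esub> A) \<otimes>\<^bsub>M\<^esub> (\<alpha> \<ominus>\<^bsub>M\<^esub> \<beta>) \<in> K (Suc j)"
      by (rule KS.I_r_closed) (use \<alpha> \<beta> in simp)
    have "\<Phi> s \<alpha> \<ominus>\<^bsub>M\<^esub> \<Phi> s \<beta> = \<ominus>\<^bsub>M\<^esub> ((co w \<otimes>\<^bsub>M\<^esub> A) \<otimes>\<^bsub>M\<^esub> (\<alpha> \<ominus>\<^bsub>M\<^esub> \<beta>)) \<ominus>\<^bsub>M\<^esub> U \<otimes>\<^bsub>M\<^esub> (S \<alpha> N0 \<ominus>\<^bsub>M\<^esub> S \<beta> N0)"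
      unfolding \<Phi>_def SP[OF \<alpha>] SP[OF \<beta>] WA[symmetric]
      by (rule M.contraction_identity[OF \<alpha> \<beta> s B S_closed[OF \<alpha> N0] S_closed[OF \<beta> N0] AUV(2,3)])
    then show ?thesis
      using KS.a_closed[OF KS.a_inv_closed[OF 2] KS.a_inv_closed[OF 1]] by (simp add: M.minus_eq)
  qed
  \<comment> \<open>The start is arbitrary, as \<open>K 0\<close> is the whole ring.\<close>
  define h where "h j = ((\<Phi> (x 0)) ^^ j) \<zero>\<^bsub>M\<^esub>" for j
  have h: "h j \<in> carrier M" for j by (induction j) (simp_all add: h_def \<Phi>_closed x0)
  have h_Suc: "h (Suc j) = \<Phi> (x 0) (h j)" for j by (simp add: h_def)
  have h_step: "h (Suc j) \<ominus>\<^bsub>M\<^esub> h j \<in> K j" for j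
  proof (induction j)
    case 0 then show ?case using h K(3) by simp
  next
    case (Suc j)
    then show ?case using contraction[OF x0 h h Suc] by (simp only: h_Suc)
  qed
  \<comment> \<open>The defect of the last iterate. The step from \<open>h d\<close> to
    \<open>h (Suc d)\<close> is \<open>- U E\<close> and lies in \<open>K d\<close>, so
    \<open>U E\<close> is a multiple of \<open>a\<close>; as \<open>V U\<close> is one modulo
    \<open>a\<close>, so is \<open>E\<close>.\<close>
  define E where "E = S (h d) P \<ominus>\<^bsub>M\<^esub> x 0"
  have E: "E \<in> carrier M" using S_closed[OF h PC] x0 by (simp add: E_def)
  interpret PA: ideal "PIdl\<^bsub>M\<^esub> A" M by (rule M.cgenideal_ideal[OF AUV(1)])
  have "h (Suc d) \<ominus>\<^bsub>M\<^esub> h d = \<ominus>\<^bsub>M\<^esub> (U \<otimes>\<^bsub>M\<^esub> E)"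
  proof -
    have "h (Suc d) = h d \<ominus>\<^bsub>M\<^esub> U \<otimes>\<^bsub>M\<^esub> E" unfolding h_Suc \<Phi>_def E_def by (rule refl)
    moreover have "h d \<ominus>\<^bsub>M\<^esub> U \<otimes>\<^bsub>M\<^esub> E \<ominus>\<^bsub>M\<^esub> h d = \<ominus>\<^bsub>M\<^esub> (U \<otimes>\<^bsub>M\<^esub> E)"
      using h[of d] AUV(2) E by algebra
    ultimately show ?thesis by simp
  qed
  then have "\<ominus>\<^bsub>M\<^esub> (U \<otimes>\<^bsub>M\<^esub> E) \<in> PIdl\<^bsub>M\<^esub> A" using h_step[of d] K(4) by auto
  then have "V \<otimes>\<^bsub>M\<^esub> \<ominus>\<^bsub>M\<^esub> (U \<otimes>\<^bsub>M\<^esub> E) \<in> PIdl\<^bsub>M\<^esub> A" by (rule PA.I_l_closed[OF _ AUV(3)])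
  moreover have "(co w \<otimes>\<^bsub>M\<^esub> A) \<otimes>\<^bsub>M\<^esub> E \<in> PIdl\<^bsub>M\<^esub> A" by (rule PA.I_r_closed[OF A_mem E]) (use w in simp)
  ultimately have "V \<otimes>\<^bsub>M\<^esub> \<ominus>\<^bsub>M\<^esub> (U \<otimes>\<^bsub>M\<^esub> E) \<oplus>\<^bsub>M\<^esub> (co w \<otimes>\<^bsub>M\<^esub> A) \<otimes>\<^bsub>M\<^esub> E \<in> PIdl\<^bsub>M\<^esub> A"
    by (rule PA.a_closed)
  moreover have "V \<otimes>\<^bsub>M\<^esub> \<ominus>\<^bsub>M\<^esub> (U \<otimes>\<^bsub>M\<^esub> E) \<oplus>\<^bsub>M\<^esub> (co w \<otimes>\<^bsub>M\<^esub> A) \<otimes>\<^bsub>M\<^esub> E = \<ominus>\<^bsub>M\<^esub> E"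
    unfolding WA[symmetric] using AUV(2,3) E by algebra simp
  ultimately have "E \<in> PIdl\<^bsub>M\<^esub> A" using PA.a_inv_closed[of "\<ominus>\<^bsub>M\<^esub> E"] E by simp
  then obtain Q where Q: "Q \<in> carrier M" "E = Q \<otimes>\<^bsub>M\<^esub> A" unfolding cgenideal_def by blast
  have hP: "S (h d) P = x 0 \<oplus>\<^bsub>M\<^esub> A \<otimes>\<^bsub>M\<^esub> Q"
  proof -
    have "S (h d) P = x 0 \<oplus>\<^bsub>M\<^esub> (S (h d) P \<ominus>\<^bsub>M\<^esub> x 0)"
      by (rule M.add_minus_cancel[OF x0 S_closed[OF h PC], symmetric])
    then show ?thesis using Q AUV(1) by (simp add: E_def[symmetric] M.m_comm)
  qed
  interpret SPh: ring_hom_cring M M "S P" by (rule S_hom[OF PC])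
  \<comment> \<open>Substituting \<open>P\<close> for the variable turns the iteration with target
    \<open>x 0\<close> into the one with target \<open>P\<close>, which has the exact fixed point
    \<open>x 0\<close>. The contraction then shows \<open>h(P)\<close> congruent to
    \<open>x 0\<close> modulo \<open>a\<close>, so that \<open>h\<close> inverts \<open>P\<close> on
    both sides.\<close>
  have k_step: "S P (\<Phi> (x 0) \<alpha>) = \<Phi> P (S P \<alpha>)" if \<alpha>: "\<alpha> \<in> carrier M" for \<alpha>
  proof -
    have cl: "U \<otimes>\<^bsub>M\<^esub> (S \<alpha> P \<ominus>\<^bsub>M\<^esub> x 0) \<in> carrier M" "S \<alpha> P \<in> carrier M"
      using AUV(2) S_closed[OF \<alpha> PC] x0 by simp_all
    have "S P (\<Phi> (x 0) \<alpha>) = S P \<alpha> \<ominus>\<^bsub>M\<^esub> S P U \<otimes>\<^bsub>M\<^esub> (S P (S \<alpha> P) \<ominus>\<^bsub>M\<^esub> S P (x 0))"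
      unfolding \<Phi>_def using \<alpha> cl AUV(2) x0 by (simp add: M.minus_eq)
    also have "S P U = U" unfolding U_def by (rule S_co[OF PC u])
    also have "S P (S \<alpha> P) = S (S P \<alpha>) P" by (rule S_S[OF \<alpha> PC PC])
    also have "S P (x 0) = P" using S_x[OF PC n] by simp
    finally show ?thesis by (simp add: \<Phi>_def)
  qed
  have fixp: "\<Phi> P (x 0) = x 0"
  proof -
    have "\<Phi> P (x 0) = x 0 \<ominus>\<^bsub>M\<^esub> U \<otimes>\<^bsub>M\<^esub> (P \<ominus>\<^bsub>M\<^esub> P)" unfolding \<Phi>_def S_id[OF PC] by (rule refl)
    also have "\<dots> = x 0" using x0 AUV(2) PC by algebra
    finally show ?thesis .
  qed
  have "S P (h j) \<ominus>\<^bsub>M\<^esub> x 0 \<in> K j" for j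
  proof (induction j)
    case 0
    then show ?case using S_closed[OF PC h] x0 K(3) by simp
  next
    case (Suc j)
    have "\<Phi> P (S P (h j)) \<ominus>\<^bsub>M\<^esub> \<Phi> P (x 0) \<in> K (Suc j)"
      by (rule contraction[OF PC S_closed[OF PC h] x0 Suc])
    then show ?case unfolding h_Suc k_step[OF h] fixp .
  qed
  then have "S P (h d) \<ominus>\<^bsub>M\<^esub> x 0 \<in> PIdl\<^bsub>M\<^esub> A" using K(4) by blast
  then obtain Q' where Q': "Q' \<in> carrier M" "S P (h d) \<ominus>\<^bsub>M\<^esub> x 0 = Q' \<otimes>\<^bsub>M\<^esub> A" unfolding cgenideal_def by blast
  have Ph: "S P (h d) = x 0 \<oplus>\<^bsub>M\<^esub> A \<otimes>\<^bsub>M\<^esub> Q'"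
  proof -
    have "S P (h d) = x 0 \<oplus>\<^bsub>M\<^esub> (S P (h d) \<ominus>\<^bsub>M\<^esub> x 0)"
      by (rule M.add_minus_cancel[OF x0 S_closed[OF PC h], symmetric])
    then show ?thesis using Q' AUV(1) by (simp add: M.m_comm)
  qed
  show thesis
    by (rule that[of "h d" Q Q'])
      (use h Q(1) Q'(1) hP Ph in \<open>simp_all add: S_eq x_def A_def co_def M_def\<close>)
qed

section \<open>From inverse substitutions modulo \<open>a\<close> to a coordinate\<close>

context cring
begin

text \<open>With \<open>J = A C\<close> the cofactor of \<open>A\<close> is found in
  \<open>C\<close> itself; membership in the ideal that \<open>A\<close> generates in the whole ring
  would not give this.\<close>

lemma subst_congruent_principal:
  assumes C: "subring C (mpoly_ring R m)" and const: "\<And>c. c \<in> carrier R \<Longrightarrow> indexed_const c \<in> C"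
    and A: "A \<in> C"
    and y: "\<And>i. i < n \<Longrightarrow> y i \<in> C" and z: "\<And>i. i < n \<Longrightarrow> z i \<in> C"
    and yz: "\<And>i. i < n \<Longrightarrow> \<exists>j\<in>C. y i = z i \<oplus>\<^bsub>mpoly_ring R m\<^esub> A \<otimes>\<^bsub>mpoly_ring R m\<^esub> j"
    and P: "P \<in> mpolys R n"
  shows "\<exists>j\<in>C. mpoly_subst R m y P = mpoly_subst R m z P \<oplus>\<^bsub>mpoly_ring R m\<^esub> A \<otimes>\<^bsub>mpoly_ring R m\<^esub> j"
proof -
  define M where "M = mpoly_ring R m"
  interpret M: cring M unfolding M_def by (rule cring_mpoly_ring)
  have CM: "c \<in> carrier M" if "c \<in> C" for c using subringE(1)[OF C] that by (auto simp: M_def)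
  define J where "J = (\<lambda>j. A \<otimes>\<^bsub>M\<^esub> j) ` C"
  note sub = subringE[OF C, folded M_def]
  have "\<exists>j\<in>J. mpoly_subst R m y P = mpoly_subst R m z P \<oplus>\<^bsub>mpoly_ring R m\<^esub> j"
  proof (rule subst_congruent[OF C const _ _ _ _ y z _ P], fold M_def)
    show "J \<subseteq> C" using sub(6)[OF A] by (auto simp: J_def)
    show "\<zero>\<^bsub>M\<^esub> \<in> J" unfolding J_def by (rule image_eqI[of _ _ "\<zero>\<^bsub>M\<^esub>"]) (use sub(2) CM[OF A] in auto)
    show "i \<oplus>\<^bsub>M\<^esub> j \<in> J" if ij: "i \<in> J" "j \<in> J" for i j
    proof -
      obtain p q where "p \<in> C" "q \<in> C" "i = A \<otimes>\<^bsub>M\<^esub> p" "j = A \<otimes>\<^bsub>M\<^esub> q" using ij unfolding J_def by blast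
      then have "i \<oplus>\<^bsub>M\<^esub> j = A \<otimes>\<^bsub>M\<^esub> (p \<oplus>\<^bsub>M\<^esub> q)" using CM[OF A] CM by (simp add: M.r_distr)
      then show ?thesis using sub(7)[OF \<open>p \<in> C\<close> \<open>q \<in> C\<close>] by (auto simp: J_def)
    qed
    show "p \<otimes>\<^bsub>M\<^esub> j \<in> J" if pj: "p \<in> C" "j \<in> J" for p j
    proof -
      obtain q where "q \<in> C" "j = A \<otimes>\<^bsub>M\<^esub> q" using pj unfolding J_def by blast
      then have "p \<otimes>\<^bsub>M\<^esub> j = A \<otimes>\<^bsub>M\<^esub> (p \<otimes>\<^bsub>M\<^esub> q)" using CM[OF A] CM[OF pj(1)] CM[of q] by (simp add: M.m_lcomm)
      then show ?thesis using sub(6)[OF \<open>p \<in> C\<close> \<open>q \<in> C\<close>] by (auto simp: J_def)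
    qed
    show "\<exists>j\<in>J. y i = z i \<oplus>\<^bsub>M\<^esub> j" if "i < n" for i
      using yz[OF that] by (auto simp: J_def M_def)
  qed
  then show ?thesis by (auto simp: J_def M_def)
qed

lemma ring_ops_eq:
  "x \<oplus>\<^bsub>mpoly_ring R n\<^esub> y = x \<oplus>\<^bsub>mpoly_ring R m\<^esub> y" "x \<otimes>\<^bsub>mpoly_ring R n\<^esub> y = x \<otimes>\<^bsub>mpoly_ring R m\<^esub> y"
  by (simp_all add: mpoly_ring_simps)

text \<open>Let \<open>\<tau>\<close> put \<open>F\<close> for the variable \<open>0\<close>. Then
  \<open>\<tau> h\<close> and \<open>h(P)\<close> are both congruent to \<open>x 0\<close> modulo
  \<open>a\<close>, which defines \<open>H\<close>. In the ring generated by \<open>F\<close>,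
  \<open>H\<close> and the variables strictly between \<open>0\<close> and \<open>n\<close>, one has
  \<open>x 0 = \<tau> h - a H\<close>. For \<open>x n\<close>, the element
  \<open>P(\<tau> h)\<close> is computed in two ways, which yields \<open>a x n = a y\<close> with
  \<open>y\<close> in that ring.\<close>

lemma coordinate_of_inverse_mod:
  assumes a: "non_zerodivisor R a" and n: "0 < n"
    and P: "P \<in> mpolys R n" and h: "h \<in> mpolys R n" and Q: "Q \<in> mpolys R n" and Q': "Q' \<in> mpolys R n"
    and hP: "mpoly_subst R n (indexed_var(0 := h)) P = indexed_var 0 \<oplus>\<^bsub>mpoly_ring R n\<^esub> indexed_const a \<otimes>\<^bsub>mpoly_ring R n\<^esub> Q"
    and Ph: "mpoly_subst R n (indexed_var(0 := P)) h = indexed_var 0 \<oplus>\<^bsub>mpoly_ring R n\<^esub> indexed_const a \<otimes>\<^bsub>mpoly_ring R n\<^esub> Q'"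
  shows "is_coordinate R (n + 1) (indexed_const a \<otimes>\<^bsub>mpoly_ring R (n + 1)\<^esub> indexed_var n \<oplus>\<^bsub>mpoly_ring R (n + 1)\<^esub> P)"
proof -
  have aR: "a \<in> carrier R" and a_reg: "\<And>y. y \<in> carrier R \<Longrightarrow> a \<otimes> y = \<zero> \<Longrightarrow> y = \<zero>"
    using a unfolding non_zerodivisor_def by blast+
  define M where "M = mpoly_ring R (n + 1)"
  interpret M: cring M unfolding M_def by (rule cring_mpoly_ring)
  define x where "x = (indexed_var :: nat \<Rightarrow> nat multiset \<Rightarrow> 'a)"
  define A where "A = (indexed_const a :: nat multiset \<Rightarrow> 'a)"
  have xM: "x i \<in> carrier M" if "i < n + 1" for i unfolding x_def M_def by (rule mpoly_var_closed[OF that])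
  have xn: "x i \<in> mpolys R n" if "i < n" for i unfolding x_def by (rule mpoly_var_closed[OF that])
  have AM: "A \<in> carrier M" unfolding A_def M_def by (rule const_closed[OF aR])
  have incl: "p \<in> carrier M" if "p \<in> mpolys R n" for p
    using mpolys_mono[OF that, of "n + 1"] by (simp add: M_def)
  note ops = ring_ops_eq[of n _ _ "n + 1", folded M_def]
  note hP = hP[unfolded ops, folded x_def A_def] and Ph = Ph[unfolded ops, folded x_def A_def]
  \<comment> \<open>Multiplication by \<open>A\<close> acts on coefficients as \<open>a\<close>, so
    regularity of \<open>a\<close> passes to polynomials.\<close>
  have A_cancel: "p = q" if "p \<in> carrier M" "q \<in> carrier M" "A \<otimes>\<^bsub>M\<^esub> p = A \<otimes>\<^bsub>M\<^esub> q" for p q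
  proof
    fix u
    have pq: "p \<in> mpolys R (n + 1)" "q \<in> mpolys R (n + 1)" using that by (simp_all add: M_def)
    have c: "p u \<in> carrier R" "q u \<in> carrier R" using mpolys_coeff[OF pq(1)] mpolys_coeff[OF pq(2)] by auto
    have "a \<otimes> p u = a \<otimes> q u"
      using fun_cong[OF that(3), of u] mult_const_coeff[OF aR pq(1), of u] mult_const_coeff[OF aR pq(2), of u]
      by (simp add: M_def A_def)
    then have "a \<otimes> (p u \<ominus> q u) = \<zero>" using aR c by (simp add: minus_eq r_distr r_minus r_neg)
    then have "p u \<ominus> q u = \<zero>" using a_reg c by simp
    then show "p u = q u" using c by simp
  qed
  define F where "F = A \<otimes>\<^bsub>M\<^esub> x n \<oplus>\<^bsub>M\<^esub> P"
  have F: "F \<in> carrier M" using AM xM[of n] incl[OF P] by (simp add: F_def)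
  have yF: "x(0 := q) \<in> {..<n} \<rightarrow> mpolys R (n + 1)" if "q \<in> carrier M" for q
    using xM that by (auto simp: M_def)
  have yn: "x(0 := q) \<in> {..<n} \<rightarrow> mpolys R n" if "q \<in> mpolys R n" for q
    using xn that by auto
  define \<tau> where "\<tau> = mpoly_subst R (n + 1) (x(0 := F))"
  have \<tau>_hom: "ring_hom_cring (mpoly_ring R n) M \<tau>"
    unfolding \<tau>_def M_def by (rule subst_hom[OF yF[OF F]])
  interpret \<tau>: ring_hom_cring "mpoly_ring R n" M \<tau> by (rule \<tau>_hom)
  have \<tau>x: "\<tau> (x i) = (x(0 := F)) i" if "i < n" for i
    unfolding \<tau>_def by (subst (2) x_def) (rule subst_var[OF yF[OF F] that])
  have \<tau>A: "\<tau> A = A" unfolding \<tau>_def A_def by (rule subst_const[OF yF[OF F] aR])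
  \<comment> \<open>\<open>F\<close> and \<open>P\<close> differ by \<open>A x n\<close>, hence the
    values of \<open>h\<close> at them differ by a multiple of \<open>A\<close>.\<close>
  have "\<exists>j\<in>carrier M. mpoly_subst R (n + 1) (x(0 := F)) h
      = mpoly_subst R (n + 1) (x(0 := P)) h \<oplus>\<^bsub>M\<^esub> A \<otimes>\<^bsub>M\<^esub> j"
    unfolding M_def
  proof (rule subst_congruent_principal[OF _ const_closed _ _ _ _ h], fold M_def)
    show "subring (carrier M) M" by (rule M.carrier_is_subring)
    show "A \<in> carrier M" by (rule AM)
    show "(x(0 := F)) i \<in> carrier M" "(x(0 := P)) i \<in> carrier M" if "i < n" for i
      using that xM F incl[OF P] by auto
    show "\<exists>j\<in>carrier M. (x(0 := F)) i = (x(0 := P)) i \<oplus>\<^bsub>M\<^esub> A \<otimes>\<^bsub>M\<^esub> j" if "i < n" for i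
    proof (cases "i = 0")
      case True
      then show ?thesis
        using AM xM[of n] incl[OF P] by (intro bexI[of _ "x n"]) (simp_all add: F_def M.a_comm)
    next
      case False
      then show ?thesis using that AM xM[of i] by (intro bexI[of _ "\<zero>\<^bsub>M\<^esub>"]) simp_all
    qed
  qed
  then obtain j where j: "j \<in> carrier M" "\<tau> h = mpoly_subst R (n + 1) (x(0 := P)) h \<oplus>\<^bsub>M\<^esub> A \<otimes>\<^bsub>M\<^esub> j"
    unfolding \<tau>_def by blast
  define H where "H = Q' \<oplus>\<^bsub>M\<^esub> j"
  have H: "H \<in> carrier M" using incl[OF Q'] j by (simp add: H_def)
  have \<tau>h: "\<tau> h = x 0 \<oplus>\<^bsub>M\<^esub> A \<otimes>\<^bsub>M\<^esub> H"
  proof -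
    have "mpoly_subst R (n + 1) (x(0 := P)) h = x 0 \<oplus>\<^bsub>M\<^esub> A \<otimes>\<^bsub>M\<^esub> Q'"
      using subst_incl[OF yn[OF P] h, of "n + 1"] Ph by simp
    then show ?thesis
      unfolding j(2) H_def using xM[of 0] AM incl[OF Q'] j(1) by (simp add: M.r_distr M.a_assoc)
  qed
  \<comment> \<open>Generators other than \<open>F\<close> are counted from 2 as in
    \<open>is_coordinate\<close>: \<open>H\<close> takes the place of \<open>x 0\<close>, followed
    by \<open>x 1\<close> up to \<open>x (n - 1)\<close>.\<close>
  define G where "G i = (if i = 2 then H else x (i - 2))" for i
  define K where "K = indexed_const ` carrier R \<union> insert F (G ` {2..n + 1})"
  have GM: "G ` {2..n + 1} \<subseteq> carrier M" using H xM by (auto simp: G_def)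
  have KM: "K \<subseteq> carrier M" unfolding K_def using GM F const_closed by (auto simp: M_def)
  define C where "C = generate_ring M K"
  have C: "subring C M" unfolding C_def by (rule M.generate_ring_is_subring[OF KM])
  note sub = subringE[OF C]
  have KC: "K \<subseteq> C" unfolding C_def by (auto intro: generate_ring.incl)
  have coC: "indexed_const c \<in> C" if "c \<in> carrier R" for c using KC that by (auto simp: K_def)
  have FC: "F \<in> C" using KC by (auto simp: K_def)
  have HC: "H \<in> C"
  proof -
    have "G 2 \<in> G ` {2..n + 1}" using n by auto
    then show ?thesis using KC by (auto simp: K_def G_def)
  qed
  have xC: "x i \<in> C" if "0 < i" "i < n" for i
  proof -
    have "G (i + 2) \<in> G ` {2..n + 1}" using that by auto
    then have "G (i + 2) \<in> C" using KC by (auto simp: K_def)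
    then show ?thesis using that by (simp add: G_def)
  qed
  have AC: "A \<in> C" unfolding A_def by (rule coC[OF aR])
  have CM: "c \<in> carrier M" if "c \<in> C" for c using sub(1) that by auto
  have \<tau>C: "\<tau> q \<in> C" if "q \<in> mpolys R n" for q
    unfolding \<tau>_def
  proof (rule subst_in_subring[OF C[unfolded M_def] coC _ that])
    show "(x(0 := F)) i \<in> C" if "i < n" for i using xC FC that by auto
  qed
  have x0C: "x 0 \<in> C"
  proof -
    have "\<ominus>\<^bsub>M\<^esub> (A \<otimes>\<^bsub>M\<^esub> H) \<in> C" by (rule sub(5)[OF sub(6)[OF AC HC]])
    then have "\<tau> h \<oplus>\<^bsub>M\<^esub> \<ominus>\<^bsub>M\<^esub> (A \<otimes>\<^bsub>M\<^esub> H) \<in> C" by (rule sub(7)[OF \<tau>C[OF h]])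
    moreover have "\<tau> h \<oplus>\<^bsub>M\<^esub> \<ominus>\<^bsub>M\<^esub> (A \<otimes>\<^bsub>M\<^esub> H) = x 0"
      unfolding \<tau>h using xM[of 0] AM H by (simp add: M.a_assoc M.r_neg)
    ultimately show ?thesis by simp
  qed
  have xnC: "x i \<in> C" if "i < n" for i using x0C xC that by (cases "i = 0") auto
  \<comment> \<open>The congruence is taken inside \<open>C\<close>: \<open>\<tau> h\<close> and
    \<open>x 0\<close> differ by \<open>A H\<close> with \<open>H\<close> in \<open>C\<close>, hence
    the cofactor \<open>q\<close> of the result is in \<open>C\<close> as well.\<close>
  have "\<exists>q\<in>C. mpoly_subst R (n + 1) (x(0 := \<tau> h)) P = mpoly_subst R (n + 1) x P \<oplus>\<^bsub>M\<^esub> A \<otimes>\<^bsub>M\<^esub> q"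
    unfolding M_def
  proof (rule subst_congruent_principal[OF C[unfolded M_def] coC AC _ _ _ P], fold M_def)
    show "(x(0 := \<tau> h)) i \<in> C" "x i \<in> C" if "i < n" for i
      using that xnC \<tau>C[OF h] by auto
    show "\<exists>j\<in>C. (x(0 := \<tau> h)) i = x i \<oplus>\<^bsub>M\<^esub> A \<otimes>\<^bsub>M\<^esub> j" if "i < n" for i
    proof (cases "i = 0")
      case True
      then show ?thesis using HC \<tau>h by auto
    next
      case False
      then show ?thesis using that AM xM[of i] sub(2) by (intro bexI[of _ "\<zero>\<^bsub>M\<^esub>"]) simp_all
    qed
  qed
  then obtain q where q: "q \<in> C" "mpoly_subst R (n + 1) (x(0 := \<tau> h)) P = P \<oplus>\<^bsub>M\<^esub> A \<otimes>\<^bsub>M\<^esub> q"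
    using subst_var_incl[OF P, of "n + 1"] by (auto simp: x_def)
  \<comment> \<open>The second computation: \<open>\<tau>\<close> is applied to
    \<open>P(h) = x 0 + a Q\<close>, and \<open>\<tau> (x 0) = F\<close> brings in the multiple of
    \<open>x n\<close>.\<close>
  have "mpoly_subst R (n + 1) (x(0 := \<tau> h)) P = \<tau> (mpoly_subst R n (x(0 := h)) P)"
  proof -
    have "\<tau> (mpoly_subst R n (x(0 := h)) P) = mpoly_subst R (n + 1) (\<lambda>i. \<tau> ((x(0 := h)) i)) P"
      unfolding \<tau>_def by (rule subst_subst[OF yn[OF h] yF[OF F] P])
    also have "\<dots> = mpoly_subst R (n + 1) (x(0 := \<tau> h)) P"
    proof (rule subst_cong[OF _ P])
      show eq: "\<tau> ((x(0 := h)) i) = (x(0 := \<tau> h)) i" if "i < n" for i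
        using \<tau>x[OF that] by simp
      show "(\<lambda>i. \<tau> ((x(0 := h)) i)) \<in> {..<n} \<rightarrow> mpolys R (n + 1)"
        using yF[OF CM[OF \<tau>C[OF h]]] eq by (simp add: Pi_iff)
    qed
    finally show ?thesis by simp
  qed
  also have "\<dots> = \<tau> (x 0 \<oplus>\<^bsub>mpoly_ring R n\<^esub> A \<otimes>\<^bsub>mpoly_ring R n\<^esub> Q)" unfolding hP ops by (rule refl)
  also have "\<dots> = \<tau> (x 0) \<oplus>\<^bsub>M\<^esub> \<tau> A \<otimes>\<^bsub>M\<^esub> \<tau> Q"
    using xn[OF n] const_closed[OF aR, of n] Q by (simp add: A_def)
  also have "\<dots> = F \<oplus>\<^bsub>M\<^esub> A \<otimes>\<^bsub>M\<^esub> \<tau> Q" using \<tau>x[OF n] \<tau>A by simp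
  finally have key: "P \<oplus>\<^bsub>M\<^esub> A \<otimes>\<^bsub>M\<^esub> q = F \<oplus>\<^bsub>M\<^esub> A \<otimes>\<^bsub>M\<^esub> \<tau> Q" using q(2) by simp
  have cl: "P \<in> carrier M" "x n \<in> carrier M" "\<tau> Q \<in> carrier M" "q \<in> carrier M"
    using incl[OF P] xM[of n] CM[OF \<tau>C[OF Q]] CM[OF q(1)] by auto
  have "A \<otimes>\<^bsub>M\<^esub> x n = A \<otimes>\<^bsub>M\<^esub> (q \<ominus>\<^bsub>M\<^esub> \<tau> Q)"
  proof -
    have "A \<otimes>\<^bsub>M\<^esub> (q \<ominus>\<^bsub>M\<^esub> \<tau> Q) = (P \<oplus>\<^bsub>M\<^esub> A \<otimes>\<^bsub>M\<^esub> q) \<ominus>\<^bsub>M\<^esub> (P \<oplus>\<^bsub>M\<^esub> A \<otimes>\<^bsub>M\<^esub> \<tau> Q)"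
      using cl AM by algebra
    also have "\<dots> = (A \<otimes>\<^bsub>M\<^esub> x n \<oplus>\<^bsub>M\<^esub> P \<oplus>\<^bsub>M\<^esub> A \<otimes>\<^bsub>M\<^esub> \<tau> Q) \<ominus>\<^bsub>M\<^esub> (P \<oplus>\<^bsub>M\<^esub> A \<otimes>\<^bsub>M\<^esub> \<tau> Q)"
      unfolding key F_def by (rule refl)
    also have "\<dots> = A \<otimes>\<^bsub>M\<^esub> x n" using cl AM by algebra
    finally show ?thesis by simp
  qed
  then have "x n = q \<ominus>\<^bsub>M\<^esub> \<tau> Q" by (rule A_cancel[OF cl(2) M.minus_closed[OF cl(4,3)]])
  then have "x n \<in> C" using sub(7)[OF q(1) sub(5)[OF \<tau>C[OF Q]]] by (simp add: M.minus_eq)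
  then have vC: "indexed_var i \<in> C" if "i < n + 1" for i
    using xnC that by (cases "i = n") (auto simp: x_def)
  have "C = mpolys R (n + 1)" by (rule vars_generate[OF C[unfolded M_def] coC vC])
  then have "mpolys R (n + 1) = generate_ring (mpoly_ring R (n + 1)) (indexed_const ` carrier R \<union> insert F (G ` {2..n + 1}))"
    by (simp add: C_def K_def M_def)
  moreover have "is_coordinate R (n + 1) F"
    unfolding is_coordinate_def
    using calculation F GM by (intro conjI exI[of _ G]) (auto simp: M_def)
  ultimately show ?thesis by (simp add: F_def M_def A_def x_def)
qed

end

section \<open>Points of affine algebras\<close>

text \<open>Polynomials are coefficient lists with the leading term first, hence the reversal.
  Splitting means that there are as many roots as the degree, so at least one.\<close>

lemma (in algebraically_closed) ex_root:
  assumes "\<And>i. a i \<in> carrier L" "a d \<noteq> \<zero>" "d > 0"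
  shows "\<exists>c\<in>carrier L. (\<Oplus>i\<in>{..d}. a i \<otimes> c [^] (i::nat)) = \<zero>"
proof -
  have ev: "eval (map a (rev [0..<n])) c = (\<Oplus>i\<in>{..<n}. a i \<otimes> c [^] i)" if "c \<in> carrier L" for c n
  proof (induction n)
    case (Suc n)
    have "(\<Oplus>i\<in>{..<Suc n}. a i \<otimes> c [^] i) = a n \<otimes> c [^] n \<oplus> (\<Oplus>i\<in>{..<n}. a i \<otimes> c [^] i)"
      unfolding lessThan_Suc using assms(1) that by (subst finsum_insert) auto
    then show ?case using Suc by simp
  qed simp
  define p where "p = map a (rev [0..<Suc d])"
  have p: "p \<in> carrier (poly_ring L)"
    unfolding univ_poly_carrier[symmetric] polynomial_def using assms by (auto simp: p_def)
  have "degree p = d" by (simp add: p_def)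
  moreover have "splitted p" by (rule roots_over_carrier[OF p])
  ultimately have "roots p \<noteq> {#}" using assms(3) by (auto simp: splitted_def)
  then obtain c where "c \<in># roots p" by blast
  then have "is_root p c" using roots_mem_iff_is_root[OF p] by blast
  then have "c \<in> carrier L" "eval p c = \<zero>" by (auto simp: is_root_def)
  then show ?thesis using ev[of c "Suc d"] by (auto simp: p_def lessThan_Suc_atMost simp del: upt_Suc)
qed

text \<open>If the polynomial is not constant, a root of the polynomial minus \<open>\<one>\<close>
  is a point where its value is \<open>\<one>\<close>. This replaces a comparison of the number of
  roots with the size of the field.\<close>

lemma (in algebraically_closed) ex_nonroot:
  assumes "\<And>i. a i \<in> carrier L" "a d \<noteq> \<zero>"
  shows "\<exists>c\<in>carrier L. (\<Oplus>i\<in>{..d}. a i \<otimes> c [^] (i::nat)) \<noteq> \<zero>"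
proof (cases "d = 0")
  case True
  then show ?thesis using assms by (auto intro!: bexI[of _ \<one>])
next
  case False
  define b where "b = a(0 := a 0 \<ominus> \<one>)"
  have b: "b i \<in> carrier L" for i using assms(1) by (simp add: b_def)
  have split: "(\<Oplus>i\<in>{..d}. f i \<otimes> c [^] i) = f 0 \<oplus> (\<Oplus>i\<in>{1..d}. f i \<otimes> c [^] i)"
    if "c \<in> carrier L" "\<And>i. f i \<in> carrier L" for f c
  proof -
    have "{..d} = insert 0 {1..d}" by auto
    then show ?thesis using that by (simp add: finsum_insert Pi_def)
  qed
  obtain c where c: "c \<in> carrier L" and eq: "(\<Oplus>i\<in>{..d}. b i \<otimes> c [^] i) = \<zero>"
    using ex_root[of b d] b False assms(2) by (auto simp: b_def)
  have "(\<Oplus>i\<in>{1..d}. b i \<otimes> c [^] i) = (\<Oplus>i\<in>{1..d}. a i \<otimes> c [^] i)"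
    using assms(1) c by (intro finsum_cong') (auto simp: b_def)
  moreover have "(\<Oplus>i\<in>{1..d}. a i \<otimes> c [^] i) \<in> carrier L"
    using assms(1) c by (intro finsum_closed) auto
  ultimately have "(\<Oplus>i\<in>{..d}. b i \<otimes> c [^] i) = (\<Oplus>i\<in>{..d}. a i \<otimes> c [^] i) \<ominus> \<one>"
    using split[of c a] split[of c b] c assms(1) b by (simp add: b_def minus_eq a_ac)
  moreover have "(\<Oplus>i\<in>{..d}. a i \<otimes> c [^] i) \<in> carrier L"
    using assms(1) c by (intro finsum_closed) auto
  ultimately have "(\<Oplus>i\<in>{..d}. a i \<otimes> c [^] i) = \<one>"
    using eq by (metis r_right_minus_eq one_closed)
  then show ?thesis using c one_not_zero by (intro bexI[of _ c]) simp_all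
qed

section \<open>Extension of homomorphisms and the Nullstellensatz\<close>

lemma factor_hom:
  assumes "ring_hom_cring P D f" "ring_hom_cring P k g"
    and ker: "\<And>p. p \<in> carrier P \<Longrightarrow> f p = \<zero>\<^bsub>D\<^esub> \<Longrightarrow> g p = \<zero>\<^bsub>k\<^esub>"
  obtains \<psi> where "\<psi> \<in> ring_hom (D\<lparr>carrier := f ` carrier P\<rparr>) k" "\<And>p. p \<in> carrier P \<Longrightarrow> \<psi> (f p) = g p"
proof -
  interpret f: ring_hom_cring P D f by fact
  interpret g: ring_hom_cring P k g by fact
  have wd: "g p = g q" if "p \<in> carrier P" "q \<in> carrier P" "f p = f q" for p q
  proof -
    have "f (p \<ominus>\<^bsub>P\<^esub> q) = \<zero>\<^bsub>D\<^esub>"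
      using that by (simp add: f.R.minus_eq f.S.r_neg)
    then have "g (p \<ominus>\<^bsub>P\<^esub> q) = \<zero>\<^bsub>k\<^esub>" using ker that by simp
    then have "g p \<ominus>\<^bsub>k\<^esub> g q = \<zero>\<^bsub>k\<^esub>" using that by (simp add: f.R.minus_eq g.S.minus_eq)
    then show ?thesis using that by simp
  qed
  \<comment> \<open>Any preimage serves, by \<open>wd\<close>. Off the image the value is arbitrary,
    which is why the domain is the ring with its carrier cut down to the image.\<close>
  define \<psi> where "\<psi> x = g (SOME p. p \<in> carrier P \<and> f p = x)" for x
  have \<psi>: "\<psi> (f p) = g p" if "p \<in> carrier P" for p
  proof -
    have "(SOME q. q \<in> carrier P \<and> f q = f p) \<in> carrier P \<and> f (SOME q. q \<in> carrier P \<and> f q = f p) = f p"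
      by (rule someI[of _ p]) (use that in simp)
    then show ?thesis unfolding \<psi>_def using wd that by blast
  qed
  have "\<psi> \<in> ring_hom (D\<lparr>carrier := f ` carrier P\<rparr>) k"
  proof (rule ring_hom_memI)
    fix x y assume "x \<in> carrier (D\<lparr>carrier := f ` carrier P\<rparr>)" "y \<in> carrier (D\<lparr>carrier := f ` carrier P\<rparr>)"
    then obtain p q where pq: "p \<in> carrier P" "x = f p" "q \<in> carrier P" "y = f q" by auto
    show "\<psi> x \<in> carrier k" using pq \<psi> by simp
    have "x \<otimes>\<^bsub>D\<^esub> y = f (p \<otimes>\<^bsub>P\<^esub> q)" using pq by simp
    then show "\<psi> (x \<otimes>\<^bsub>D\<lparr>carrier := f ` carrier P\<rparr>\<^esub> y) = \<psi> x \<otimes>\<^bsub>k\<^esub> \<psi> y"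
      using \<psi>[of "p \<otimes>\<^bsub>P\<^esub> q"] \<psi>[OF pq(1)] \<psi>[OF pq(3)] pq by simp
    have "x \<oplus>\<^bsub>D\<^esub> y = f (p \<oplus>\<^bsub>P\<^esub> q)" using pq by simp
    then show "\<psi> (x \<oplus>\<^bsub>D\<lparr>carrier := f ` carrier P\<rparr>\<^esub> y) = \<psi> x \<oplus>\<^bsub>k\<^esub> \<psi> y"
      using \<psi>[of "p \<oplus>\<^bsub>P\<^esub> q"] \<psi>[OF pq(1)] \<psi>[OF pq(3)] pq by simp
  next
    show "\<psi> \<one>\<^bsub>D\<lparr>carrier := f ` carrier P\<rparr>\<^esub> = \<one>\<^bsub>k\<^esub>" using \<psi>[of "\<one>\<^bsub>P\<^esub>"] by simp
  qed
  then show thesis using that \<psi> by blast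
qed

text \<open>The inductive form of the Nullstellensatz: it passes to towers of finitely generated extensions.\<close>

definition hom_extendable :: "('k, 'c) ring_scheme \<Rightarrow> ('d, 'e) ring_scheme \<Rightarrow> 'd set \<Rightarrow> 'd set \<Rightarrow> bool"
  where "hom_extendable k D A B \<longleftrightarrow> (\<forall>v\<in>B. v \<noteq> \<zero>\<^bsub>D\<^esub> \<longrightarrow> (\<exists>u\<in>A. u \<noteq> \<zero>\<^bsub>D\<^esub> \<and>
     (\<forall>\<phi>\<in>ring_hom (D\<lparr>carrier := A\<rparr>) k. \<phi> u \<noteq> \<zero>\<^bsub>k\<^esub> \<longrightarrow>
       (\<exists>\<psi>\<in>ring_hom (D\<lparr>carrier := B\<rparr>) k. (\<forall>x\<in>A. \<psi> x = \<phi> x) \<and> \<psi> v \<noteq> \<zero>\<^bsub>k\<^esub>))))"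

text \<open>\<open>B\<close> is \<open>A[b]\<close>. If \<open>b\<close> is transcendental,
  \<open>v\<close> is a polynomial \<open>g\<close> in \<open>b\<close>, and any non-root of the
  image of \<open>g\<close> serves as the value of \<open>b\<close>. If \<open>b\<close> is
  algebraic, its value must be a root of the image of a minimal relation, and a non-zero multiple of
  \<open>v\<close> that lies in \<open>A\<close> keeps \<open>v\<close> from vanishing. The element
  \<open>u\<close> collects what must stay non-zero.\<close>

lemma hom_extendable_simple:
  fixes k :: "('k, 'c) ring_scheme" and D :: "('d, 'e) ring_scheme"
  assumes "algebraically_closed k" "domain D" "subring A D" "b \<in> carrier D"
  obtains B where "subring B D" "A \<subseteq> B" "b \<in> B" "hom_extendable k D A B"
proof -
  interpret k: algebraically_closed k by fact
  interpret D: domain D by fact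
  define A' where "A' = D\<lparr>carrier := A\<rparr>"
  have A'_simps: "carrier A' = A" "\<zero>\<^bsub>A'\<^esub> = \<zero>\<^bsub>D\<^esub>" "\<one>\<^bsub>A'\<^esub> = \<one>\<^bsub>D\<^esub>" "x \<otimes>\<^bsub>A'\<^esub> y = x \<otimes>\<^bsub>D\<^esub> y" "x \<oplus>\<^bsub>A'\<^esub> y = x \<oplus>\<^bsub>D\<^esub> y" for x y
    by (simp_all add: A'_def)
  have AD: "A \<subseteq> carrier D" using subringE(1)[OF assms(3)] .
  interpret A': domain A'
    unfolding A'_def by (rule D.subring_is_domain[OF assms(3)])
  define P where "P = UP A'"
  interpret U: UP_domain A' P
    by unfold_locales (simp add: P_def)
  have id: "id \<in> ring_hom A' D"
    by (rule ring_hom_memI) (use AD in \<open>auto simp: A'_simps\<close>)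
  have pre: "UP_pre_univ_prop A' D id"
    by (rule UP_pre_univ_propI) (use id in \<open>auto intro: A'.is_cring D.is_cring\<close>)
  interpret E: UP_pre_univ_prop A' D id P
    using pre by (simp_all add: P_def)
  define ev where "ev = UnivPoly.eval A' D id b"
  have ev_hom: "ev \<in> ring_hom P D" unfolding ev_def by (rule E.eval_ring_hom[OF assms(4)])
  interpret ev: ring_hom_cring P D ev by unfold_locales (rule ev_hom)
  have ev_const: "ev (monom P r 0) = r" if "r \<in> A" for r
    unfolding ev_def using E.eval_const[OF assms(4), of r] that by (simp add: A'_simps)
  have ev_smult: "ev (r \<odot>\<^bsub>P\<^esub> p) = r \<otimes>\<^bsub>D\<^esub> ev p" if "r \<in> A" "p \<in> carrier P" for r p
    using that ev_const ev.hom_mult[of "monom P r 0" p] by (simp add: U.monom_mult_is_smult A'_simps)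
  define B where "B = ev ` carrier P"
  have "subring B D"
    unfolding B_def
    by (rule ring_hom_ring.img_is_subring[OF ring_hom_ringI2[OF U.UP_ring cring.axioms(1)[OF D.is_cring] ev_hom]
        ring.carrier_is_subring[OF U.UP_ring]])
  have AB: "A \<subseteq> B"
  proof
    fix r assume "r \<in> A"
    then have "monom P r 0 \<in> carrier P" by (simp add: A'_simps)
    with ev_const[OF \<open>r \<in> A\<close>] show "r \<in> B" unfolding B_def by force
  qed
  have bB: "b \<in> B"
  proof -
    have "monom P \<one>\<^bsub>A'\<^esub> 1 \<in> carrier P" by simp
    moreover have "ev (monom P \<one>\<^bsub>A'\<^esub> 1) = b"
      unfolding ev_def by (rule E.eval_monom1[OF assms(4)])
    ultimately show ?thesis unfolding B_def by force
  qed
  have "hom_extendable k D A B"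
    unfolding hom_extendable_def
  proof (intro ballI impI)
    fix v assume v: "v \<in> B" "v \<noteq> \<zero>\<^bsub>D\<^esub>"
    \<comment> \<open>A value \<open>c\<close> for \<open>b\<close> is admissible as soon as
      evaluation at \<open>c\<close> kills every relation of \<open>b\<close> over
      \<open>A\<close>.\<close>
    have ext: "\<exists>\<psi>\<in>ring_hom (D\<lparr>carrier := B\<rparr>) k. (\<forall>x\<in>A. \<psi> x = \<phi> x) \<and>
        (\<forall>p\<in>carrier P. \<psi> (ev p) = (\<Oplus>\<^bsub>k\<^esub>i\<in>{..deg A' p}. \<phi> (coeff P p i) \<otimes>\<^bsub>k\<^esub> c [^]\<^bsub>k\<^esub> i))"
      if \<phi>: "\<phi> \<in> ring_hom (D\<lparr>carrier := A\<rparr>) k" and c: "c \<in> carrier k"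
        and ker: "\<And>p. p \<in> carrier P \<Longrightarrow> ev p = \<zero>\<^bsub>D\<^esub> \<Longrightarrow> UnivPoly.eval A' k \<phi> c p = \<zero>\<^bsub>k\<^esub>"
      for \<phi> c
    proof -
      have pre: "UP_pre_univ_prop A' k \<phi>"
        by (rule UP_pre_univ_propI[OF A'.is_cring k.is_cring]) (use \<phi> in \<open>simp add: A'_def\<close>)
      interpret F: UP_pre_univ_prop A' k \<phi> P
        using pre by (simp_all add: P_def)
      have "ring_hom_cring P k (UnivPoly.eval A' k \<phi> c)"
        by unfold_locales (rule F.eval_ring_hom[OF c])
      then obtain \<psi> where \<psi>: "\<psi> \<in> ring_hom (D\<lparr>carrier := B\<rparr>) k"
        "\<And>p. p \<in> carrier P \<Longrightarrow> \<psi> (ev p) = UnivPoly.eval A' k \<phi> c p"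
        using factor_hom[OF ev.ring_hom_cring_axioms, of k "UnivPoly.eval A' k \<phi> c"] ker
        unfolding B_def by blast
      have "\<psi> x = \<phi> x" if "x \<in> A" for x
        using \<psi>(2)[of "monom P x 0"] ev_const[OF that] F.eval_const[OF c, of x] that
        by (simp add: A'_simps)
      with \<psi> show ?thesis by (auto simp: U.eval_on_carrier)
    qed
    show "\<exists>u\<in>A. u \<noteq> \<zero>\<^bsub>D\<^esub> \<and> (\<forall>\<phi>\<in>ring_hom (D\<lparr>carrier := A\<rparr>) k. \<phi> u \<noteq> \<zero>\<^bsub>k\<^esub> \<longrightarrow>
       (\<exists>\<psi>\<in>ring_hom (D\<lparr>carrier := B\<rparr>) k. (\<forall>x\<in>A. \<psi> x = \<phi> x) \<and> \<psi> v \<noteq> \<zero>\<^bsub>k\<^esub>))"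
    proof (cases "\<forall>p\<in>carrier P. ev p = \<zero>\<^bsub>D\<^esub> \<longrightarrow> p = \<zero>\<^bsub>P\<^esub>")
      case True
      obtain g where g: "g \<in> carrier P" "v = ev g" using v by (auto simp: B_def)
      have "g \<noteq> \<zero>\<^bsub>P\<^esub>" using g v by auto
      \<comment> \<open>A non-zero image of the leading coefficient prevents the image of
        \<open>g\<close> from being the zero polynomial, hence a non-root exists.\<close>
      define u where "u = coeff P g (deg A' g)"
      have u: "u \<in> A" "u \<noteq> \<zero>\<^bsub>D\<^esub>"
        using U.lcoeff_nonzero2[OF g(1) \<open>g \<noteq> \<zero>\<^bsub>P\<^esub>\<close>] U.coeff_closed[OF g(1)] by (simp_all add: u_def A'_simps)
      show ?thesis
      proof (intro bexI[of _ u] conjI ballI impI u)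
        fix \<phi> assume \<phi>: "\<phi> \<in> ring_hom (D\<lparr>carrier := A\<rparr>) k" and "\<phi> u \<noteq> \<zero>\<^bsub>k\<^esub>"
        have "\<phi> (coeff P g i) \<in> carrier k" for i
          using ring_hom_closed[OF \<phi>, of "coeff P g i"] U.coeff_closed[OF g(1), of i] by (simp add: A'_simps)
        then obtain c where c: "c \<in> carrier k"
          "(\<Oplus>\<^bsub>k\<^esub>i\<in>{..deg A' g}. \<phi> (coeff P g i) \<otimes>\<^bsub>k\<^esub> c [^]\<^bsub>k\<^esub> i) \<noteq> \<zero>\<^bsub>k\<^esub>"
          using k.ex_nonroot[of "\<lambda>i. \<phi> (coeff P g i)" "deg A' g"] \<open>\<phi> u \<noteq> \<zero>\<^bsub>k\<^esub>\<close> by (auto simp: u_def)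
        have "UnivPoly.eval A' k \<phi> c \<zero>\<^bsub>P\<^esub> = \<zero>\<^bsub>k\<^esub>"
        proof -
          have "ring_hom_cring A' k \<phi>"
            by unfold_locales (use \<phi> in \<open>simp add: A'_def\<close>)
          then have "\<phi> \<zero>\<^bsub>A'\<^esub> = \<zero>\<^bsub>k\<^esub>" by (rule ring_hom_cring.hom_zero)
          then show ?thesis using c by (simp add: U.eval_on_carrier)
        qed
        then obtain \<psi> where "\<psi> \<in> ring_hom (D\<lparr>carrier := B\<rparr>) k" "\<forall>x\<in>A. \<psi> x = \<phi> x"
          "\<forall>p\<in>carrier P. \<psi> (ev p) = (\<Oplus>\<^bsub>k\<^esub>i\<in>{..deg A' p}. \<phi> (coeff P p i) \<otimes>\<^bsub>k\<^esub> c [^]\<^bsub>k\<^esub> i)"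
          using ext[OF \<phi> c(1)] True by blast
        then show "\<exists>\<psi>\<in>ring_hom (D\<lparr>carrier := B\<rparr>) k. (\<forall>x\<in>A. \<psi> x = \<phi> x) \<and> \<psi> v \<noteq> \<zero>\<^bsub>k\<^esub>"
          using c(2) g by auto
      qed
    next
      case False
      \<comment> \<open>The non-zero relations of \<open>b\<close>. As \<open>A\<close> need not be
        a field, division by one of least degree is pseudo-division, at the price of powers of the
        leading coefficient \<open>lf\<close>.\<close>
      define N where "N f \<longleftrightarrow> f \<in> carrier P \<and> ev f = \<zero>\<^bsub>D\<^esub> \<and> f \<noteq> \<zero>\<^bsub>P\<^esub>" for f
      obtain f where f: "N f" and fmin: "\<And>g. N g \<Longrightarrow> deg A' f \<le> deg A' g"
        using False ex_has_least_nat[of N _ "deg A'"] unfolding N_def by blast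
      have fP: "f \<in> carrier P" "ev f = \<zero>\<^bsub>D\<^esub>" "f \<noteq> \<zero>\<^bsub>P\<^esub>" using f by (auto simp: N_def)
      define lf where "lf = coeff P f (deg A' f)"
      have lf: "lf \<in> A" "lf \<noteq> \<zero>\<^bsub>D\<^esub>"
        using U.lcoeff_nonzero2[OF fP(1,3)] U.coeff_closed[OF fP(1)] by (simp_all add: lf_def A'_simps)
      have pow: "r [^]\<^bsub>A'\<^esub> j \<in> A" "r \<noteq> \<zero>\<^bsub>D\<^esub> \<Longrightarrow> r [^]\<^bsub>A'\<^esub> j \<noteq> \<zero>\<^bsub>D\<^esub>" if "r \<in> A" for r and j :: nat
      proof -
        show *: "r [^]\<^bsub>A'\<^esub> j \<in> A" for j :: nat using that A'.nat_pow_closed[of r j] by (simp add: A'_simps)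
        show "r [^]\<^bsub>A'\<^esub> j \<noteq> \<zero>\<^bsub>D\<^esub>" if "r \<noteq> \<zero>\<^bsub>D\<^esub>"
        proof (induction j)
          case 0 then show ?case by (simp add: A'_simps)
        next
          case (Suc j)
          then show ?case using A'.integral[of "r [^]\<^bsub>A'\<^esub> j" r] * that \<open>r \<in> A\<close> by (auto simp: A'_simps)
        qed
      qed
      \<comment> \<open>Polynomials whose value at \<open>b\<close> is a non-zero multiple of
        \<open>v\<close> in \<open>A[b]\<close>. One of least degree turns out to be constant, which
        yields a non-zero multiple of \<open>v\<close> in \<open>A\<close>.\<close>
      define V where "V r \<longleftrightarrow> r \<in> carrier P \<and> ev r \<noteq> \<zero>\<^bsub>D\<^esub> \<and> (\<exists>w\<in>B. ev r = v \<otimes>\<^bsub>D\<^esub> w)" for r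
      have BD: "B \<subseteq> carrier D" using subringE(1)[OF \<open>subring B D\<close>] .
      have "\<exists>r. V r"
      proof -
        obtain g where "g \<in> carrier P" "v = ev g" using v by (auto simp: B_def)
        moreover have "\<one>\<^bsub>D\<^esub> \<in> B" using subringE(3)[OF \<open>subring B D\<close>] .
        ultimately have "V g" using v BD unfolding V_def by (intro conjI bexI[of _ "\<one>\<^bsub>D\<^esub>"]) auto
        then show ?thesis by blast
      qed
      then obtain r where r: "V r" and rmin: "\<And>g. V g \<Longrightarrow> deg A' r \<le> deg A' g"
        using ex_has_least_nat[of V _ "deg A'"] by blast
      have rP: "r \<in> carrier P" "ev r \<noteq> \<zero>\<^bsub>D\<^esub>" using r by (auto simp: V_def)
      obtain w where w: "w \<in> B" "ev r = v \<otimes>\<^bsub>D\<^esub> w" using r by (auto simp: V_def)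
      have "r \<noteq> \<zero>\<^bsub>P\<^esub>" using rP by auto
      define lr where "lr = coeff P r (deg A' r)"
      have lr: "lr \<in> A" "lr \<noteq> \<zero>\<^bsub>D\<^esub>"
        using U.lcoeff_nonzero2[OF rP(1) \<open>r \<noteq> \<zero>\<^bsub>P\<^esub>\<close>] U.coeff_closed[OF rP(1)] by (simp_all add: lr_def A'_simps)
      have vD: "v \<in> carrier D" "w \<in> carrier D" using v w BD by auto
      \<comment> \<open>The pseudo-remainder of \<open>r\<close> by \<open>f\<close> takes at
        \<open>b\<close> the same value up to a power of \<open>lf\<close>, so it satisfies
        \<open>V\<close> again and minimality of \<open>r\<close> applies.\<close>
      have deg_rf: "deg A' r < deg A' f"
      proof -
        obtain q s and j :: nat where qs: "q \<in> carrier P" "s \<in> carrier P"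
          "lf [^]\<^bsub>A'\<^esub> j \<odot>\<^bsub>P\<^esub> r = f \<otimes>\<^bsub>P\<^esub> q \<oplus>\<^bsub>P\<^esub> s" "s = \<zero>\<^bsub>P\<^esub> \<or> deg A' s < deg A' f"
          using U.long_div_theorem[OF fP(1) rP(1) fP(3)] unfolding lf_def by blast
        have "ev s = ev (lf [^]\<^bsub>A'\<^esub> j \<odot>\<^bsub>P\<^esub> r)"
          unfolding qs(3) using qs fP by simp
        also have "\<dots> = lf [^]\<^bsub>A'\<^esub> j \<otimes>\<^bsub>D\<^esub> ev r" by (rule ev_smult[OF pow(1)[OF lf(1)] rP(1)])
        finally have evs: "ev s = lf [^]\<^bsub>A'\<^esub> j \<otimes>\<^bsub>D\<^esub> ev r" .
        have lfD: "lf [^]\<^bsub>A'\<^esub> j \<in> carrier D" "lf [^]\<^bsub>A'\<^esub> j \<in> B" using pow(1)[OF lf(1)] AD AB by auto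
        have "ev s \<noteq> \<zero>\<^bsub>D\<^esub>"
          using evs D.integral[of "lf [^]\<^bsub>A'\<^esub> j" "ev r"] pow(2)[OF lf] lfD rP by auto
        moreover have "ev s = v \<otimes>\<^bsub>D\<^esub> (lf [^]\<^bsub>A'\<^esub> j \<otimes>\<^bsub>D\<^esub> w)"
          unfolding evs w(2) using lfD vD by (simp add: D.m_ac)
        moreover have "lf [^]\<^bsub>A'\<^esub> j \<otimes>\<^bsub>D\<^esub> w \<in> B" using lfD w subringE(6)[OF \<open>subring B D\<close>] by blast
        ultimately have "V s" using qs(2) by (auto simp: V_def)
        moreover have "s \<noteq> \<zero>\<^bsub>P\<^esub>" using \<open>ev s \<noteq> \<zero>\<^bsub>D\<^esub>\<close> by auto
        ultimately show ?thesis using rmin[of s] qs(4) by auto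
      qed
      \<comment> \<open>Otherwise divide \<open>f\<close> by \<open>r\<close>. The value of the
        remainder \<open>s\<close> is a multiple of \<open>v\<close>, so by minimality of
        \<open>r\<close> it is zero, and by minimality of \<open>f\<close> so is \<open>s\<close>.
        Then \<open>q\<close> is a relation of degree \<open>deg f - deg r\<close>, smaller than
        that of \<open>f\<close>.\<close>
      have deg_r: "deg A' r = 0"
      proof (rule ccontr)
        assume r0: "deg A' r \<noteq> 0"
        obtain q s and j :: nat where qs: "q \<in> carrier P" "s \<in> carrier P"
          "lr [^]\<^bsub>A'\<^esub> j \<odot>\<^bsub>P\<^esub> f = r \<otimes>\<^bsub>P\<^esub> q \<oplus>\<^bsub>P\<^esub> s" "s = \<zero>\<^bsub>P\<^esub> \<or> deg A' s < deg A' r"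
          using U.long_div_theorem[OF rP(1) fP(1) \<open>r \<noteq> \<zero>\<^bsub>P\<^esub>\<close>] unfolding lr_def by blast
        have "ev r \<otimes>\<^bsub>D\<^esub> ev q \<oplus>\<^bsub>D\<^esub> ev s = ev (lr [^]\<^bsub>A'\<^esub> j \<odot>\<^bsub>P\<^esub> f)"
          unfolding qs(3) using qs rP by simp
        also have "\<dots> = \<zero>\<^bsub>D\<^esub>"
          using ev_smult[OF pow(1)[OF lr(1), of j] fP(1)] fP(2) subsetD[OF AD pow(1)[OF lr(1), of j]] by simp
        finally have *: "ev r \<otimes>\<^bsub>D\<^esub> ev q \<oplus>\<^bsub>D\<^esub> ev s = \<zero>\<^bsub>D\<^esub>" .
        have evs: "ev s = \<ominus>\<^bsub>D\<^esub> (ev r \<otimes>\<^bsub>D\<^esub> ev q)"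
          by (rule D.sum_zero_eq_neg) (use * qs rP in \<open>simp_all add: D.a_comm\<close>)
        have "ev s = \<zero>\<^bsub>D\<^esub>"
        proof (rule ccontr)
          assume ns: "ev s \<noteq> \<zero>\<^bsub>D\<^esub>"
          have "ev q \<in> B" using qs by (auto simp: B_def)
          then have "\<ominus>\<^bsub>D\<^esub> (w \<otimes>\<^bsub>D\<^esub> ev q) \<in> B"
            using w subringE(5,6)[OF \<open>subring B D\<close>] by blast
          moreover have "ev s = v \<otimes>\<^bsub>D\<^esub> (\<ominus>\<^bsub>D\<^esub> (w \<otimes>\<^bsub>D\<^esub> ev q))"
            unfolding evs w(2) using vD qs by (simp add: D.r_minus D.m_assoc)
          ultimately have "V s" using ns qs(2) by (auto simp: V_def)
          moreover have "s \<noteq> \<zero>\<^bsub>P\<^esub>" using ns by auto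
          ultimately show False using rmin[of s] qs(4) by auto
        qed
        have "s = \<zero>\<^bsub>P\<^esub>"
        proof (rule ccontr)
          assume "s \<noteq> \<zero>\<^bsub>P\<^esub>"
          then have "N s" using \<open>ev s = \<zero>\<^bsub>D\<^esub>\<close> qs(2) by (simp add: N_def)
          then show False using fmin[of s] qs(4) \<open>s \<noteq> \<zero>\<^bsub>P\<^esub>\<close> deg_rf by auto
        qed
        then have eq: "lr [^]\<^bsub>A'\<^esub> j \<odot>\<^bsub>P\<^esub> f = r \<otimes>\<^bsub>P\<^esub> q" using qs rP by simp
        have lrA: "lr [^]\<^bsub>A'\<^esub> j \<in> carrier A'" "lr [^]\<^bsub>A'\<^esub> j \<noteq> \<zero>\<^bsub>A'\<^esub>" using pow[OF lr(1)] lr(2) by (simp_all add: A'_simps)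
        have df: "deg A' (lr [^]\<^bsub>A'\<^esub> j \<odot>\<^bsub>P\<^esub> f) = deg A' f" using lrA fP(1) by simp
        have "q \<noteq> \<zero>\<^bsub>P\<^esub>"
        proof
          assume "q = \<zero>\<^bsub>P\<^esub>"
          then have "lr [^]\<^bsub>A'\<^esub> j \<odot>\<^bsub>P\<^esub> f = \<zero>\<^bsub>P\<^esub>" using eq rP by simp
          then show False using df deg_rf by simp
        qed
        then have "deg A' f = deg A' r + deg A' q"
          using df unfolding eq using qs(1) rP(1) \<open>r \<noteq> \<zero>\<^bsub>P\<^esub>\<close> by simp
        moreover have "ev q = \<zero>\<^bsub>D\<^esub>"
        proof -
          have "ev r \<otimes>\<^bsub>D\<^esub> ev q = \<zero>\<^bsub>D\<^esub>" using * \<open>ev s = \<zero>\<^bsub>D\<^esub>\<close> qs rP by simp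
          then show ?thesis using D.integral[of "ev r" "ev q"] qs rP by auto
        qed
        then have "N q" using \<open>q \<noteq> \<zero>\<^bsub>P\<^esub>\<close> qs(1) by (simp add: N_def)
        ultimately show False using fmin[of q] r0 by auto
      qed
      define a0 where "a0 = coeff P r 0"
      have a0: "a0 \<in> A" using U.coeff_closed[OF rP(1)] by (simp add: a0_def A'_simps)
      have "r = monom P a0 0" unfolding a0_def by (rule U.deg_zero_impl_monom[OF rP(1) deg_r])
      then have "ev r = a0" using ev_const[OF a0] by simp
      then have a0w: "a0 = v \<otimes>\<^bsub>D\<^esub> w" "a0 \<noteq> \<zero>\<^bsub>D\<^esub>" using w rP by auto
      \<comment> \<open>The factor \<open>lf\<close> keeps the degree of the image of
        \<open>f\<close> positive, so that a root exists, and permits the cancellation of powers of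
        \<open>lf\<close>. The factor \<open>a0\<close> is a multiple of \<open>v\<close>.\<close>
      define u where "u = lf \<otimes>\<^bsub>D\<^esub> a0"
      have u: "u \<in> A" "u \<noteq> \<zero>\<^bsub>D\<^esub>"
        using lf a0 a0w(2) AD D.integral[of lf a0] subringE(6)[OF assms(3)] by (auto simp: u_def)
      show ?thesis
      proof (intro bexI[of _ u] conjI ballI impI u)
        fix \<phi> assume \<phi>: "\<phi> \<in> ring_hom (D\<lparr>carrier := A\<rparr>) k" and \<phi>u: "\<phi> u \<noteq> \<zero>\<^bsub>k\<^esub>"
        have pre: "UP_pre_univ_prop A' k \<phi>"
          by (rule UP_pre_univ_propI[OF A'.is_cring k.is_cring]) (use \<phi> in \<open>simp add: A'_def\<close>)
        interpret F: UP_pre_univ_prop A' k \<phi> P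
          using pre by (simp_all add: P_def)
        have "\<phi> u = \<phi> lf \<otimes>\<^bsub>k\<^esub> \<phi> a0" using F.hom_mult[of lf a0] lf a0 by (simp add: u_def A'_simps)
        then have \<phi>lf: "\<phi> lf \<noteq> \<zero>\<^bsub>k\<^esub>" and \<phi>a: "\<phi> a0 \<noteq> \<zero>\<^bsub>k\<^esub>"
          using \<phi>u F.hom_closed[of lf] F.hom_closed[of a0] lf a0 by (auto simp: A'_simps)
        have "deg A' f > 0" using deg_rf by simp
        moreover have "\<phi> (coeff P f i) \<in> carrier k" for i
          using U.coeff_closed[OF fP(1), of i] by simp
        ultimately obtain c where c: "c \<in> carrier k"
          "(\<Oplus>\<^bsub>k\<^esub>i\<in>{..deg A' f}. \<phi> (coeff P f i) \<otimes>\<^bsub>k\<^esub> c [^]\<^bsub>k\<^esub> i) = \<zero>\<^bsub>k\<^esub>"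
          using k.ex_root[of "\<lambda>i. \<phi> (coeff P f i)" "deg A' f"] \<phi>lf by (auto simp: lf_def)
        define e where "e = UnivPoly.eval A' k \<phi> c"
        have ef: "e f = \<zero>\<^bsub>k\<^esub>" using c fP(1) by (simp add: e_def U.eval_on_carrier)
        have e_hom: "e \<in> ring_hom P k" unfolding e_def by (rule F.eval_ring_hom[OF c(1)])
        interpret e: ring_hom_cring P k e by unfold_locales (rule e_hom)
        \<comment> \<open>A relation \<open>p\<close> is a multiple of \<open>f\<close> up to a
          power of \<open>lf\<close>, because the remainder is a relation of smaller degree than
          \<open>f\<close>. Evaluation kills \<open>f\<close> and not \<open>lf\<close>, so it kills
          \<open>p\<close>.\<close>
        have "e p = \<zero>\<^bsub>k\<^esub>" if p: "p \<in> carrier P" "ev p = \<zero>\<^bsub>D\<^esub>" for p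
        proof -
          obtain q s and j :: nat where qs: "q \<in> carrier P" "s \<in> carrier P"
            "lf [^]\<^bsub>A'\<^esub> j \<odot>\<^bsub>P\<^esub> p = f \<otimes>\<^bsub>P\<^esub> q \<oplus>\<^bsub>P\<^esub> s" "s = \<zero>\<^bsub>P\<^esub> \<or> deg A' s < deg A' f"
            using U.long_div_theorem[OF fP(1) p(1) fP(3)] unfolding lf_def by blast
          have lfj: "lf [^]\<^bsub>A'\<^esub> j \<in> A" by (rule pow(1)[OF lf(1)])
          have "ev s = ev (lf [^]\<^bsub>A'\<^esub> j \<odot>\<^bsub>P\<^esub> p)"
            unfolding qs(3) using qs fP by simp
          also have "\<dots> = \<zero>\<^bsub>D\<^esub>" using ev_smult[OF lfj p(1)] p(2) subsetD[OF AD lfj] by simp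
          finally have "s = \<zero>\<^bsub>P\<^esub>" using qs fmin[of s] unfolding N_def by force
          then have "e (lf [^]\<^bsub>A'\<^esub> j \<odot>\<^bsub>P\<^esub> p) = \<zero>\<^bsub>k\<^esub>" unfolding qs(3) using qs fP ef by simp
          moreover have "e (lf [^]\<^bsub>A'\<^esub> j \<odot>\<^bsub>P\<^esub> p) = \<phi> (lf [^]\<^bsub>A'\<^esub> j) \<otimes>\<^bsub>k\<^esub> e p"
          proof -
            have "lf [^]\<^bsub>A'\<^esub> j \<in> carrier A'" using lfj by (simp add: A'_simps)
            then show ?thesis
              using e.hom_mult[of "monom P (lf [^]\<^bsub>A'\<^esub> j) 0" p] p(1) F.eval_const[OF c(1), of "lf [^]\<^bsub>A'\<^esub> j"]
              by (simp add: U.monom_mult_is_smult e_def)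
          qed
          moreover have "\<phi> (lf [^]\<^bsub>A'\<^esub> j) \<noteq> \<zero>\<^bsub>k\<^esub>"
          proof -
            have "\<phi> (lf [^]\<^bsub>A'\<^esub> j) = \<phi> lf [^]\<^bsub>k\<^esub> j" using lf by (intro F.hom_pow) (simp add: A'_simps)
            moreover have "\<phi> lf \<in> Units k" using \<phi>lf F.hom_closed[of lf] lf by (simp add: A'_simps k.field_Units)
            then have "\<phi> lf [^]\<^bsub>k\<^esub> j \<in> Units k" by (rule k.Units_pow_closed)
            ultimately show ?thesis by (simp add: k.field_Units)
          qed
          ultimately show ?thesis
            using k.integral[of "\<phi> (lf [^]\<^bsub>A'\<^esub> j)" "e p"] lfj p F.hom_closed[of "lf [^]\<^bsub>A'\<^esub> j"]
            by (auto simp: A'_simps)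
        qed
        then obtain \<psi> where \<psi>: "\<psi> \<in> ring_hom (D\<lparr>carrier := B\<rparr>) k" "\<forall>x\<in>A. \<psi> x = \<phi> x"
          using ext[OF \<phi> c(1)] unfolding e_def by blast
        have "\<psi> v \<noteq> \<zero>\<^bsub>k\<^esub>"
        proof
          assume "\<psi> v = \<zero>\<^bsub>k\<^esub>"
          moreover have "\<psi> a0 = \<psi> v \<otimes>\<^bsub>k\<^esub> \<psi> w"
            using ring_hom_mult[OF \<psi>(1), of v w] v w a0w by simp
          moreover have "\<psi> w \<in> carrier k" using ring_hom_closed[OF \<psi>(1), of w] w by simp
          ultimately have "\<psi> a0 = \<zero>\<^bsub>k\<^esub>" by simp
          then show False using \<psi>(2) a0 \<phi>a by simp
        qed
        with \<psi> show "\<exists>\<psi>\<in>ring_hom (D\<lparr>carrier := B\<rparr>) k. (\<forall>x\<in>A. \<psi> x = \<phi> x) \<and> \<psi> v \<noteq> \<zero>\<^bsub>k\<^esub>" by blast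
      qed
    qed
  qed
  with \<open>subring B D\<close> AB bB show thesis by (rule that)
qed

text \<open>The element that the upper step requires to be non-zero is taken as the \<open>v\<close>
  of the lower step.\<close>

lemma hom_extendable_trans:
  assumes "hom_extendable k D A B" "hom_extendable k D B C" "A \<subseteq> B"
  shows "hom_extendable k D A C"
  unfolding hom_extendable_def
proof (intro ballI impI)
  fix v assume v: "v \<in> C" "v \<noteq> \<zero>\<^bsub>D\<^esub>"
  obtain w where w: "w \<in> B" "w \<noteq> \<zero>\<^bsub>D\<^esub>"
    "\<forall>\<phi>\<in>ring_hom (D\<lparr>carrier := B\<rparr>) k. \<phi> w \<noteq> \<zero>\<^bsub>k\<^esub> \<longrightarrow>
       (\<exists>\<psi>\<in>ring_hom (D\<lparr>carrier := C\<rparr>) k. (\<forall>x\<in>B. \<psi> x = \<phi> x) \<and> \<psi> v \<noteq> \<zero>\<^bsub>k\<^esub>)"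
    using assms(2)[unfolded hom_extendable_def, THEN bspec, OF v(1), THEN mp, OF v(2)]
    by (elim bexE conjE) (rule that)
  obtain u where u: "u \<in> A" "u \<noteq> \<zero>\<^bsub>D\<^esub>"
    "\<forall>\<phi>\<in>ring_hom (D\<lparr>carrier := A\<rparr>) k. \<phi> u \<noteq> \<zero>\<^bsub>k\<^esub> \<longrightarrow>
       (\<exists>\<psi>\<in>ring_hom (D\<lparr>carrier := B\<rparr>) k. (\<forall>x\<in>A. \<psi> x = \<phi> x) \<and> \<psi> w \<noteq> \<zero>\<^bsub>k\<^esub>)"
    using assms(1)[unfolded hom_extendable_def, THEN bspec, OF w(1), THEN mp, OF w(2)]
    by (elim bexE conjE) (rule that)
  show "\<exists>u\<in>A. u \<noteq> \<zero>\<^bsub>D\<^esub> \<and> (\<forall>\<phi>\<in>ring_hom (D\<lparr>carrier := A\<rparr>) k. \<phi> u \<noteq> \<zero>\<^bsub>k\<^esub> \<longrightarrow>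
       (\<exists>\<psi>\<in>ring_hom (D\<lparr>carrier := C\<rparr>) k. (\<forall>x\<in>A. \<psi> x = \<phi> x) \<and> \<psi> v \<noteq> \<zero>\<^bsub>k\<^esub>))"
  proof (intro bexI[of _ u] conjI ballI impI u(1,2))
    fix \<phi> assume \<phi>: "\<phi> \<in> ring_hom (D\<lparr>carrier := A\<rparr>) k" "\<phi> u \<noteq> \<zero>\<^bsub>k\<^esub>"
    obtain \<psi> where \<psi>: "\<psi> \<in> ring_hom (D\<lparr>carrier := B\<rparr>) k" "\<forall>x\<in>A. \<psi> x = \<phi> x" "\<psi> w \<noteq> \<zero>\<^bsub>k\<^esub>"
      using u(3)[THEN bspec, OF \<phi>(1), THEN mp, OF \<phi>(2)] by (elim bexE conjE) (rule that)
    obtain \<psi>' where "\<psi>' \<in> ring_hom (D\<lparr>carrier := C\<rparr>) k" "\<forall>x\<in>B. \<psi>' x = \<psi> x" "\<psi>' v \<noteq> \<zero>\<^bsub>k\<^esub>"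
      using w(3)[THEN bspec, OF \<psi>(1), THEN mp, OF \<psi>(3)] by (elim bexE conjE) (rule that)
    moreover have "\<forall>x\<in>A. \<psi>' x = \<phi> x" using calculation(2) \<psi>(2) assms(3) by auto
    ultimately show "\<exists>\<psi>\<in>ring_hom (D\<lparr>carrier := C\<rparr>) k. (\<forall>x\<in>A. \<psi> x = \<phi> x) \<and> \<psi> v \<noteq> \<zero>\<^bsub>k\<^esub>" by blast
  qed
qed

lemma hom_extendable_finite:
  assumes "algebraically_closed k" "domain D" "subring A D" "finite S" "S \<subseteq> carrier D"
  shows "\<exists>B. subring B D \<and> A \<subseteq> B \<and> S \<subseteq> B \<and> hom_extendable k D A B"
  using assms(4,5)
proof (induction S)
  case empty
  have "hom_extendable k D A A" unfolding hom_extendable_def by (intro ballI impI bexI conjI) auto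
  then show ?case using assms(3) by blast
next
  case (insert b S)
  then obtain B where B: "subring B D" "A \<subseteq> B" "S \<subseteq> B" "hom_extendable k D A B" by auto
  obtain C where C: "subring C D" "B \<subseteq> C" "b \<in> C" "hom_extendable k D B C"
    using hom_extendable_simple[OF assms(1,2) B(1), of b] insert.prems by auto
  have "hom_extendable k D A C" using hom_extendable_trans B C by blast
  then show ?case using B C by blast
qed

text \<open>A \<open>k\<close>-rational point, as a homomorphism of algebras. Values outside the
  carrier are not constrained, so different functions may represent one point.\<close>

definition alg_point :: "('k, 'c) ring_scheme \<Rightarrow> ('k, 'a, 'b) module_scheme \<Rightarrow> ('a \<Rightarrow> 'k) \<Rightarrow> bool"
  where "alg_point k R \<chi> \<longleftrightarrow> \<chi> \<in> ring_hom R k \<and> (\<forall>c\<in>carrier k. \<chi> (c \<odot>\<^bsub>R\<^esub> \<one>\<^bsub>R\<^esub>) = c)"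

lemma (in algebra) scalar_hom: "(\<lambda>c. c \<odot>\<^bsub>M\<^esub> \<one>\<^bsub>M\<^esub>) \<in> ring_hom R M"
  by (rule ring_hom_memI) (simp_all add: smult_l_distr smult_assoc2 smult_assoc1)

text \<open>The Nullstellensatz for \<open>R/p\<close>: the identity of \<open>k\<close>, read on
  the copy of \<open>k\<close> inside \<open>R/p\<close>, is extended to the whole quotient so that
  the image of \<open>v\<close> survives. The non-zero test element of \<open>hom_extendable\<close>
  lies in this copy, hence its image is automatically non-zero.\<close>

lemma ex_alg_point:
  fixes k :: "('k, 'c) ring_scheme" and R :: "('k, 'a, 'b) module_scheme"
  assumes "algebraically_closed k" "fin_gen_algebra k R" "primeideal p R" "v \<in> carrier R" "v \<notin> p"
  obtains \<chi> where "alg_point k R \<chi>" "\<And>x. x \<in> p \<Longrightarrow> \<chi> x = \<zero>\<^bsub>k\<^esub>" "\<chi> v \<noteq> \<zero>\<^bsub>k\<^esub>"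
proof -
  interpret k: algebraically_closed k by fact
  have alg: "algebra k R" using assms(2) by (simp add: fin_gen_algebra_def)
  interpret R: cring R by (rule algebra.M_cring[OF alg])
  interpret p: primeideal p R by fact
  define D where "D = R Quot p"
  define \<pi> where "\<pi> = (+>\<^bsub>R\<^esub>) p"
  interpret D: domain D unfolding D_def by (rule p.quotient_is_domain)
  interpret \<pi>: ring_hom_cring R D \<pi> unfolding D_def \<pi>_def by (rule p.rcos_ring_hom_cring)
  have \<pi>0: "\<pi> x = \<zero>\<^bsub>D\<^esub> \<longleftrightarrow> x \<in> p" if "x \<in> carrier R" for x
  proof -
    have "\<zero>\<^bsub>D\<^esub> = p" by (simp add: D_def FactRing_def)
    then show ?thesis
      unfolding \<pi>_def using that p.rcos_const_imp_mem R.a_rcos_zero[OF p.ideal_axioms] by blast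
  qed
  define h where "h c = \<pi> (c \<odot>\<^bsub>R\<^esub> \<one>\<^bsub>R\<^esub>)" for c
  have h_hom: "h \<in> ring_hom k D"
    unfolding h_def using ring_hom_trans[OF algebra.scalar_hom[OF alg] \<pi>.homh] by (simp add: comp_def)
  interpret h: ring_hom_cring k D h by unfold_locales (rule h_hom)
  have h_inj: "c = \<zero>\<^bsub>k\<^esub>" if "c \<in> carrier k" "h c = \<zero>\<^bsub>D\<^esub>" for c
  proof (rule ccontr)
    assume "c \<noteq> \<zero>\<^bsub>k\<^esub>"
    then have "c \<in> Units k" using that by (simp add: k.field_Units)
    then have "h (c \<otimes>\<^bsub>k\<^esub> inv\<^bsub>k\<^esub> c) = \<one>\<^bsub>D\<^esub>" by simp
    moreover have "h (c \<otimes>\<^bsub>k\<^esub> inv\<^bsub>k\<^esub> c) = h c \<otimes>\<^bsub>D\<^esub> h (inv\<^bsub>k\<^esub> c)"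
      by (rule h.hom_mult[OF that(1) k.Units_inv_closed[OF \<open>c \<in> Units k\<close>]])
    ultimately show False using that \<open>c \<in> Units k\<close> by simp
  qed
  define A where "A = h ` carrier k"
  have "subring A D"
    unfolding A_def
    by (rule ring_hom_ring.img_is_subring[OF ring_hom_ringI2[OF cring.axioms(1)[OF k.is_cring] cring.axioms(1)[OF D.is_cring] h_hom]
        k.carrier_is_subring])
  \<comment> \<open>The inverse of the embedding \<open>h\<close> is the homomorphism to be
    extended.\<close>
  have "ring_hom_cring k k id" by unfold_locales simp
  then obtain \<phi> where \<phi>: "\<phi> \<in> ring_hom (D\<lparr>carrier := A\<rparr>) k" "\<And>c. c \<in> carrier k \<Longrightarrow> \<phi> (h c) = c"
    using factor_hom[OF h.ring_hom_cring_axioms, of k id] h_inj unfolding A_def by auto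
  obtain S where S: "finite S" "S \<subseteq> carrier R"
    "carrier R = generate_ring R ((\<lambda>c. c \<odot>\<^bsub>R\<^esub> \<one>\<^bsub>R\<^esub>) ` carrier k \<union> S)"
    using assms(2) unfolding fin_gen_algebra_def by blast
  obtain B where B: "subring B D" "A \<subseteq> B" "\<pi> ` S \<subseteq> B" "hom_extendable k D A B"
    using hom_extendable_finite[OF assms(1) D.domain_axioms \<open>subring A D\<close>, of "\<pi> ` S"] S by auto
  have \<pi>B: "\<pi> x \<in> B" if "x \<in> carrier R" for x
  proof -
    have gen: "x \<in> generate_ring R ((\<lambda>c. c \<odot>\<^bsub>R\<^esub> \<one>\<^bsub>R\<^esub>) ` carrier k \<union> S)" using that S(3) by blast
    have inR: "generate_ring R ((\<lambda>c. c \<odot>\<^bsub>R\<^esub> \<one>\<^bsub>R\<^esub>) ` carrier k \<union> S) = carrier R" using S(3) by simp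
    show ?thesis using gen
    proof (induction rule: generate_ring.induct)
      case (incl y)
      then show ?case using B(2,3) by (auto simp: A_def h_def)
    qed (use subringE[OF B(1)] in \<open>auto simp: inR\<close>)
  qed
  have "\<pi> v \<noteq> \<zero>\<^bsub>D\<^esub>" using \<pi>0 assms(4,5) by simp
  obtain u where u: "u \<in> A" "u \<noteq> \<zero>\<^bsub>D\<^esub>"
    "\<forall>\<phi>\<in>ring_hom (D\<lparr>carrier := A\<rparr>) k. \<phi> u \<noteq> \<zero>\<^bsub>k\<^esub> \<longrightarrow>
       (\<exists>\<psi>\<in>ring_hom (D\<lparr>carrier := B\<rparr>) k. (\<forall>x\<in>A. \<psi> x = \<phi> x) \<and> \<psi> (\<pi> v) \<noteq> \<zero>\<^bsub>k\<^esub>)"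
    using B(4)[unfolded hom_extendable_def, THEN bspec, OF \<pi>B[OF assms(4)], THEN mp, OF \<open>\<pi> v \<noteq> \<zero>\<^bsub>D\<^esub>\<close>]
    by (elim bexE conjE) (rule that)
  have "\<phi> u \<noteq> \<zero>\<^bsub>k\<^esub>"
  proof
    assume "\<phi> u = \<zero>\<^bsub>k\<^esub>"
    obtain c where c: "c \<in> carrier k" "u = h c" using u(1) by (auto simp: A_def)
    then show False using u(2) \<phi>(2)[OF c(1)] \<open>\<phi> u = \<zero>\<^bsub>k\<^esub>\<close> by simp
  qed
  obtain \<psi> where \<psi>: "\<psi> \<in> ring_hom (D\<lparr>carrier := B\<rparr>) k" "\<forall>x\<in>A. \<psi> x = \<phi> x" "\<psi> (\<pi> v) \<noteq> \<zero>\<^bsub>k\<^esub>"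
    using u(3)[THEN bspec, OF \<phi>(1), THEN mp, OF \<open>\<phi> u \<noteq> \<zero>\<^bsub>k\<^esub>\<close>] by (elim bexE conjE) (rule that)
  have "(\<lambda>x. \<psi> (\<pi> x)) \<in> ring_hom R k"
    by (rule ring_hom_memI)
      (use \<pi>B ring_hom_closed[OF \<psi>(1)] ring_hom_mult[OF \<psi>(1)] ring_hom_add[OF \<psi>(1)] ring_hom_one[OF \<psi>(1)] in auto)
  moreover have "\<psi> (\<pi> (c \<odot>\<^bsub>R\<^esub> \<one>\<^bsub>R\<^esub>)) = c" if "c \<in> carrier k" for c
    using \<psi>(2) \<phi>(2)[OF that] that by (auto simp: A_def h_def)
  ultimately have "alg_point k R (\<lambda>x. \<psi> (\<pi> x))" by (simp add: alg_point_def)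
  moreover have "\<psi> (\<pi> x) = \<zero>\<^bsub>k\<^esub>" if "x \<in> p" for x
  proof -
    have "\<pi> x = h \<zero>\<^bsub>k\<^esub>" using \<pi>0 that p.a_subset by auto
    moreover have "h \<zero>\<^bsub>k\<^esub> \<in> A" unfolding A_def by blast
    ultimately show ?thesis using \<psi>(2) \<phi>(2)[OF k.zero_closed] by simp
  qed
  ultimately show thesis using \<psi>(3) that by blast
qed

section \<open>Prime ideals and dimension\<close>

lemma (in cring) ex_prime_avoiding:
  assumes "ideal I R" "M \<subseteq> carrier R" "\<one> \<in> M" "I \<inter> M = {}"
    and mult: "\<And>x y. x \<in> M \<Longrightarrow> y \<in> M \<Longrightarrow> x \<otimes> y \<in> M"
  obtains p where "primeideal p R" "I \<subseteq> p" "p \<inter> M = {}"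
proof -
  define F where "F = {J. ideal J R \<and> I \<subseteq> J \<and> J \<inter> M = {}}"
  have "\<exists>p\<in>F. \<forall>q\<in>F. p \<subseteq> q \<longrightarrow> q = p"
  proof (rule subset_Zorn_nonempty)
    show "F \<noteq> {}" using assms by (auto simp: F_def)
    fix C assume C: "C \<noteq> {}" "subset.chain F C"
    then have "C \<subseteq> F" by (auto simp: subset.chain_def)
    have "subset.chain {I. ideal I R} C" using C(2) by (auto simp: subset.chain_def F_def)
    then have "ideal (\<Union>C) R" using chain_Union_is_ideal[of C] C(1) by simp
    moreover have J: "I \<subseteq> J" "J \<inter> M = {}" if "J \<in> C" for J
      using subsetD[OF \<open>C \<subseteq> F\<close> that] by (simp_all add: F_def)
    then have "I \<subseteq> \<Union>C" "\<Union>C \<inter> M = {}" using C(1) by blast+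
    ultimately show "\<Union>C \<in> F" by (simp add: F_def)
  qed
  then obtain p where "p \<in> F" and F_max: "\<forall>q\<in>F. p \<subseteq> q \<longrightarrow> q = p" by (elim bexE) (rule that)
  then have p: "ideal p R" "I \<subseteq> p" "p \<inter> M = {}" by (simp_all add: F_def)
  have max: "q = p" if "ideal q R" "p \<subseteq> q" "q \<inter> M = {}" for q
  proof -
    have "q \<in> F" using that p(2) by (simp add: F_def)
    then show ?thesis using F_max that(2) by simp
  qed
  interpret p: ideal p R by fact
  \<comment> \<open>Krull's argument: for \<open>x\<close> and \<open>y\<close> outside
    \<open>p\<close>, the ideals \<open>p + (x)\<close> and \<open>p + (y)\<close> meet
    \<open>M\<close> by maximality. The product of the two elements found there lies in
    \<open>M\<close> and, if \<open>x \<otimes> y\<close> is in \<open>p\<close>, also in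
    \<open>p\<close>.\<close>
  have "primeideal p R"
  proof (rule primeidealI[OF p(1) is_cring])
    show "carrier R \<noteq> p" using p(3) assms(3) by auto
    fix x y assume x: "x \<in> carrier R" and y: "y \<in> carrier R" and xy: "x \<otimes> y \<in> p"
    have ext: "\<exists>j r. j \<in> p \<and> r \<in> carrier R \<and> j \<oplus> r \<otimes> z \<in> M" if "z \<in> carrier R" "z \<notin> p" for z
    proof -
      have "ideal (p <+>\<^bsub>R\<^esub> PIdl z) R" using add_ideals[OF p(1) cgenideal_ideal[OF that(1)]] .
      moreover have "p \<subseteq> p <+>\<^bsub>R\<^esub> PIdl z"
      proof
        fix j assume j: "j \<in> p"
        have "\<zero> \<in> PIdl z" using cgenideal_ideal[OF that(1)] by (simp add: additive_subgroup.zero_closed ideal.axioms(1))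
        moreover have "j = j \<oplus> \<zero>" using j p.Icarr by simp
        ultimately show "j \<in> p <+>\<^bsub>R\<^esub> PIdl z" using j unfolding set_add_def' by blast
      qed
      moreover have "z \<in> p <+>\<^bsub>R\<^esub> PIdl z"
      proof -
        have "z \<in> PIdl z" using that(1) by (rule cgenideal_self)
        moreover have "z = \<zero> \<oplus> z" using that by simp
        ultimately show ?thesis using p.zero_closed unfolding set_add_def' by blast
      qed
      ultimately have "(p <+>\<^bsub>R\<^esub> PIdl z) \<inter> M \<noteq> {}" using max[of "p <+>\<^bsub>R\<^esub> PIdl z"] that(2) by auto
      then show ?thesis unfolding set_add_def' cgenideal_def by blast
    qed
    show "x \<in> p \<or> y \<in> p"
    proof (rule ccontr)
      assume "\<not> (x \<in> p \<or> y \<in> p)"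
      then obtain j r i s where j: "j \<in> p" "r \<in> carrier R" "j \<oplus> r \<otimes> x \<in> M"
        and i: "i \<in> p" "s \<in> carrier R" "i \<oplus> s \<otimes> y \<in> M"
        using ext[of x] ext[of y] x y by blast
      have c: "j \<in> carrier R" "i \<in> carrier R" using j i p.Icarr by auto
      have "(j \<oplus> r \<otimes> x) \<otimes> (i \<oplus> s \<otimes> y) = j \<otimes> (i \<oplus> s \<otimes> y) \<oplus> ((r \<otimes> x) \<otimes> i \<oplus> (r \<otimes> s) \<otimes> (x \<otimes> y))"
        using c j(2) i(2) x y by (simp add: l_distr r_distr m_ac)
      moreover have "j \<otimes> (i \<oplus> s \<otimes> y) \<in> p" "(r \<otimes> x) \<otimes> i \<in> p" "(r \<otimes> s) \<otimes> (x \<otimes> y) \<in> p"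
        using c j i x y xy p.I_l_closed p.I_r_closed by auto
      ultimately have "(j \<oplus> r \<otimes> x) \<otimes> (i \<oplus> s \<otimes> y) \<in> p" by simp
      then show False using mult[OF j(3) i(3)] p(3) by blast
    qed
  qed
  then show thesis using p that by blast
qed

text \<open>A minimal prime consists of zero divisors: the products of elements outside
  \<open>q\<close> with powers of \<open>a\<close> form a multiplicative set without zero, and a
  prime avoiding it lies inside \<open>q\<close> and misses \<open>a\<close>.\<close>

lemma (in cring) prime_below:
  assumes "primeideal q R" "a \<in> q" "non_zerodivisor R a"
  obtains p where "primeideal p R" "p \<subset> q"
proof -
  interpret q: primeideal q R by fact
  have a: "a \<in> carrier R" "\<And>x. x \<in> carrier R \<Longrightarrow> a \<otimes> x = \<zero> \<Longrightarrow> x = \<zero>"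
    using assms(3) unfolding non_zerodivisor_def by blast+
  define M where "M = {s \<otimes> a [^] (i::nat) | s i. s \<in> carrier R - q}"
  have one: "\<one> \<in> carrier R - q" using q.I_notcarr q.one_imp_carrier by auto
  have mem: "s \<otimes> a [^] i \<in> M" if "s \<in> carrier R - q" for s and i :: nat
    using that by (auto simp: M_def)
  have nz: "s \<otimes> a [^] i \<noteq> \<zero>" if "s \<in> carrier R - q" for s and i :: nat
  proof (induction i)
    case 0 then show ?case using that q.zero_closed by auto
  next
    case (Suc i)
    have "s \<otimes> a [^] Suc i = a \<otimes> (s \<otimes> a [^] i)" using that a(1) by (simp add: m_ac)
    moreover have "s \<otimes> a [^] i \<in> carrier R" using that a(1) by simp
    ultimately show ?case using Suc a(2)[of "s \<otimes> a [^] i"] by auto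
  qed
  have "\<zero> \<notin> M"
  proof
    assume "\<zero> \<in> M"
    then obtain s i where "\<zero> = s \<otimes> a [^] (i::nat)" "s \<in> carrier R - q" unfolding M_def by blast
    then show False using nz[of s i] by simp
  qed
  then have disj: "{\<zero>} \<inter> M = {}" by simp
  have MR: "M \<subseteq> carrier R" using a(1) by (auto simp: M_def)
  have oneM: "\<one> \<in> M" using mem[OF one, of 0] by simp
  have mult: "x \<otimes> y \<in> M" if xy: "x \<in> M" "y \<in> M" for x y
  proof -
    obtain s i t j where st: "x = s \<otimes> a [^] (i::nat)" "s \<in> carrier R - q" "y = t \<otimes> a [^] (j::nat)" "t \<in> carrier R - q"
      using xy unfolding M_def by blast
    have "x \<otimes> y = (s \<otimes> t) \<otimes> a [^] (i + j)" using st(2,4) a(1) unfolding st(1,3) by (simp add: m_ac nat_pow_mult[symmetric])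
    moreover have "s \<otimes> t \<in> carrier R - q" using st(2,4) q.I_prime[of s t] by auto
    ultimately show ?thesis using mem by auto
  qed
  obtain p where p: "primeideal p R" "p \<inter> M = {}"
    using ex_prime_avoiding[OF zeroideal MR oneM disj mult] by metis
  have "p \<subseteq> q"
  proof
    fix x assume "x \<in> p"
    moreover have "x \<in> carrier R"
      using \<open>x \<in> p\<close> p(1) additive_subgroup.a_subset ideal.axioms(1) primeideal.axioms(1) by blast
    ultimately show "x \<in> q" using mem[of x 0] p(2) by auto
  qed
  moreover have "a \<in> M" using mem[OF one, of 1] a(1) by simp
  then have "a \<notin> p" using p(2) by blast
  ultimately have "p \<subset> q" using assms(2) by blast
  then show thesis by (rule that[OF p(1)])
qed

lemma krull_dim_chain:
  assumes "primeideal p0 R" "primeideal p1 R" "primeideal p2 R" "p0 \<subset> p1" "p1 \<subset> p2"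
  shows "2 \<le> krull_dim R"
proof -
  define C where "C i = (if i = 0 then p0 else if i = 1 then p1 else p2)" for i :: nat
  have "(\<forall>i\<le>2. primeideal (C i) R) \<and> (\<forall>i<2. C i \<subset> C (Suc i))"
    using assms by (auto simp: C_def less_2_cases_iff)
  then have "ereal (real 2) \<le> krull_dim R"
    unfolding krull_dim_def by (intro Sup_upper) blast
  then show ?thesis by simp
qed

text \<open>Every element of \<open>R\<close> takes finitely many values at the points over
  \<open>a\<close>, and a point is determined by its values at finitely many generators. Dimension
  one enters in the first claim: otherwise there would be a chain of three primes.\<close>

lemma ex_finite_points:
  fixes k :: "('k, 'c) ring_scheme" and R :: "('k, 'a, 'b) module_scheme"
  assumes "algebraically_closed k" "fin_gen_algebra k R" "krull_dim R = 1" "non_zerodivisor R a"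
  obtains A :: "('a \<Rightarrow> 'k) set" where "finite A"
    "\<And>\<chi>. \<chi> \<in> A \<Longrightarrow> alg_point k R \<chi> \<and> \<chi> a = \<zero>\<^bsub>k\<^esub>"
    "\<And>\<chi>. \<chi> \<in> A \<Longrightarrow> \<exists>e\<in>carrier R. \<chi> e = \<one>\<^bsub>k\<^esub> \<and> (\<forall>\<chi>'\<in>A - {\<chi>}. \<chi>' e = \<zero>\<^bsub>k\<^esub>)"
    "\<And>x. x \<in> carrier R \<Longrightarrow> (\<And>\<chi>. \<chi> \<in> A \<Longrightarrow> \<chi> x = \<zero>\<^bsub>k\<^esub>) \<Longrightarrow> \<exists>N::nat. x [^]\<^bsub>R\<^esub> N \<in> PIdl\<^bsub>R\<^esub> a"
proof -
  interpret k: algebraically_closed k by fact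
  have alg: "algebra k R" using assms(2) by (simp add: fin_gen_algebra_def)
  interpret R: cring R by (rule algebra.M_cring[OF alg])
  have a: "a \<in> carrier R" using assms(4) by (simp add: non_zerodivisor_def)
  define \<iota> where "\<iota> c = c \<odot>\<^bsub>R\<^esub> \<one>\<^bsub>R\<^esub>" for c
  have \<iota>: "\<iota> c \<in> carrier R" if "c \<in> carrier k" for c
    unfolding \<iota>_def by (rule ring_hom_closed[OF algebra.scalar_hom[OF alg] that])
  have pt: "ring_hom_cring R k \<chi>" "\<And>c. c \<in> carrier k \<Longrightarrow> \<chi> (\<iota> c) = c" if "alg_point k R \<chi>" for \<chi>
  proof -
    show "ring_hom_cring R k \<chi>"
      by unfold_locales (use that in \<open>simp add: alg_point_def\<close>)
    show "\<chi> (\<iota> c) = c" if "c \<in> carrier k" for c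
      using \<open>alg_point k R \<chi>\<close> that by (simp add: alg_point_def \<iota>_def)
  qed
  \<comment> \<open>Points are normalised to be extensional, so that one point is represented by one
    function and finiteness can hold.\<close>
  define A where "A = {\<chi>. alg_point k R \<chi> \<and> \<chi> a = \<zero>\<^bsub>k\<^esub> \<and> \<chi> \<in> extensional (carrier R)}"
  have in_A: "restrict \<chi> (carrier R) \<in> A" if "alg_point k R \<chi>" "\<chi> a = \<zero>\<^bsub>k\<^esub>" for \<chi>
  proof -
    interpret \<chi>: ring_hom_cring R k \<chi> by (rule pt(1)[OF that(1)])
    have "restrict \<chi> (carrier R) \<in> ring_hom R k" by (rule ring_hom_memI) auto
    moreover have "\<forall>c\<in>carrier k. restrict \<chi> (carrier R) (\<iota> c) = c"
      using pt(2)[OF that(1)] \<iota> by simp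
    ultimately show ?thesis
      using that(2) a by (simp add: A_def alg_point_def \<iota>_def)
  qed
  have PI: "ideal (PIdl\<^bsub>R\<^esub> a) R" by (rule R.cgenideal_ideal[OF a])
  have nil: "\<exists>N::nat. x [^]\<^bsub>R\<^esub> N \<in> PIdl\<^bsub>R\<^esub> a" if x: "x \<in> carrier R" and vanish: "\<And>\<chi>. \<chi> \<in> A \<Longrightarrow> \<chi> x = \<zero>\<^bsub>k\<^esub>" for x
  proof (rule ccontr)
    assume no: "\<nexists>N::nat. x [^]\<^bsub>R\<^esub> N \<in> PIdl\<^bsub>R\<^esub> a"
    \<comment> \<open>If no power of \<open>x\<close> lies in \<open>PIdl a\<close>, some prime over
      \<open>a\<close> avoids all of them, and the Nullstellensatz gives a point over this prime at
      which \<open>x\<close> does not vanish.\<close>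
    define M where "M = range (\<lambda>N::nat. x [^]\<^bsub>R\<^esub> N)"
    have disj: "PIdl\<^bsub>R\<^esub> a \<inter> M = {}" using no by (auto simp: M_def)
    have MR: "M \<subseteq> carrier R" using x by (auto simp: M_def)
    have oneM: "\<one>\<^bsub>R\<^esub> \<in> M" unfolding M_def by (rule range_eqI[of _ _ 0]) simp
    have mult: "y \<otimes>\<^bsub>R\<^esub> z \<in> M" if "y \<in> M" "z \<in> M" for y z
      using that x by (auto simp: M_def R.nat_pow_mult)
    obtain p where p: "primeideal p R" "PIdl\<^bsub>R\<^esub> a \<subseteq> p" "p \<inter> M = {}"
      using R.ex_prime_avoiding[OF PI MR oneM disj mult] by metis
    have "x \<in> M" unfolding M_def by (rule range_eqI[of _ _ 1]) (simp add: x)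
    then have "x \<notin> p" using p(3) by blast
    then obtain \<chi> where \<chi>: "alg_point k R \<chi>" "\<And>y. y \<in> p \<Longrightarrow> \<chi> y = \<zero>\<^bsub>k\<^esub>" "\<chi> x \<noteq> \<zero>\<^bsub>k\<^esub>"
      using ex_alg_point[OF assms(1,2) p(1) x] by blast
    have "\<chi> a = \<zero>\<^bsub>k\<^esub>" using \<chi>(2) p(2) R.cgenideal_self[OF a] by blast
    then show False using vanish[OF in_A[OF \<chi>(1)]] \<chi>(3) x by simp
  qed
  have fin: "\<exists>C. finite C \<and> (\<forall>\<chi>\<in>A. \<chi> x \<in> C)" if x: "x \<in> carrier R" for x
  proof -
    \<comment> \<open>The product of \<open>x - c\<close> over a list of scalars. Once such a
      product is a multiple of \<open>a\<close>, every point over \<open>a\<close> has its value at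
      \<open>x\<close> in the list.\<close>
    define m where "m cs = foldr (\<lambda>c y. (x \<ominus>\<^bsub>R\<^esub> \<iota> c) \<otimes>\<^bsub>R\<^esub> y) cs \<one>\<^bsub>R\<^esub>" for cs
    have m_closed: "m cs \<in> carrier R" if "set cs \<subseteq> carrier k" for cs
      using that by (induction cs) (auto simp: m_def x \<iota>)
    have m_append: "m (cs @ ds) = m cs \<otimes>\<^bsub>R\<^esub> m ds" if "set cs \<subseteq> carrier k" "set ds \<subseteq> carrier k" for cs ds
      using that(1)
    proof (induction cs)
      case (Cons c cs)
      then show ?case using m_closed[of cs] m_closed[OF that(2)] \<iota>[of c] x
        by (simp add: m_def R.m_assoc)
    qed (use m_closed[OF that(2)] in \<open>simp add: m_def\<close>)
    have m_root: "\<chi> x \<in> set cs" if \<chi>: "alg_point k R \<chi>" and "set cs \<subseteq> carrier k" "\<chi> (m cs) = \<zero>\<^bsub>k\<^esub>" for \<chi> cs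
      using that(2,3)
    proof (induction cs)
      case Nil
      interpret \<chi>: ring_hom_cring R k \<chi> by (rule pt(1)[OF \<chi>])
      show ?case using Nil by (simp add: m_def)
    next
      case (Cons c cs)
      interpret \<chi>: ring_hom_cring R k \<chi> by (rule pt(1)[OF \<chi>])
      have cR: "m cs \<in> carrier R" "\<iota> c \<in> carrier R" "c \<in> carrier k" using m_closed[of cs] Cons.prems \<iota> by auto
      have "\<chi> (x \<ominus>\<^bsub>R\<^esub> \<iota> c) = \<chi> x \<ominus>\<^bsub>k\<^esub> c"
        using cR pt(2)[OF \<chi> cR(3)] x by (simp add: R.minus_eq k.minus_eq)
      moreover have "m (c # cs) = (x \<ominus>\<^bsub>R\<^esub> \<iota> c) \<otimes>\<^bsub>R\<^esub> m cs" by (simp add: m_def)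
      ultimately have "(\<chi> x \<ominus>\<^bsub>k\<^esub> c) \<otimes>\<^bsub>k\<^esub> \<chi> (m cs) = \<zero>\<^bsub>k\<^esub>"
        using Cons.prems(2) cR x by simp
      moreover have "\<chi> x \<ominus>\<^bsub>k\<^esub> c \<in> carrier k" "\<chi> (m cs) \<in> carrier k" using cR x by simp_all
      ultimately have "\<chi> x \<ominus>\<^bsub>k\<^esub> c = \<zero>\<^bsub>k\<^esub> \<or> \<chi> (m cs) = \<zero>\<^bsub>k\<^esub>"
        by (rule k.integral)
      then show ?case
      proof
        assume "\<chi> x \<ominus>\<^bsub>k\<^esub> c = \<zero>\<^bsub>k\<^esub>"
        then show ?thesis using k.r_right_minus_eq[of "\<chi> x" c] cR x by simp
      next
        assume "\<chi> (m cs) = \<zero>\<^bsub>k\<^esub>"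
        then show ?thesis using Cons by simp
      qed
    qed
    define M where "M = m ` {cs. set cs \<subseteq> carrier k}"
    have "\<exists>cs. set cs \<subseteq> carrier k \<and> m cs \<in> PIdl\<^bsub>R\<^esub> a"
    proof (rule ccontr)
      assume no: "\<nexists>cs. set cs \<subseteq> carrier k \<and> m cs \<in> PIdl\<^bsub>R\<^esub> a"
      then have disj: "PIdl\<^bsub>R\<^esub> a \<inter> M = {}" by (auto simp: M_def)
      have MR: "M \<subseteq> carrier R" using m_closed by (auto simp: M_def)
      have oneM: "\<one>\<^bsub>R\<^esub> \<in> M" unfolding M_def by (rule image_eqI[of _ _ "[]"]) (simp_all add: m_def)
      have mult: "y \<otimes>\<^bsub>R\<^esub> z \<in> M" if yz: "y \<in> M" "z \<in> M" for y z
      proof -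
        obtain cs ds where cd: "set cs \<subseteq> carrier k" "y = m cs" "set ds \<subseteq> carrier k" "z = m ds"
          using yz by (auto simp: M_def)
        have "y \<otimes>\<^bsub>R\<^esub> z = m (cs @ ds)" using m_append cd by simp
        then show ?thesis using cd unfolding M_def by auto
      qed
      \<comment> \<open>A prime over \<open>a\<close> that contains no \<open>x - c\<close>. The
        kernel \<open>K\<close> of a point over it does contain one, hence is strictly larger, and
        below \<open>q\<close> there is a further prime as \<open>a\<close> is a
        non-zerodivisor.\<close>
      obtain q where q: "primeideal q R" "PIdl\<^bsub>R\<^esub> a \<subseteq> q" "q \<inter> M = {}"
        using R.ex_prime_avoiding[OF PI MR oneM disj mult] by metis
      interpret q: primeideal q R by fact
      have "\<one>\<^bsub>R\<^esub> \<notin> q" using q.I_notcarr q.one_imp_carrier by auto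
      then obtain \<chi> where \<chi>: "alg_point k R \<chi>" "\<And>y. y \<in> q \<Longrightarrow> \<chi> y = \<zero>\<^bsub>k\<^esub>"
        using ex_alg_point[OF assms(1,2) q(1) R.one_closed] by blast
      interpret \<chi>: ring_hom_cring R k \<chi> by (rule pt(1)[OF \<chi>(1)])
      have \<chi>r: "ring_hom_ring R k \<chi>"
        by (rule ring_hom_ringI2[OF cring.axioms(1)[OF R.is_cring] cring.axioms(1)[OF k.is_cring] \<chi>.homh])
      define K where "K = {y \<in> carrier R. \<chi> y = \<zero>\<^bsub>k\<^esub>}"
      have K: "primeideal K R"
      proof (rule primeidealI[OF _ R.is_cring])
        have "K = a_kernel R k \<chi>" unfolding K_def a_kernel_def' by (rule refl)
        then show "ideal K R" using ring_hom_ring.kernel_is_ideal[OF \<chi>r] by simp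
        show "carrier R \<noteq> K"
        proof
          assume "carrier R = K"
          then have "\<one>\<^bsub>R\<^esub> \<in> K" by blast
          then show False by (simp add: K_def)
        qed
        show "y \<in> K \<or> z \<in> K" if "y \<in> carrier R" "z \<in> carrier R" "y \<otimes>\<^bsub>R\<^esub> z \<in> K" for y z
          using that k.integral by (auto simp: K_def)
      qed
      have "q \<subseteq> K" using \<chi>(2) q.a_subset by (auto simp: K_def)
      have cx: "\<chi> x \<in> carrier k" using x by simp
      have "m [\<chi> x] \<in> K"
        using x \<iota>[OF cx] pt(2)[OF \<chi>(1) cx] by (simp add: K_def m_def R.minus_eq k.r_neg)
      moreover have "m [\<chi> x] \<notin> q" using q(3) cx by (auto simp: M_def)
      ultimately have "q \<subset> K" using \<open>q \<subseteq> K\<close> by blast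
      have "a \<in> q" using q(2) R.cgenideal_self[OF a] by blast
      then obtain p where "primeideal p R" "p \<subset> q" using R.prime_below[OF q(1) _ assms(4)] by blast
      then have "2 \<le> krull_dim R" using krull_dim_chain[OF _ q(1) K _ \<open>q \<subset> K\<close>] by blast
      then show False using assms(3) by simp
    qed
    then obtain cs where cs: "set cs \<subseteq> carrier k" "m cs \<in> PIdl\<^bsub>R\<^esub> a" by blast
    obtain r where r: "r \<in> carrier R" "m cs = r \<otimes>\<^bsub>R\<^esub> a" using cs(2) by (auto simp: cgenideal_def)
    have "\<chi> x \<in> set cs" if "\<chi> \<in> A" for \<chi>
    proof -
      have \<chi>: "alg_point k R \<chi>" "\<chi> a = \<zero>\<^bsub>k\<^esub>" using that by (auto simp: A_def)
      interpret \<chi>: ring_hom_cring R k \<chi> by (rule pt(1)[OF \<chi>(1)])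
      have "\<chi> (m cs) = \<zero>\<^bsub>k\<^esub>" using r a \<chi>(2) by simp
      then show ?thesis by (rule m_root[OF \<chi>(1) cs(1)])
    qed
    then show ?thesis by blast
  qed
  obtain S where S: "finite S" "S \<subseteq> carrier R"
    "carrier R = generate_ring R (\<iota> ` carrier k \<union> S)"
    using assms(2) unfolding fin_gen_algebra_def \<iota>_def by blast
  have "\<forall>x\<in>S. \<exists>C. finite C \<and> (\<forall>\<chi>\<in>A. \<chi> x \<in> C)" using fin S(2) by blast
  then obtain C where C: "\<And>x. x \<in> S \<Longrightarrow> finite (C x)" "\<And>x \<chi>. x \<in> S \<Longrightarrow> \<chi> \<in> A \<Longrightarrow> \<chi> x \<in> C x" by metis
  \<comment> \<open>Restriction to the generators embeds \<open>A\<close> into a finite product of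
    finite sets of values.\<close>
  have finA: "finite A"
  proof (rule inj_on_finite)
    show "finite (Pi\<^sub>E S C)" using S(1) C(1) by (rule finite_PiE)
    show "(\<lambda>\<chi>. restrict \<chi> S) ` A \<subseteq> Pi\<^sub>E S C" using C(2) by auto
    show "inj_on (\<lambda>\<chi>. restrict \<chi> S) A"
    proof (rule inj_onI)
      fix \<chi> \<chi>' assume \<chi>: "\<chi> \<in> A" "\<chi>' \<in> A" "restrict \<chi> S = restrict \<chi>' S"
      have "alg_point k R \<chi>" "alg_point k R \<chi>'" using \<chi>(1,2) by (auto simp: A_def)
      interpret \<chi>: ring_hom_cring R k \<chi> by (rule pt(1)) fact
      interpret \<chi>': ring_hom_cring R k \<chi>' by (rule pt(1)) fact
      have "\<chi> x = \<chi>' x" if "x \<in> generate_ring R (\<iota> ` carrier k \<union> S)" for x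
        using that
      proof (induction rule: generate_ring.induct)
        case (incl x)
        then show ?case
        proof
          assume "x \<in> \<iota> ` carrier k"
          then show ?thesis using pt(2)[OF \<open>alg_point k R \<chi>\<close>] pt(2)[OF \<open>alg_point k R \<chi>'\<close>] by auto
        next
          assume "x \<in> S"
          then show ?thesis using fun_cong[OF \<chi>(3), of x] by simp
        qed
      qed (auto simp: S(3)[symmetric])
      then show "\<chi> = \<chi>'"
        using \<chi>(1,2) S(3) by (intro extensionalityI[of _ "carrier R"]) (auto simp: A_def)
    qed
  qed
  have sep: "\<exists>e\<in>carrier R. \<chi> e = \<one>\<^bsub>k\<^esub> \<and> (\<forall>\<chi>'\<in>A - {\<chi>}. \<chi>' e = \<zero>\<^bsub>k\<^esub>)" if \<chi>A: "\<chi> \<in> A" for \<chi>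
  proof -
    have ptA: "alg_point k R \<psi>" if "\<psi> \<in> A" for \<psi> using that by (simp add: A_def)
    interpret \<chi>: ring_hom_cring R k \<chi> by (rule pt(1)[OF ptA[OF \<chi>A]])
    have "\<exists>e\<in>carrier R. \<chi> e = \<one>\<^bsub>k\<^esub> \<and> (\<forall>\<chi>'\<in>B. \<chi>' e = \<zero>\<^bsub>k\<^esub>)" if "finite B" "B \<subseteq> A - {\<chi>}" for B
      using that
    proof (induction B)
      case empty
      show ?case by (intro bexI[of _ "\<one>\<^bsub>R\<^esub>"]) auto
    next
      case (insert \<psi> B)
      then obtain e where e: "e \<in> carrier R" "\<chi> e = \<one>\<^bsub>k\<^esub>" "\<And>\<chi>'. \<chi>' \<in> B \<Longrightarrow> \<chi>' e = \<zero>\<^bsub>k\<^esub>" by auto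
      have \<psi>A: "\<psi> \<in> A" "\<psi> \<noteq> \<chi>" using insert.prems by auto
      interpret \<psi>: ring_hom_cring R k \<psi> by (rule pt(1)[OF ptA[OF \<psi>A(1)]])
      have "\<exists>x\<in>carrier R. \<chi> x \<noteq> \<psi> x"
        using \<psi>A \<chi>A extensionalityI[of \<chi> "carrier R" \<psi>] by (auto simp: A_def)
      then obtain x where x: "x \<in> carrier R" "\<chi> x \<noteq> \<psi> x" by blast
      define d where "d = \<chi> x \<ominus>\<^bsub>k\<^esub> \<psi> x"
      have d: "d \<in> Units k" using x by (simp add: d_def k.field_Units)
      \<comment> \<open>The Lagrange factor \<open>(x - \<psi> x) / d\<close>, which is one at
        \<open>\<chi>\<close> and zero at \<open>\<psi>\<close>.\<close>
      define g where "g = (x \<ominus>\<^bsub>R\<^esub> \<iota> (\<psi> x)) \<otimes>\<^bsub>R\<^esub> \<iota> (inv\<^bsub>k\<^esub> d)"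
      have cl: "\<iota> (\<psi> x) \<in> carrier R" "\<iota> (inv\<^bsub>k\<^esub> d) \<in> carrier R" using x d \<iota> by auto
      have g: "g \<in> carrier R" using cl x by (simp add: g_def)
      have vals: "\<theta> (\<iota> (\<psi> x)) = \<psi> x" "\<theta> (\<iota> (inv\<^bsub>k\<^esub> d)) = inv\<^bsub>k\<^esub> d" if "alg_point k R \<theta>" for \<theta>
        using pt(2)[OF that] x d by auto
      have "\<chi> g = d \<otimes>\<^bsub>k\<^esub> inv\<^bsub>k\<^esub> d"
        using cl x vals[OF ptA[OF \<chi>A]] by (simp add: g_def d_def R.minus_eq k.minus_eq)
      then have g1: "\<chi> g = \<one>\<^bsub>k\<^esub>" using d by simp
      have g0: "\<psi> g = \<zero>\<^bsub>k\<^esub>"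
        using cl x vals[OF ptA[OF \<psi>A(1)]] d by (simp add: g_def R.minus_eq k.r_neg)
      have "\<chi> (g \<otimes>\<^bsub>R\<^esub> e) = \<one>\<^bsub>k\<^esub>" using g e g1 by simp
      moreover have "\<chi>' (g \<otimes>\<^bsub>R\<^esub> e) = \<zero>\<^bsub>k\<^esub>" if \<chi>': "\<chi>' \<in> insert \<psi> B" for \<chi>'
      proof -
        have "\<chi>' \<in> A" using \<chi>' insert.prems by auto
        interpret \<chi>': ring_hom_cring R k \<chi>' by (rule pt(1)[OF ptA[OF \<open>\<chi>' \<in> A\<close>]])
        show ?thesis
        proof (cases "\<chi>' = \<psi>")
          case True
          then show ?thesis using \<psi>.hom_mult[OF g e(1)] \<psi>.hom_closed[OF e(1)] g0 by simp
        next
          case False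
          then have "\<chi>' e = \<zero>\<^bsub>k\<^esub>" using e(3) \<chi>' by blast
          then show ?thesis using \<chi>'.hom_mult[OF g e(1)] \<chi>'.hom_closed[OF g] by simp
        qed
      qed
      ultimately show ?case using g e(1) by (intro bexI[of _ "g \<otimes>\<^bsub>R\<^esub> e"]) auto
    qed
    then show ?thesis using finA by simp
  qed
  show thesis
    by (rule that[OF finA _ sep nil]) (auto simp: A_def)
qed

section \<open>Gluing coordinates at finitely many points\<close>

text \<open>The image of a substitution is a subring; it contains the generators and therefore every
  polynomial expression in them.\<close>

lemma (in cring) subst_image_generate:
  assumes y: "y \<in> {..<n} \<rightarrow> mpolys R m"
    and p: "p \<in> generate_ring (mpoly_ring R m) (indexed_const ` carrier R \<union> y ` {..<n})"
  obtains h where "h \<in> mpolys R n" "mpoly_subst R m y h = p"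
proof -
  interpret M: cring "mpoly_ring R m" by (rule cring_mpoly_ring)
  interpret N: cring "mpoly_ring R n" by (rule cring_mpoly_ring)
  have "ring_hom_ring (mpoly_ring R n) (mpoly_ring R m) (mpoly_subst R m y)"
    by (rule ring_hom_ringI2[OF N.ring_axioms M.ring_axioms ring_hom_cring.homh[OF subst_hom[OF y]]])
  then have sub: "subring (mpoly_subst R m y ` mpolys R n) (mpoly_ring R m)"
    by (rule ring_hom_ring.img_is_subring[OF _ N.carrier_is_subring])
  have K: "indexed_const ` carrier R \<union> y ` {..<n} \<subseteq> mpolys R m"
    using y const_closed by auto
  have "indexed_const ` carrier R \<union> y ` {..<n} \<subseteq> mpoly_subst R m y ` mpolys R n"
  proof
    fix q assume "q \<in> indexed_const ` carrier R \<union> y ` {..<n}"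
    then consider c where "c \<in> carrier R" "q = indexed_const c" | i where "i < n" "q = y i" by auto
    then show "q \<in> mpoly_subst R m y ` mpolys R n"
    proof cases
      case 1
      then show ?thesis using subst_const[OF y 1(1)] const_closed[OF 1(1)] by (intro image_eqI[of _ _ "indexed_const c"]) simp_all
    next
      case 2
      then show ?thesis using subst_var[OF y 2(1)] mpoly_var_closed[OF 2(1)] by (intro image_eqI[of _ _ "indexed_var i"]) simp_all
    qed
  qed
  then have "generate_ring (mpoly_ring R m) (indexed_const ` carrier R \<union> y ` {..<n}) \<subseteq> mpoly_subst R m y ` mpolys R n"
    by (rule M.generate_ring_min_subring1[OF K sub])
  then show thesis using p that by blast
qed

text \<open>Turns the condition on generated rings into an equation \<open>h(g) = Z\<close>, which
  \<open>map_subst\<close> transports along ring homomorphisms.\<close>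

lemma (in cring) coordinate_system:
  assumes "is_coordinate R n P"
  obtains g h where "g \<in> {..<n} \<rightarrow> mpolys R n" "h \<in> {..<n} \<rightarrow> mpolys R n" "g 0 = P"
    "\<And>j. j < n \<Longrightarrow> mpoly_subst R n g (h j) = indexed_var j"
proof -
  obtain G where P: "n \<ge> 1" "P \<in> mpolys R n" and G: "G ` {2..n} \<subseteq> mpolys R n"
    and gen: "mpolys R n = generate_ring (mpoly_ring R n) (indexed_const ` carrier R \<union> insert P (G ` {2..n}))"
    using assms by (auto simp: is_coordinate_def)
  \<comment> \<open>Shifts the numbering of \<open>is_coordinate\<close>, where the generators
    besides \<open>P\<close> run from 2 to \<open>n\<close>, to the range
    \<open>{..<n}\<close>.\<close>
  define g where "g j = (if j = 0 then P else G (Suc j))" for j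
  have g: "g \<in> {..<n} \<rightarrow> mpolys R n"
  proof
    fix j assume "j \<in> {..<n}"
    then show "g j \<in> mpolys R n" using P(2) G by (cases "j = 0") (auto simp: g_def)
  qed
  have im: "insert P (G ` {2..n}) = g ` {..<n}"
  proof
    show "insert P (G ` {2..n}) \<subseteq> g ` {..<n}"
    proof
      fix q assume "q \<in> insert P (G ` {2..n})"
      then consider "q = P" | i where "i \<in> {2..n}" "q = G i" by auto
      then show "q \<in> g ` {..<n}"
      proof cases
        case 1
        then show ?thesis using P(1) by (intro image_eqI[of _ _ 0]) (auto simp: g_def)
      next
        case 2
        then show ?thesis by (intro image_eqI[of _ _ "i - 1"]) (auto simp: g_def)
      qed
    qed
    show "g ` {..<n} \<subseteq> insert P (G ` {2..n})" by (auto simp: g_def)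
  qed
  have "\<exists>h\<in>mpolys R n. mpoly_subst R n g h = indexed_var j" if "j < n" for j
  proof -
    have "indexed_var j \<in> generate_ring (mpoly_ring R n) (indexed_const ` carrier R \<union> g ` {..<n})"
      using mpoly_var_closed[OF that] gen unfolding im by simp
    then show ?thesis by (rule subst_image_generate[OF g]) blast
  qed
  then obtain h where "\<And>j. j < n \<Longrightarrow> h j \<in> mpolys R n" "\<And>j. j < n \<Longrightarrow> mpoly_subst R n g (h j) = indexed_var j"
    by metis
  then show thesis using that[of g h] g by (auto simp: g_def)
qed

text \<open>The automorphism is extended by fixing the last variable. It fixes the constant
  \<open>a\<close> too, so only the summand \<open>Q\<close> changes.\<close>

lemma (in cring) coordinate_image_lift:
  assumes coord: "is_coordinate R (n + 1) (indexed_const a \<otimes>\<^bsub>mpoly_ring R (n + 1)\<^esub> indexed_var n \<oplus>\<^bsub>mpoly_ring R (n + 1)\<^esub> Q)"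
    and a: "a \<in> carrier R" and Q: "Q \<in> mpolys R n"
    and Y: "Y \<in> {..<n} \<rightarrow> mpolys R n" and N: "N \<in> {..<n} \<rightarrow> mpolys R n"
    and YN: "\<And>j. j < n \<Longrightarrow> mpoly_subst R n Y (N j) = indexed_var j"
  shows "is_coordinate R (n + 1) (indexed_const a \<otimes>\<^bsub>mpoly_ring R (n + 1)\<^esub> indexed_var n
    \<oplus>\<^bsub>mpoly_ring R (n + 1)\<^esub> mpoly_subst R n Y Q)"
proof -
  interpret M: cring "mpoly_ring R (n + 1)" by (rule cring_mpoly_ring)
  define W where "W = (indexed_var n :: nat multiset \<Rightarrow> 'a)"
  have W: "W \<in> mpolys R (n + 1)" unfolding W_def by (rule mpoly_var_closed) simp
  have ext: "f(n := W) \<in> {..<n + 1} \<rightarrow> mpolys R (n + 1)" if "f \<in> {..<n} \<rightarrow> mpolys R n" for f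
  proof
    fix i assume "i \<in> {..<n + 1}"
    then have "i = n \<or> i < n" by auto
    then show "(f(n := W)) i \<in> mpolys R (n + 1)"
      using W that mpolys_mono[of "f i" n "n + 1"] by auto
  qed
  have ev: "mpoly_subst R (n + 1) (Y(n := W)) q = mpoly_subst R n Y q" if "q \<in> mpolys R n" for q
  proof -
    have Y': "Y \<in> {..<n} \<rightarrow> mpolys R (n + 1)"
      using Y mpolys_mono[of _ n "n + 1"] by (simp add: Pi_iff)
    have "mpoly_subst R (n + 1) (Y(n := W)) q = mpoly_subst R (n + 1) Y q"
      by (rule subst_cong[symmetric, OF Y' that]) simp
    then show ?thesis using subst_incl[OF Y that, of "n + 1"] by simp
  qed
  interpret S: ring_hom_cring "mpoly_ring R (n + 1)" "mpoly_ring R (n + 1)" "mpoly_subst R (n + 1) (Y(n := W))"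
    by (rule subst_hom[OF ext[OF Y]])
  have sW: "mpoly_subst R (n + 1) (Y(n := W)) W = W"
    unfolding W_def by (subst subst_var[OF ext[OF Y, unfolded W_def]]) simp_all
  have sa: "mpoly_subst R (n + 1) (Y(n := W)) (indexed_const a) = indexed_const a"
    by (rule subst_const[OF ext[OF Y] a])
  have "is_coordinate R (n + 1) (mpoly_subst R (n + 1) (Y(n := W))
      (indexed_const a \<otimes>\<^bsub>mpoly_ring R (n + 1)\<^esub> W \<oplus>\<^bsub>mpoly_ring R (n + 1)\<^esub> Q))"
  proof (rule coordinate_image[OF coord[folded W_def] ext[OF Y] ext[OF N]])
    show "mpoly_subst R (n + 1) (Y(n := W)) ((N(n := W)) j) = indexed_var j" if "j < n + 1" for j
    proof (cases "j = n")
      case True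
      then show ?thesis using sW by (simp add: W_def)
    next
      case False
      then have "j < n" using that by simp
      then show ?thesis using ev[of "N j"] N YN[of j] False by auto
    qed
  qed
  moreover have "mpoly_subst R (n + 1) (Y(n := W)) (indexed_const a \<otimes>\<^bsub>mpoly_ring R (n + 1)\<^esub> W \<oplus>\<^bsub>mpoly_ring R (n + 1)\<^esub> Q)
      = indexed_const a \<otimes>\<^bsub>mpoly_ring R (n + 1)\<^esub> W \<oplus>\<^bsub>mpoly_ring R (n + 1)\<^esub> mpoly_subst R n Y Q"
  proof -
    have ca: "indexed_const a \<in> mpolys R (n + 1)" by (rule const_closed[OF a])
    have Qm: "Q \<in> mpolys R (n + 1)" by (rule mpolys_mono[OF Q]) simp
    show ?thesis
      unfolding S.hom_add[OF M.m_closed[OF ca W] Qm] S.hom_mult[OF ca W] sW sa ev[OF Q] by (rule refl)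
  qed
  ultimately show ?thesis by (simp add: W_def)
qed

lemma (in ring_hom_cring) map_lincomb:
  assumes "\<And>t. c t \<in> carrier R" "y \<in> {..<n} \<rightarrow> mpolys R n"
  shows "mpoly_map h (lincomb R n c y) = lincomb S n (\<lambda>t. h (c t)) (\<lambda>t. mpoly_map h (y t))"
proof -
  interpret H: ring_hom_cring "mpoly_ring R n" "mpoly_ring S n" "mpoly_map h" by (rule map_hom_cring)
  have "mpoly_map h (lincomb R n c y) = (\<Oplus>\<^bsub>mpoly_ring S n\<^esub>t\<in>{..<n}.
      mpoly_map h (R.indexed_const (c t)) \<otimes>\<^bsub>mpoly_ring S n\<^esub> mpoly_map h (y t))"
    unfolding lincomb_def by (rule H.hom_lincomb) (use R.const_closed[OF assms(1)] assms(2) in auto)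
  then show ?thesis by (simp only: lincomb_def map_const[OF assms(1)])
qed

text \<open>Evaluation at the variables is the identity, and by definition it is a sum over the
  support.\<close>

lemma (in cring) poly_expansion:
  assumes "P \<in> mpolys R n"
  shows "P = (\<Oplus>\<^bsub>mpoly_ring R n\<^esub>u\<in>{u. P u \<noteq> \<zero>}. indexed_const (P u) \<otimes>\<^bsub>mpoly_ring R n\<^esub> mon_eval (mpoly_ring R n) indexed_var u)"
  using subst_var_id[OF mpolysD[OF assms]] by (simp add: mpoly_eval_def)

lemma (in cring) mon_eval_var_closed:
  assumes "P \<in> mpolys R n" "P u \<noteq> \<zero>"
  shows "mon_eval (mpoly_ring R n) indexed_var u \<in> mpolys R n"
proof -
  interpret M: cring "mpoly_ring R n" by (rule cring_mpoly_ring)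
  show ?thesis
    by (rule M.mon_eval_closed[OF polys_support[OF mpolysD[OF assms(1)] assms(2)]])
      (use mpoly_var_closed in auto)
qed

text \<open>Every term contributes a multiple of the variable \<open>0\<close>, so the shear changes
  only the coefficient there. A suitable \<open>s\<close> moves a non-zero coefficient from another
  variable to this one.\<close>

lemma (in cring) shear_lincomb:
  assumes r: "\<And>t. r t \<in> carrier R" and s: "\<And>t. s t \<in> carrier R" and n: "0 < n"
  shows "lincomb R n r (\<lambda>t. indexed_var t \<oplus>\<^bsub>mpoly_ring R n\<^esub> indexed_const (s t) \<otimes>\<^bsub>mpoly_ring R n\<^esub> indexed_var 0)
    = lincomb R n (\<lambda>t. r t \<oplus> (if t = 0 then (\<Oplus>t\<in>{..<n}. r t \<otimes> s t) else \<zero>)) indexed_var"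
proof
  fix u :: "nat multiset"
  interpret M: cring "mpoly_ring R n" by (rule cring_mpoly_ring)
  define S where "S = (\<Oplus>t\<in>{..<n}. r t \<otimes> s t)"
  have S: "S \<in> carrier R" unfolding S_def by (rule finsum_closed) (use r s in auto)
  define x where "x = (indexed_var :: nat \<Rightarrow> nat multiset \<Rightarrow> 'a)"
  have x: "x t \<in> mpolys R n" if "t < n" for t unfolding x_def by (rule mpoly_var_closed[OF that])
  have xu: "x t u \<in> carrier R" if "t < n" for t by (rule mpolys_coeff[OF x[OF that]])
  have sx: "indexed_const (s t) \<otimes>\<^bsub>mpoly_ring R n\<^esub> x 0 \<in> mpolys R n" for t
    by (rule M.m_closed[OF const_closed[OF s] x[OF n]])
  define \<theta> where "\<theta> t = x t \<oplus>\<^bsub>mpoly_ring R n\<^esub> indexed_const (s t) \<otimes>\<^bsub>mpoly_ring R n\<^esub> x 0" for t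
  have \<theta>: "\<theta> \<in> {..<n} \<rightarrow> mpolys R n"
  proof
    fix t assume "t \<in> {..<n}"
    then show "\<theta> t \<in> mpolys R n" unfolding \<theta>_def by (intro M.a_closed[OF x sx]) simp
  qed
  have \<theta>u: "\<theta> t u = x t u \<oplus> s t \<otimes> x 0 u" for t
    unfolding \<theta>_def add_coeff mult_const_coeff[OF s x[OF n]] by (rule refl)
  define l where "l t = r t \<oplus> (if t = 0 then S else \<zero>)" for t
  have l: "l t \<in> carrier R" for t using r S by (simp add: l_def)
  have xf: "x \<in> {..<n} \<rightarrow> mpolys R n" using x by auto
  have rx: "(\<Oplus>t\<in>{..<n}. r t \<otimes> x t u) \<in> carrier R" by (rule finsum_closed) (use r xu in auto)
  have "lincomb R n r \<theta> u = (\<Oplus>t\<in>{..<n}. r t \<otimes> x t u \<oplus> (r t \<otimes> s t) \<otimes> x 0 u)"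
    unfolding lincomb_coeff[OF r \<theta>]
  proof (rule finsum_cong')
    fix t assume "t \<in> {..<n}"
    then show "r t \<otimes> \<theta> t u = r t \<otimes> x t u \<oplus> (r t \<otimes> s t) \<otimes> x 0 u"
      unfolding \<theta>u using r[of t] s[of t] xu[of t] xu[OF n] by (simp add: r_distr m_assoc)
  qed (use r s xu n in auto)
  also have "\<dots> = (\<Oplus>t\<in>{..<n}. r t \<otimes> x t u) \<oplus> (\<Oplus>t\<in>{..<n}. (r t \<otimes> s t) \<otimes> x 0 u)"
    by (rule finsum_addf) (use r s xu n in auto)
  also have "(\<Oplus>t\<in>{..<n}. (r t \<otimes> s t) \<otimes> x 0 u) = S \<otimes> x 0 u"
    unfolding S_def by (rule finsum_ldistr[symmetric]) (use r s xu n in auto)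
  finally have 1: "lincomb R n r \<theta> u = (\<Oplus>t\<in>{..<n}. r t \<otimes> x t u) \<oplus> S \<otimes> x 0 u" .
  have "lincomb R n l x u = (\<Oplus>t\<in>{..<n}. r t \<otimes> x t u \<oplus> (if 0 = t then S \<otimes> x t u else \<zero>))"
    unfolding lincomb_coeff[OF l xf]
  proof (rule finsum_cong')
    fix t assume "t \<in> {..<n}"
    then show "l t \<otimes> x t u = r t \<otimes> x t u \<oplus> (if 0 = t then S \<otimes> x t u else \<zero>)"
      unfolding l_def using r[of t] S xu[of t] by (auto simp: l_distr)
  qed (use r S xu in auto)
  also have "\<dots> = (\<Oplus>t\<in>{..<n}. r t \<otimes> x t u) \<oplus> (\<Oplus>t\<in>{..<n}. if 0 = t then S \<otimes> x t u else \<zero>)"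
    by (rule finsum_addf) (use r S xu in auto)
  also have "(\<Oplus>t\<in>{..<n}. if 0 = t then S \<otimes> x t u else \<zero>) = S \<otimes> x 0 u"
    by (rule finsum_singleton) (use n S xu in auto)
  finally have 2: "lincomb R n l x u = (\<Oplus>t\<in>{..<n}. r t \<otimes> x t u) \<oplus> S \<otimes> x 0 u" .
  show "lincomb R n r (\<lambda>t. indexed_var t \<oplus>\<^bsub>mpoly_ring R n\<^esub> indexed_const (s t) \<otimes>\<^bsub>mpoly_ring R n\<^esub> indexed_var 0) u
    = lincomb R n (\<lambda>t. r t \<oplus> (if t = 0 then (\<Oplus>t\<in>{..<n}. r t \<otimes> s t) else \<zero>)) indexed_var u"
    using 1 2 unfolding \<theta>_def l_def x_def S_def by simp
qed

section \<open>Interpolation at separated points\<close>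

locale separated_points =
  k: field k + R: cring R + \<iota>: ring_hom_cring k R \<iota>
  for k :: "('k, 'c) ring_scheme" and R :: "('a, 'b) ring_scheme" and \<iota> +
  fixes A :: "('a \<Rightarrow> 'k) set"
  assumes fin: "finite A"
    and hom: "\<chi> \<in> A \<Longrightarrow> ring_hom_cring R k \<chi>"
    and point: "\<chi> \<in> A \<Longrightarrow> c \<in> carrier k \<Longrightarrow> \<chi> (\<iota> c) = c"
    and sep: "\<chi> \<in> A \<Longrightarrow> \<exists>e\<in>carrier R. \<chi> e = \<one>\<^bsub>k\<^esub> \<and> (\<forall>\<chi>'\<in>A - {\<chi>}. \<chi>' e = \<zero>\<^bsub>k\<^esub>)"
begin

text \<open>Lagrange interpolation with the separating elements as basis functions.\<close>

lemma interpolate: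
  assumes "\<And>\<chi>. \<chi> \<in> A \<Longrightarrow> f \<chi> \<in> carrier k"
  obtains r where "r \<in> carrier R" "\<And>\<chi>. \<chi> \<in> A \<Longrightarrow> \<chi> r = f \<chi>"
proof -
  obtain e where e: "\<And>\<chi>. \<chi> \<in> A \<Longrightarrow> e \<chi> \<in> carrier R" "\<And>\<chi>. \<chi> \<in> A \<Longrightarrow> \<chi> (e \<chi>) = \<one>\<^bsub>k\<^esub>"
    "\<And>\<chi> \<chi>'. \<chi> \<in> A \<Longrightarrow> \<chi>' \<in> A - {\<chi>} \<Longrightarrow> \<chi>' (e \<chi>) = \<zero>\<^bsub>k\<^esub>"
    using sep by metis
  define r where "r = (\<Oplus>\<^bsub>R\<^esub>\<chi>\<in>A. \<iota> (f \<chi>) \<otimes>\<^bsub>R\<^esub> e \<chi>)"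
  have \<iota>f: "\<iota> (f \<chi>) \<in> carrier R" if "\<chi> \<in> A" for \<chi> using assms[OF that] by simp
  have r: "r \<in> carrier R" unfolding r_def by (rule R.finsum_closed) (use \<iota>f e(1) in auto)
  have "\<psi> r = f \<psi>" if \<psi>: "\<psi> \<in> A" for \<psi>
  proof -
    interpret \<psi>: ring_hom_cring R k \<psi> by (rule hom[OF \<psi>])
    have "\<psi> r = (\<Oplus>\<^bsub>k\<^esub>\<chi>\<in>A. \<psi> (\<iota> (f \<chi>)) \<otimes>\<^bsub>k\<^esub> \<psi> (e \<chi>))"
      unfolding r_def by (rule \<psi>.hom_lincomb[OF fin]) (use \<iota>f e(1) in auto)
    also have "\<dots> = (\<Oplus>\<^bsub>k\<^esub>\<chi>\<in>A. if \<psi> = \<chi> then f \<chi> else \<zero>\<^bsub>k\<^esub>)"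
    proof (rule k.finsum_cong')
      fix \<chi> assume \<chi>: "\<chi> \<in> A"
      show "\<psi> (\<iota> (f \<chi>)) \<otimes>\<^bsub>k\<^esub> \<psi> (e \<chi>) = (if \<psi> = \<chi> then f \<chi> else \<zero>\<^bsub>k\<^esub>)"
        using point[OF \<psi> assms[OF \<chi>]] e(2)[OF \<chi>] e(3)[OF \<chi>, of \<psi>] \<psi> assms[OF \<chi>] by auto
    qed (use assms in auto)
    also have "\<dots> = f \<psi>" by (rule k.finsum_singleton[OF \<psi> fin]) (use assms in auto)
    finally show ?thesis .
  qed
  then show thesis using r that by blast
qed

text \<open>The points are treated one at a time. For a new point \<open>\<psi>\<close>, the system
  is composed with the path of \<open>\<gamma> \<psi>\<close> evaluated at an element that is one at
  \<open>\<psi>\<close> and zero at the other points; there the path is the identity, so earlier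
  values are kept.\<close>

lemma interpolate_coordinates:
  assumes \<gamma>: "\<And>\<chi>. \<chi> \<in> A \<Longrightarrow> \<gamma> \<chi> \<in> {..<n} \<rightarrow> mpolys k n" and \<eta>: "\<And>\<chi>. \<chi> \<in> A \<Longrightarrow> \<eta> \<chi> \<in> {..<n} \<rightarrow> mpolys k n"
    and \<gamma>0: "\<And>\<chi> j. \<chi> \<in> A \<Longrightarrow> j < n \<Longrightarrow> \<gamma> \<chi> j {#} = \<zero>\<^bsub>k\<^esub>"
    and \<eta>0: "\<And>\<chi> j. \<chi> \<in> A \<Longrightarrow> j < n \<Longrightarrow> \<eta> \<chi> j {#} = \<zero>\<^bsub>k\<^esub>"
    and \<gamma>1: "\<And>\<chi> j s. \<chi> \<in> A \<Longrightarrow> j < n \<Longrightarrow> s < n \<Longrightarrow> \<gamma> \<chi> j {#s#} = (if j = s then \<one>\<^bsub>k\<^esub> else \<zero>\<^bsub>k\<^esub>)"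
    and \<gamma>\<eta>: "\<And>\<chi> j. \<chi> \<in> A \<Longrightarrow> j < n \<Longrightarrow> mpoly_subst k n (\<gamma> \<chi>) (\<eta> \<chi> j) = k.indexed_var j"
  obtains Y N where "Y \<in> {..<n} \<rightarrow> mpolys R n" "N \<in> {..<n} \<rightarrow> mpolys R n"
    "\<And>j. j < n \<Longrightarrow> mpoly_subst R n Y (N j) = R.indexed_var j"
    "\<And>\<chi> j. \<chi> \<in> A \<Longrightarrow> j < n \<Longrightarrow> mpoly_map \<chi> (Y j) = \<gamma> \<chi> j"
proof -
  have kv: "k.indexed_var \<in> {..<n} \<rightarrow> mpolys k n" using k.mpoly_var_closed by auto
  have Rv: "R.indexed_var \<in> {..<n} \<rightarrow> mpolys R n" using R.mpoly_var_closed by auto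
  \<comment> \<open>At points outside \<open>B\<close> the identity is prescribed, so that
    composition yields exactly \<open>\<gamma> \<psi>\<close> at a new point
    \<open>\<psi>\<close>.\<close>
  define good where "good B Y N \<longleftrightarrow> Y \<in> {..<n} \<rightarrow> mpolys R n \<and> N \<in> {..<n} \<rightarrow> mpolys R n \<and>
      (\<forall>j<n. mpoly_subst R n Y (N j) = R.indexed_var j) \<and>
      (\<forall>\<chi>\<in>A. \<forall>j<n. mpoly_map \<chi> (Y j) = (if \<chi> \<in> B then \<gamma> \<chi> j else k.indexed_var j))" for B Y N
  have "\<exists>Y N. good B Y N" if "finite B" "B \<subseteq> A" for B
    using that
  proof (induction B)
    case empty
    have "mpoly_map \<chi> (R.indexed_var j) = k.indexed_var j" if "\<chi> \<in> A" for \<chi> and j :: nat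
      by (rule ring_hom_cring.map_var[OF hom[OF that]])
    moreover have "mpoly_subst R n R.indexed_var (R.indexed_var j) = R.indexed_var j" if "j < n" for j
      by (rule R.subst_var[OF Rv that])
    ultimately have "good {} R.indexed_var R.indexed_var" using Rv unfolding good_def by simp
    then show ?case by blast
  next
    case (insert \<psi> B)
    then obtain Y N where good: "good B Y N" by auto
    have Y: "Y \<in> {..<n} \<rightarrow> mpolys R n" and N: "N \<in> {..<n} \<rightarrow> mpolys R n"
      and YN: "\<And>j. j < n \<Longrightarrow> mpoly_subst R n Y (N j) = R.indexed_var j"
      and val: "\<And>\<chi> j. \<chi> \<in> A \<Longrightarrow> j < n \<Longrightarrow> mpoly_map \<chi> (Y j) = (if \<chi> \<in> B then \<gamma> \<chi> j else k.indexed_var j)"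
      using good unfolding good_def by blast+
    have Yj: "Y j \<in> mpolys R n" "N j \<in> mpolys R n" if "j < n" for j using Y N that by auto
    have \<psi>: "\<psi> \<in> A" using insert.prems by simp
    obtain e where e: "e \<in> carrier R" "\<psi> e = \<one>\<^bsub>k\<^esub>" "\<And>\<chi>. \<chi> \<in> A - {\<psi>} \<Longrightarrow> \<chi> e = \<zero>\<^bsub>k\<^esub>"
      using sep[OF \<psi>] by blast
    define \<Gamma> where "\<Gamma> j u = \<iota> (\<gamma> \<psi> j u) \<otimes>\<^bsub>R\<^esub> e [^]\<^bsub>R\<^esub> (size u - 1)" for j and u :: "nat multiset"
    obtain N' where \<Gamma>: "\<Gamma> \<in> {..<n} \<rightarrow> mpolys R n" and N': "N' \<in> {..<n} \<rightarrow> mpolys R n"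
      and \<Gamma>N: "\<And>j. j < n \<Longrightarrow> mpoly_subst R n \<Gamma> (N' j) = R.indexed_var j"
      unfolding \<Gamma>_def[abs_def]
      by (rule coordinate_path[OF \<iota>.ring_hom_cring_axioms e(1) \<gamma>[OF \<psi>] \<eta>[OF \<psi>] \<gamma>0[OF \<psi>] \<eta>0[OF \<psi>] \<gamma>\<eta>[OF \<psi>]]; iprover)
    have \<gamma>c: "\<gamma> \<psi> j u \<in> carrier k" if "j < n" for j and u :: "nat multiset"
      by (rule k.mpolys_coeff[of _ n]) (use \<gamma>[OF \<psi>] that in auto)
    have map\<Gamma>: "mpoly_map \<chi> (\<Gamma> j) u = \<gamma> \<psi> j u \<otimes>\<^bsub>k\<^esub> \<chi> e [^]\<^bsub>k\<^esub> (size u - 1)" if "\<chi> \<in> A" "j < n" for \<chi> j and u :: "nat multiset"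
    proof -
      interpret \<chi>: ring_hom_cring R k \<chi> by (rule hom[OF that(1)])
      show ?thesis
        using \<gamma>c[OF that(2), of u] e(1) point[OF that(1) \<gamma>c[OF that(2), of u]] \<chi>.hom_pow[OF e(1), of "size u - 1"]
        by (simp add: mpoly_map_apply \<Gamma>_def)
    qed
    have at_\<psi>: "mpoly_map \<psi> (\<Gamma> j) = \<gamma> \<psi> j" if "j < n" for j
    proof
      fix u :: "nat multiset"
      show "mpoly_map \<psi> (\<Gamma> j) u = \<gamma> \<psi> j u"
        using map\<Gamma>[OF \<psi> that, of u] e(2) \<gamma>c[OF that, of u] by simp
    qed
    \<comment> \<open>For \<open>\<chi> e = 0\<close> the power with exponent
      \<open>size u - 1\<close> is one in degrees zero and one, and zero above. As
      \<open>\<gamma> \<psi>\<close> has no constant term, its linear part remains, which is the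
      identity by \<open>\<gamma>1\<close>.\<close>
    have off_\<psi>: "mpoly_map \<chi> (\<Gamma> j) = k.indexed_var j" if \<chi>: "\<chi> \<in> A" "\<chi> \<noteq> \<psi>" and j: "j < n" for \<chi> j
    proof
      fix u :: "nat multiset"
      have e0: "\<chi> e = \<zero>\<^bsub>k\<^esub>" using e(3) \<chi> by blast
      have gp: "\<gamma> \<psi> j \<in> mpolys k n" using \<gamma>[OF \<psi>] j by auto
      consider "u = {#}" | s where "u = {#s#}" | "size u \<ge> 2"
      proof (cases u)
        case (add s v)
        then show ?thesis using that by (cases v) auto
      qed (use that in auto)
      then show "mpoly_map \<chi> (\<Gamma> j) u = k.indexed_var j u"
      proof cases
        case 1
        then show ?thesis using map\<Gamma>[OF \<chi>(1) j, of u] \<gamma>0[OF \<psi> j] by (simp add: k.var_coeff)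
      next
        case 2
        have "\<gamma> \<psi> j {#s#} = (if s = j then \<one>\<^bsub>k\<^esub> else \<zero>\<^bsub>k\<^esub>)"
        proof (cases "s < n")
          case True
          then show ?thesis using \<gamma>1[OF \<psi> j True] by auto
        next
          case False
          then have "\<gamma> \<psi> j {#s#} = \<zero>\<^bsub>k\<^esub>" using k.polys_support[OF k.mpolysD[OF gp], of "{#s#}"] by auto
          then show ?thesis using False j by auto
        qed
        then show ?thesis using 2 map\<Gamma>[OF \<chi>(1) j, of u] \<gamma>c[OF j, of u] by (simp add: k.var_coeff)
      next
        case 3
        then have "\<chi> e [^]\<^bsub>k\<^esub> (size u - 1) = \<zero>\<^bsub>k\<^esub>" using e0 by (simp add: k.nat_pow_zero)
        moreover have "k.indexed_var j u = \<zero>\<^bsub>k\<^esub>"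
        proof -
          have "u - {#j#} \<noteq> {#}" if "j \<in># u"
          proof
            assume "u - {#j#} = {#}"
            then have "u = {#j#}" using that by (metis insert_DiffM)
            then show False using 3 by simp
          qed
          then show ?thesis by (auto simp: k.indexed_var_def k.indexed_pmult_def k.indexed_const_def)
        qed
        ultimately show ?thesis using map\<Gamma>[OF \<chi>(1) j, of u] \<gamma>c[OF j, of u] by simp
      qed
    qed
    \<comment> \<open>The inverse of a composite is formed in the opposite order.\<close>
    define Y' where "Y' j = mpoly_subst R n \<Gamma> (Y j)" for j
    define N'' where "N'' j = mpoly_subst R n N (N' j)" for j
    have Y': "Y' \<in> {..<n} \<rightarrow> mpolys R n" using R.subst_closed[OF \<Gamma> Yj(1)] by (simp add: Y'_def)
    have N'j: "N' j \<in> mpolys R n" if "j < n" for j using N' that by auto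
    have N'': "N'' \<in> {..<n} \<rightarrow> mpolys R n" using R.subst_closed[OF N N'j] by (simp add: N''_def)
    have inv: "mpoly_subst R n Y' (N'' j) = R.indexed_var j" if j: "j < n" for j
    proof -
      have N''j: "N'' j \<in> mpolys R n" using N'' j by auto
      have "mpoly_subst R n Y' (N'' j) = mpoly_subst R n \<Gamma> (mpoly_subst R n Y (N'' j))"
        unfolding Y'_def by (rule R.subst_subst[OF Y \<Gamma> N''j, symmetric])
      also have "mpoly_subst R n Y (N'' j) = mpoly_subst R n (\<lambda>i. mpoly_subst R n Y (N i)) (N' j)"
        unfolding N''_def by (rule R.subst_subst[OF N Y N'j[OF j]])
      also have "\<dots> = mpoly_subst R n R.indexed_var (N' j)"
        by (rule R.subst_cong[OF _ N'j[OF j] YN]) (use R.subst_closed[OF Y Yj(2)] in auto)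
      also have "\<dots> = N' j" by (rule R.subst_var_id[OF R.mpolysD[OF N'j[OF j]]])
      finally show ?thesis using \<Gamma>N[OF j] by simp
    qed
    have val': "mpoly_map \<chi> (Y' j) = (if \<chi> \<in> insert \<psi> B then \<gamma> \<chi> j else k.indexed_var j)" if \<chi>: "\<chi> \<in> A" and j: "j < n" for \<chi> j
    proof -
      interpret \<chi>: ring_hom_cring R k \<chi> by (rule hom[OF \<chi>])
      have m\<Gamma>: "(\<lambda>i. mpoly_map \<chi> (\<Gamma> i)) \<in> {..<n} \<rightarrow> mpolys k n"
        using \<Gamma> by (auto intro!: \<chi>.map_closed)
      have eq: "mpoly_map \<chi> (Y' j) = mpoly_subst k n (\<lambda>i. mpoly_map \<chi> (\<Gamma> i)) (mpoly_map \<chi> (Y j))"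
        unfolding Y'_def by (rule \<chi>.map_subst[OF \<Gamma> Yj(1)[OF j]])
      show ?thesis
      proof (cases "\<chi> = \<psi>")
        case True
        then have "mpoly_map \<chi> (Y j) = k.indexed_var j" using val[OF \<chi> j] insert.hyps by simp
        then have "mpoly_map \<chi> (Y' j) = mpoly_map \<chi> (\<Gamma> j)"
          unfolding eq using k.subst_var[OF m\<Gamma> j] by simp
        then show ?thesis using True at_\<psi>[OF j] by simp
      next
        case False
        have mY: "mpoly_map \<chi> (Y j) \<in> mpolys k n" by (rule \<chi>.map_closed[OF Yj(1)[OF j]])
        have "mpoly_map \<chi> (Y' j) = mpoly_subst k n k.indexed_var (mpoly_map \<chi> (Y j))"
          unfolding eq by (rule k.subst_cong[OF m\<Gamma> mY]) (rule off_\<psi>[OF \<chi> False])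
        also have "\<dots> = mpoly_map \<chi> (Y j)" by (rule k.subst_var_id[OF k.mpolysD[OF mY]])
        finally show ?thesis using val[OF \<chi> j] False by simp
      qed
    qed
    have "good (insert \<psi> B) Y' N''" using Y' N'' inv val' unfolding good_def by blast
    then show ?case by blast
  qed
  then obtain Y N where "good A Y N" using fin by blast
  then show thesis using that[of Y N] unfolding good_def by simp
qed

text \<open>At each point \<open>P\<close> is affine in the system \<open>\<gamma>\<close>.
  Interpolation gives one system \<open>Y\<close> over \<open>R\<close> in which \<open>P\<close> is
  affine up to coefficients that vanish at all points and so are nilpotent modulo \<open>a\<close>.
  The form required by \<open>solve_mod\<close> is reached by undoing \<open>Y\<close> and by a
  shear, and the result is carried back along both.\<close>

lemma coordinate_of_points:
  assumes nil: "\<And>y. y \<in> carrier R \<Longrightarrow> (\<And>\<chi>. \<chi> \<in> A \<Longrightarrow> \<chi> y = \<zero>\<^bsub>k\<^esub>) \<Longrightarrow> \<exists>N::nat. y [^]\<^bsub>R\<^esub> N \<in> PIdl\<^bsub>R\<^esub> a"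
    and a: "non_zerodivisor R a" and n: "0 < n" and P: "P \<in> mpolys R n"
    and coord: "\<And>\<chi>. \<chi> \<in> A \<Longrightarrow> \<exists>g h. g \<in> {..<n} \<rightarrow> mpolys k n \<and> h \<in> {..<n} \<rightarrow> mpolys k n \<and>
      g 0 = mpoly_map \<chi> P \<and> (\<forall>j<n. mpoly_subst k n g (h j) = k.indexed_var j)"
  shows "is_coordinate R (n + 1) (R.indexed_const a \<otimes>\<^bsub>mpoly_ring R (n + 1)\<^esub> R.indexed_var n \<oplus>\<^bsub>mpoly_ring R (n + 1)\<^esub> P)"
proof -
  have aR: "a \<in> carrier R" using a unfolding non_zerodivisor_def by blast
  \<comment> \<open>Collects the data at one point, so that they can be chosen simultaneously for
    all points.\<close>
  define D where "D \<chi> p l \<gamma> \<eta> \<longleftrightarrow> p \<in> carrier k \<and> (\<forall>t. l t \<in> carrier k) \<and> (\<exists>t<n. l t \<noteq> \<zero>\<^bsub>k\<^esub>) \<and>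
      \<gamma> \<in> {..<n} \<rightarrow> mpolys k n \<and> \<eta> \<in> {..<n} \<rightarrow> mpolys k n \<and> (\<forall>j<n. \<gamma> j {#} = \<zero>\<^bsub>k\<^esub>) \<and> (\<forall>j<n. \<eta> j {#} = \<zero>\<^bsub>k\<^esub>) \<and>
      (\<forall>j<n. \<forall>s<n. \<gamma> j {#s#} = (if j = s then \<one>\<^bsub>k\<^esub> else \<zero>\<^bsub>k\<^esub>)) \<and>
      (\<forall>j<n. mpoly_subst k n \<gamma> (\<eta> j) = k.indexed_var j) \<and>
      mpoly_map \<chi> P = k.indexed_const p \<oplus>\<^bsub>mpoly_ring k n\<^esub> lincomb k n l \<gamma>" for \<chi> p l \<gamma> \<eta>
  have "\<exists>p l \<gamma> \<eta>. D \<chi> p l \<gamma> \<eta>" if \<chi>: "\<chi> \<in> A" for \<chi>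
  proof -
    obtain g h where gh: "g \<in> {..<n} \<rightarrow> mpolys k n" "h \<in> {..<n} \<rightarrow> mpolys k n" "g 0 = mpoly_map \<chi> P"
      "\<forall>j<n. mpoly_subst k n g (h j) = k.indexed_var j"
      using coord[OF \<chi>] by (elim exE conjE) (rule that)
    obtain p l \<gamma> \<eta> where nc: "p \<in> carrier k" "\<And>t. l t \<in> carrier k" "\<exists>t<n. l t \<noteq> \<zero>\<^bsub>k\<^esub>"
      "\<gamma> \<in> {..<n} \<rightarrow> mpolys k n" "\<eta> \<in> {..<n} \<rightarrow> mpolys k n"
      "\<And>j. j < n \<Longrightarrow> \<gamma> j {#} = \<zero>\<^bsub>k\<^esub>" "\<And>j. j < n \<Longrightarrow> \<eta> j {#} = \<zero>\<^bsub>k\<^esub>"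
      "\<And>j s. j < n \<Longrightarrow> s < n \<Longrightarrow> \<gamma> j {#s#} = (if j = s then \<one>\<^bsub>k\<^esub> else \<zero>\<^bsub>k\<^esub>)"
      "\<And>j. j < n \<Longrightarrow> mpoly_subst k n \<gamma> (\<eta> j) = k.indexed_var j"
      "g 0 = k.indexed_const p \<oplus>\<^bsub>mpoly_ring k n\<^esub> lincomb k n l \<gamma>"
      by (rule k.normalise_coordinates[OF gh(1,2) gh(4)[rule_format] n]; (assumption | rule that))
    have "D \<chi> p l \<gamma> \<eta>"
      unfolding D_def gh(3)[symmetric] by (intro conjI allI impI nc)
    then show ?thesis by blast
  qed
  then obtain p l \<gamma> \<eta> where D: "\<And>\<chi>. \<chi> \<in> A \<Longrightarrow> D \<chi> (p \<chi>) (l \<chi>) (\<gamma> \<chi>) (\<eta> \<chi>)" by metis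
  have p: "p \<chi> \<in> carrier k" and l: "\<And>t. l \<chi> t \<in> carrier k" and l_nz: "\<exists>t<n. l \<chi> t \<noteq> \<zero>\<^bsub>k\<^esub>"
    and \<gamma>: "\<gamma> \<chi> \<in> {..<n} \<rightarrow> mpolys k n" and \<eta>: "\<eta> \<chi> \<in> {..<n} \<rightarrow> mpolys k n"
    and \<gamma>0: "\<And>j. j < n \<Longrightarrow> \<gamma> \<chi> j {#} = \<zero>\<^bsub>k\<^esub>" and \<eta>0: "\<And>j. j < n \<Longrightarrow> \<eta> \<chi> j {#} = \<zero>\<^bsub>k\<^esub>"
    and \<gamma>1: "\<And>j s. j < n \<Longrightarrow> s < n \<Longrightarrow> \<gamma> \<chi> j {#s#} = (if j = s then \<one>\<^bsub>k\<^esub> else \<zero>\<^bsub>k\<^esub>)"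
    and \<gamma>\<eta>: "\<And>j. j < n \<Longrightarrow> mpoly_subst k n (\<gamma> \<chi>) (\<eta> \<chi> j) = k.indexed_var j"
    and mP: "mpoly_map \<chi> P = k.indexed_const (p \<chi>) \<oplus>\<^bsub>mpoly_ring k n\<^esub> lincomb k n (l \<chi>) (\<gamma> \<chi>)"
    if "\<chi> \<in> A" for \<chi>
    using D[OF that] unfolding D_def by blast+
  obtain Y N where Y: "Y \<in> {..<n} \<rightarrow> mpolys R n" and N: "N \<in> {..<n} \<rightarrow> mpolys R n"
    and YN: "\<And>j. j < n \<Longrightarrow> mpoly_subst R n Y (N j) = R.indexed_var j"
    and mY: "\<And>\<chi> j. \<chi> \<in> A \<Longrightarrow> j < n \<Longrightarrow> mpoly_map \<chi> (Y j) = \<gamma> \<chi> j"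
    by (rule interpolate_coordinates[of \<gamma> n \<eta>, OF \<gamma> \<eta> \<gamma>0 \<eta>0 \<gamma>1 \<gamma>\<eta>]; (assumption | rule that))
  obtain p0 where p0: "p0 \<in> carrier R" "\<And>\<chi>. \<chi> \<in> A \<Longrightarrow> \<chi> p0 = p \<chi>"
    by (rule interpolate[of p, OF p]; (assumption | rule that))
  have "\<exists>r\<in>carrier R. \<forall>\<chi>\<in>A. \<chi> r = l \<chi> t" for t
  proof (rule interpolate[of "\<lambda>\<chi>. l \<chi> t"])
    show "l \<chi> t \<in> carrier k" if "\<chi> \<in> A" for \<chi> by (rule l[OF that])
  qed blast
  then obtain r where r: "\<And>t. r t \<in> carrier R" "\<And>\<chi> t. \<chi> \<in> A \<Longrightarrow> \<chi> (r t) = l \<chi> t" by metis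
  define t0 where "t0 \<chi> = (SOME t. t < n \<and> l \<chi> t \<noteq> \<zero>\<^bsub>k\<^esub>)" for \<chi>
  have t0: "t0 \<chi> < n" "l \<chi> (t0 \<chi>) \<noteq> \<zero>\<^bsub>k\<^esub>" if "\<chi> \<in> A" for \<chi>
    using someI_ex[OF l_nz[OF that]] by (simp_all add: t0_def)
  \<comment> \<open>Where the coefficient of the variable \<open>0\<close> vanishes, the shear adds
    to it the coefficient at \<open>t0\<close>, which is non-zero; elsewhere it is trivial.\<close>
  define sv where "sv \<chi> t = (if l \<chi> 0 = \<zero>\<^bsub>k\<^esub> \<and> t0 \<chi> = t then \<one>\<^bsub>k\<^esub> else \<zero>\<^bsub>k\<^esub>)" for \<chi> t
  \<comment> \<open>The element \<open>s 0\<close> has to be zero in \<open>R\<close> and not merely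
    at the points, so that the shear fixes the variable \<open>0\<close> and
    \<open>\<theta>'\<close> is its inverse.\<close>
  have "\<exists>s\<in>carrier R. (\<forall>\<chi>\<in>A. \<chi> s = sv \<chi> t) \<and> (t = 0 \<longrightarrow> s = \<zero>\<^bsub>R\<^esub>)" for t
  proof (cases "t = 0")
    case True
    have "sv \<chi> 0 = \<zero>\<^bsub>k\<^esub>" if "\<chi> \<in> A" for \<chi> using t0(2)[OF that] unfolding sv_def by metis
    then show ?thesis
      using True ring_hom_cring.hom_zero[OF hom] by (intro bexI[of _ "\<zero>\<^bsub>R\<^esub>"]) auto
  next
    case False
    have sv: "sv \<chi> t \<in> carrier k" for \<chi> by (simp add: sv_def)
    show ?thesis by (rule interpolate[of "\<lambda>\<chi>. sv \<chi> t", OF sv]) (use False in blast)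
  qed
  then obtain s where s: "\<And>t. s t \<in> carrier R" "\<And>\<chi> t. \<chi> \<in> A \<Longrightarrow> \<chi> (s t) = sv \<chi> t" "s 0 = \<zero>\<^bsub>R\<^esub>" by metis
  define M where "M = mpoly_ring R n"
  interpret M: cring M unfolding M_def by (rule R.cring_mpoly_ring)
  define co where "co = (R.indexed_const :: 'a \<Rightarrow> nat multiset \<Rightarrow> 'a)"
  interpret co: ring_hom_cring R M co unfolding M_def co_def by (rule R.const_hom)
  define x where "x = (R.indexed_var :: nat \<Rightarrow> nat multiset \<Rightarrow> 'a)"
  have x: "x i \<in> carrier M" if "i < n" for i unfolding x_def M_def by (rule R.mpoly_var_closed[OF that])
  have xf: "x \<in> {..<n} \<rightarrow> mpolys R n" using x by (auto simp: M_def)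
  have PM: "P \<in> carrier M" using P by (simp add: M_def)
  \<comment> \<open>The affine model of \<open>P\<close>. The remainder \<open>N0\<close> vanishes
    at every point, so by \<open>nil\<close> its coefficients are nilpotent modulo
    \<open>a\<close>.\<close>
  define L where "L = co p0 \<oplus>\<^bsub>M\<^esub> lincomb R n r Y"
  have rY: "lincomb R n r Y \<in> carrier M" unfolding M_def by (rule R.lincomb_closed[OF r(1) Y])
  have L: "L \<in> carrier M" using p0(1) rY by (simp add: L_def)
  define N0 where "N0 = P \<ominus>\<^bsub>M\<^esub> L"
  have N0: "N0 \<in> carrier M" using PM L by (simp add: N0_def)
  have N0R: "N0 \<in> mpolys R n" using N0 by (simp add: M_def)
  have nilc: "\<exists>j::nat. N0 u [^]\<^bsub>R\<^esub> j \<in> PIdl\<^bsub>R\<^esub> a" for u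
  proof (rule nil[OF R.mpolys_coeff[OF N0R]])
    fix \<chi> assume \<chi>: "\<chi> \<in> A"
    interpret \<chi>: ring_hom_cring R k \<chi> by (rule hom[OF \<chi>])
    interpret H: ring_hom_cring M "mpoly_ring k n" "mpoly_map \<chi>" unfolding M_def by (rule \<chi>.map_hom_cring)
    have "mpoly_map \<chi> (lincomb R n r Y) = lincomb k n (\<lambda>t. \<chi> (r t)) (\<lambda>t. mpoly_map \<chi> (Y t))"
      by (rule \<chi>.map_lincomb[OF r(1) Y])
    also have "(\<lambda>t. \<chi> (r t)) = l \<chi>" using r(2)[OF \<chi>] by blast
    also have "lincomb k n (l \<chi>) (\<lambda>t. mpoly_map \<chi> (Y t)) = lincomb k n (l \<chi>) (\<gamma> \<chi>)"
      by (rule k.lincomb_cong[OF l[OF \<chi>] \<gamma>[OF \<chi>]]) (rule mY[OF \<chi>])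
    finally have 1: "mpoly_map \<chi> (lincomb R n r Y) = lincomb k n (l \<chi>) (\<gamma> \<chi>)" .
    have 2: "mpoly_map \<chi> (co p0) = k.indexed_const (p \<chi>)"
      unfolding co_def \<chi>.map_const[OF p0(1)] p0(2)[OF \<chi>] by (rule refl)
    have "mpoly_map \<chi> L = mpoly_map \<chi> P"
      unfolding L_def mP[OF \<chi>] H.hom_add[OF co.hom_closed[OF p0(1)] rY] 1 2 by (rule refl)
    then have "mpoly_map \<chi> N0 = \<zero>\<^bsub>mpoly_ring k n\<^esub>"
      unfolding N0_def using PM L H.hom_closed[OF PM] by (simp add: M.minus_eq H.S.r_neg)
    then show "\<chi> (N0 u) = \<zero>\<^bsub>k\<^esub>"
      using fun_cong[of _ _ u] by (simp add: mpoly_map_def k.zero_coeff fun_eq_iff)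
  qed
  \<comment> \<open>As \<open>N\<close> inverts \<open>Y\<close>, the polynomial \<open>Pt\<close>,
    affine in the variables up to \<open>NN\<close>, is a preimage of \<open>P\<close> under
    \<open>Y\<close>.\<close>
  define NN where "NN = mpoly_subst R n N N0"
  have NN: "NN \<in> carrier M" unfolding NN_def M_def by (rule R.subst_closed[OF N N0R])
  define Pt where "Pt = co p0 \<oplus>\<^bsub>M\<^esub> lincomb R n r x \<oplus>\<^bsub>M\<^esub> NN"
  have rx: "lincomb R n r x \<in> carrier M" unfolding M_def by (rule R.lincomb_closed[OF r(1) xf])
  have Pt: "Pt \<in> carrier M" using p0(1) rx NN by (simp add: Pt_def)
  have YPt: "mpoly_subst R n Y Pt = P"
  proof -
    interpret S: ring_hom_cring M M "mpoly_subst R n Y" unfolding M_def by (rule R.subst_hom[OF Y])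
    have "mpoly_subst R n Y NN = mpoly_subst R n (\<lambda>i. mpoly_subst R n Y (N i)) N0"
      unfolding NN_def by (rule R.subst_subst[OF N Y N0R])
    also have "\<dots> = mpoly_subst R n R.indexed_var N0"
      by (rule R.subst_cong[OF _ N0R YN]) (use R.subst_closed[OF Y] N in auto)
    also have "\<dots> = N0" by (rule R.subst_var_id[OF R.mpolysD[OF N0R]])
    finally have 1: "mpoly_subst R n Y NN = N0" .
    have "mpoly_subst R n Y (lincomb R n r x) = lincomb R n r (\<lambda>t. mpoly_subst R n Y (x t))"
      by (rule R.subst_lincomb[OF r(1) xf Y])
    also have "\<dots> = lincomb R n r Y"
      by (rule R.lincomb_cong[OF r(1) Y]) (unfold x_def, rule R.subst_var[OF Y])
    finally have 2: "mpoly_subst R n Y (lincomb R n r x) = lincomb R n r Y" .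
    have 3: "mpoly_subst R n Y (co p0) = co p0" unfolding co_def by (rule R.subst_const[OF Y p0(1)])
    have "mpoly_subst R n Y Pt = L \<oplus>\<^bsub>M\<^esub> N0"
      unfolding Pt_def L_def using p0(1) rx NN 1 2 3 by simp
    then show ?thesis unfolding N0_def using M.add_minus_cancel[OF L PM] by simp
  qed
  have sx: "co (s t) \<otimes>\<^bsub>M\<^esub> x 0 \<in> carrier M" "co (\<ominus>\<^bsub>R\<^esub> s t) \<otimes>\<^bsub>M\<^esub> x 0 \<in> carrier M" for t
    using s(1) x[OF n] by simp_all
  define \<theta> where "\<theta> t = x t \<oplus>\<^bsub>M\<^esub> co (s t) \<otimes>\<^bsub>M\<^esub> x 0" for t
  define \<theta>' where "\<theta>' t = x t \<oplus>\<^bsub>M\<^esub> co (\<ominus>\<^bsub>R\<^esub> s t) \<otimes>\<^bsub>M\<^esub> x 0" for t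
  have \<theta>: "\<theta> \<in> {..<n} \<rightarrow> mpolys R n" using M.a_closed[OF x sx(1)] by (simp add: \<theta>_def M_def[symmetric])
  have \<theta>': "\<theta>' \<in> {..<n} \<rightarrow> mpolys R n" using M.a_closed[OF x sx(2)] by (simp add: \<theta>'_def M_def[symmetric])
  have \<theta>\<theta>: "mpoly_subst R n \<theta>' (\<theta> j) = R.indexed_var j" if j: "j < n" for j
  proof -
    interpret S: ring_hom_cring M M "mpoly_subst R n \<theta>'" unfolding M_def by (rule R.subst_hom[OF \<theta>'])
    have sv: "mpoly_subst R n \<theta>' (x i) = \<theta>' i" if "i < n" for i
      unfolding x_def by (rule R.subst_var[OF \<theta>' that])
    have sc: "mpoly_subst R n \<theta>' (co (s j)) = co (s j)" unfolding co_def by (rule R.subst_const[OF \<theta>' s(1)])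
    have "\<theta>' 0 = x 0" unfolding \<theta>'_def s(3) using x[OF n] by simp
    then have "mpoly_subst R n \<theta>' (\<theta> j) = \<theta>' j \<oplus>\<^bsub>M\<^esub> co (s j) \<otimes>\<^bsub>M\<^esub> x 0"
      unfolding \<theta>_def using x[OF j] sx s(1) x[OF n] sv[OF j] sv[OF n] sc by simp
    also have "\<dots> = x j"
    proof -
      have c: "co (s j) \<in> carrier M" using s(1) by simp
      have "co (\<ominus>\<^bsub>R\<^esub> s j) = \<ominus>\<^bsub>M\<^esub> co (s j)" using s(1) by simp
      then show ?thesis unfolding \<theta>'_def using x[OF j] x[OF n] c by (simp add: M.a_assoc M.l_minus M.l_neg)
    qed
    finally show ?thesis by (simp add: x_def)
  qed
  define Ph where "Ph = mpoly_subst R n \<theta> Pt"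
  have PtR: "Pt \<in> mpolys R n" using Pt by (simp add: M_def)
  have Ph: "Ph \<in> mpolys R n" unfolding Ph_def by (rule R.subst_closed[OF \<theta> PtR])
  have \<theta>Ph: "mpoly_subst R n \<theta>' Ph = Pt"
  proof -
    have "mpoly_subst R n \<theta>' Ph = mpoly_subst R n (\<lambda>i. mpoly_subst R n \<theta>' (\<theta> i)) Pt"
      unfolding Ph_def by (rule R.subst_subst[OF \<theta> \<theta>' PtR])
    also have "\<dots> = mpoly_subst R n R.indexed_var Pt"
      by (rule R.subst_cong[OF _ PtR \<theta>\<theta>]) (use R.subst_closed[OF \<theta>'] \<theta> in auto)
    also have "\<dots> = Pt" by (rule R.subst_var_id[OF R.mpolysD[OF PtR]])
    finally show ?thesis .
  qed
  define \<Sigma> where "\<Sigma> = (\<Oplus>\<^bsub>R\<^esub>t\<in>{..<n}. r t \<otimes>\<^bsub>R\<^esub> s t)"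
  have \<Sigma>: "\<Sigma> \<in> carrier R" unfolding \<Sigma>_def by (rule R.finsum_closed) (use r s in auto)
  define ll where "ll t = r t \<oplus>\<^bsub>R\<^esub> (if t = 0 then \<Sigma> else \<zero>\<^bsub>R\<^esub>)" for t
  have ll: "ll t \<in> carrier R" for t using r(1) \<Sigma> by (simp add: ll_def)
  define T where "T = {u. N0 u \<noteq> \<zero>\<^bsub>R\<^esub>}"
  have T: "finite T" unfolding T_def by (rule R.polys_finite_support[OF R.mpolysD[OF N0R]])
  \<comment> \<open>Substitutions fix constants: the monomials of \<open>N0\<close> are transformed,
    while its coefficients, nilpotent modulo \<open>a\<close>, stay in front.\<close>
  define mo where "mo u = mpoly_subst R n \<theta> (mpoly_subst R n N (mon_eval M x u))" for u
  have monM: "mon_eval M x u \<in> carrier M" if "u \<in> T" for u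
    using R.mon_eval_var_closed[OF N0R, of u] that by (simp add: T_def M_def x_def)
  have mo: "mo u \<in> mpolys R n" if "u \<in> T" for u
    unfolding mo_def
    by (rule R.subst_closed[OF \<theta> R.subst_closed[OF N]]) (use monM[OF that] in \<open>simp add: M_def\<close>)
  have N0c: "N0 u \<in> carrier R" for u by (rule R.mpolys_coeff[OF N0R])
  have \<theta>NN: "mpoly_subst R n \<theta> NN = (\<Oplus>\<^bsub>M\<^esub>t\<in>T. co (N0 t) \<otimes>\<^bsub>M\<^esub> mo t)"
  proof -
    interpret S: ring_hom_cring M M "mpoly_subst R n \<theta>" unfolding M_def by (rule R.subst_hom[OF \<theta>])
    interpret S': ring_hom_cring M M "mpoly_subst R n N" unfolding M_def by (rule R.subst_hom[OF N])
    have cN: "co (N0 t) \<in> carrier M" for t using N0c by simp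
    have exp: "N0 = (\<Oplus>\<^bsub>M\<^esub>u\<in>T. co (N0 u) \<otimes>\<^bsub>M\<^esub> mon_eval M x u)"
      using R.poly_expansion[OF N0R] by (simp only: T_def M_def co_def x_def)
    have S'c: "mpoly_subst R n N (co (N0 t)) = co (N0 t)" for t unfolding co_def by (rule R.subst_const[OF N N0c])
    have Sc: "mpoly_subst R n \<theta> (co (N0 t)) = co (N0 t)" for t unfolding co_def by (rule R.subst_const[OF \<theta> N0c])
    have "NN = mpoly_subst R n N (\<Oplus>\<^bsub>M\<^esub>u\<in>T. co (N0 u) \<otimes>\<^bsub>M\<^esub> mon_eval M x u)"
      unfolding NN_def by (subst exp) (rule refl)
    also have "\<dots> = (\<Oplus>\<^bsub>M\<^esub>u\<in>T. mpoly_subst R n N (co (N0 u)) \<otimes>\<^bsub>M\<^esub> mpoly_subst R n N (mon_eval M x u))"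
      by (rule S'.hom_lincomb[OF T]) (use cN monM in auto)
    finally have NNe: "NN = (\<Oplus>\<^bsub>M\<^esub>u\<in>T. co (N0 u) \<otimes>\<^bsub>M\<^esub> mpoly_subst R n N (mon_eval M x u))" by (simp only: S'c)
    have "mpoly_subst R n \<theta> NN = (\<Oplus>\<^bsub>M\<^esub>u\<in>T. mpoly_subst R n \<theta> (co (N0 u)) \<otimes>\<^bsub>M\<^esub> mpoly_subst R n \<theta> (mpoly_subst R n N (mon_eval M x u)))"
      unfolding NNe by (rule S.hom_lincomb[OF T]) (use cN monM S'.hom_closed in auto)
    then show ?thesis by (simp only: Sc mo_def)
  qed
  have Ph_eq: "Ph = R.indexed_const p0 \<oplus>\<^bsub>mpoly_ring R n\<^esub> lincomb R n ll R.indexed_var \<oplus>\<^bsub>mpoly_ring R n\<^esub>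
      (\<Oplus>\<^bsub>mpoly_ring R n\<^esub>t\<in>T. R.indexed_const (N0 t) \<otimes>\<^bsub>mpoly_ring R n\<^esub> mo t)"
  proof -
    interpret S: ring_hom_cring M M "mpoly_subst R n \<theta>" unfolding M_def by (rule R.subst_hom[OF \<theta>])
    have "mpoly_subst R n \<theta> (lincomb R n r x) = lincomb R n r (\<lambda>t. mpoly_subst R n \<theta> (x t))"
      by (rule R.subst_lincomb[OF r(1) xf \<theta>])
    also have "\<dots> = lincomb R n r \<theta>"
      by (rule R.lincomb_cong[OF r(1) \<theta>]) (unfold x_def, rule R.subst_var[OF \<theta>])
    also have "\<dots> = lincomb R n ll x"
      unfolding \<theta>_def ll_def \<Sigma>_def M_def co_def x_def by (rule R.shear_lincomb[OF r(1) s(1) n])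
    finally have 1: "mpoly_subst R n \<theta> (lincomb R n r x) = lincomb R n ll x" .
    have 2: "mpoly_subst R n \<theta> (co p0) = co p0" unfolding co_def by (rule R.subst_const[OF \<theta> p0(1)])
    have "Ph = co p0 \<oplus>\<^bsub>M\<^esub> lincomb R n ll x \<oplus>\<^bsub>M\<^esub> mpoly_subst R n \<theta> NN"
      unfolding Ph_def Pt_def using p0(1) rx NN 1 2 by simp
    then show ?thesis unfolding \<theta>NN by (simp only: M_def co_def x_def)
  qed
  \<comment> \<open>By the choice of \<open>sv\<close>, the value is \<open>l \<chi> 0\<close> or,
    if this is zero, the coefficient at \<open>t0 \<chi>\<close>.\<close>
  have unit: "\<chi> (ll 0) \<noteq> \<zero>\<^bsub>k\<^esub>" if \<chi>: "\<chi> \<in> A" for \<chi>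
  proof -
    interpret \<chi>: ring_hom_cring R k \<chi> by (rule hom[OF \<chi>])
    have "\<chi> \<Sigma> = (\<Oplus>\<^bsub>k\<^esub>t\<in>{..<n}. \<chi> (r t) \<otimes>\<^bsub>k\<^esub> \<chi> (s t))"
      unfolding \<Sigma>_def by (rule \<chi>.hom_lincomb) (use r s in auto)
    also have "\<dots> = (\<Oplus>\<^bsub>k\<^esub>t\<in>{..<n}. if t0 \<chi> = t then (if l \<chi> 0 = \<zero>\<^bsub>k\<^esub> then l \<chi> t else \<zero>\<^bsub>k\<^esub>) else \<zero>\<^bsub>k\<^esub>)"
      by (rule k.finsum_cong') (use l[OF \<chi>] r(2)[OF \<chi>] s(2)[OF \<chi>] in \<open>auto simp: sv_def\<close>)
    also have "\<dots> = (if l \<chi> 0 = \<zero>\<^bsub>k\<^esub> then l \<chi> (t0 \<chi>) else \<zero>\<^bsub>k\<^esub>)"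
      by (rule k.finsum_singleton) (use t0(1)[OF \<chi>] l[OF \<chi>] in auto)
    finally have "\<chi> (ll 0) = l \<chi> 0 \<oplus>\<^bsub>k\<^esub> (if l \<chi> 0 = \<zero>\<^bsub>k\<^esub> then l \<chi> (t0 \<chi>) else \<zero>\<^bsub>k\<^esub>)"
      using r \<Sigma> \<chi> by (simp add: ll_def)
    then show ?thesis using t0(2)[OF \<chi>] l[OF \<chi>] by (auto split: if_splits)
  qed
  obtain v where v: "v \<in> carrier R" "\<And>\<chi>. \<chi> \<in> A \<Longrightarrow> \<chi> v = inv\<^bsub>k\<^esub> (\<chi> (ll 0))"
  proof (rule interpolate[of "\<lambda>\<chi>. inv\<^bsub>k\<^esub> (\<chi> (ll 0))"])
    fix \<chi> assume \<chi>: "\<chi> \<in> A"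
    have "\<chi> (ll 0) \<in> carrier k" by (rule ring_hom_closed[OF ring_hom_cring.homh[OF hom[OF \<chi>]] ll])
    then have "\<chi> (ll 0) \<in> Units k" using unit[OF \<chi>] by (simp add: k.field_Units)
    then show "inv\<^bsub>k\<^esub> (\<chi> (ll 0)) \<in> carrier k" by simp
  qed (rule that)
  \<comment> \<open>The interpolated inverse is exact only at the points: \<open>w\<close> is one
    there, so \<open>1 - w\<close> is nilpotent modulo \<open>a\<close>, and
    \<open>unit_mod_nilpotent\<close> corrects \<open>v\<close> by a factor
    \<open>y\<close>.\<close>
  define w where "w = ll 0 \<otimes>\<^bsub>R\<^esub> v"
  have w: "w \<in> carrier R" using ll v(1) by (simp add: w_def)
  have "\<exists>j::nat. (\<one>\<^bsub>R\<^esub> \<ominus>\<^bsub>R\<^esub> w) [^]\<^bsub>R\<^esub> j \<in> PIdl\<^bsub>R\<^esub> a"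
  proof (rule nil)
    show "\<one>\<^bsub>R\<^esub> \<ominus>\<^bsub>R\<^esub> w \<in> carrier R" using w by simp
    fix \<chi> assume \<chi>: "\<chi> \<in> A"
    interpret \<chi>: ring_hom_cring R k \<chi> by (rule hom[OF \<chi>])
    have "\<chi> (ll 0) \<in> Units k" using unit[OF \<chi>] ll by (simp add: k.field_Units)
    then have "\<chi> w = \<one>\<^bsub>k\<^esub>"
      unfolding w_def \<chi>.hom_mult[OF ll v(1)] v(2)[OF \<chi>] by (rule k.Units_r_inv)
    then show "\<chi> (\<one>\<^bsub>R\<^esub> \<ominus>\<^bsub>R\<^esub> w) = \<zero>\<^bsub>k\<^esub>" using w by (simp add: R.minus_eq k.r_neg)
  qed
  then obtain j :: nat where "(\<one>\<^bsub>R\<^esub> \<ominus>\<^bsub>R\<^esub> w) [^]\<^bsub>R\<^esub> j \<in> PIdl\<^bsub>R\<^esub> a" by blast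
  then obtain z where z: "z \<in> carrier R" "(\<one>\<^bsub>R\<^esub> \<ominus>\<^bsub>R\<^esub> w) [^]\<^bsub>R\<^esub> j = z \<otimes>\<^bsub>R\<^esub> a" unfolding cgenideal_def by blast
  obtain y where y: "y \<in> carrier R" "w \<otimes>\<^bsub>R\<^esub> y = \<one>\<^bsub>R\<^esub> \<ominus>\<^bsub>R\<^esub> (\<one>\<^bsub>R\<^esub> \<ominus>\<^bsub>R\<^esub> w) [^]\<^bsub>R\<^esub> j"
    using R.unit_mod_nilpotent[OF w] by blast
  have vy: "ll 0 \<otimes>\<^bsub>R\<^esub> (v \<otimes>\<^bsub>R\<^esub> y) = \<one>\<^bsub>R\<^esub> \<oplus>\<^bsub>R\<^esub> a \<otimes>\<^bsub>R\<^esub> (\<ominus>\<^bsub>R\<^esub> z)"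
  proof -
    have "ll 0 \<otimes>\<^bsub>R\<^esub> (v \<otimes>\<^bsub>R\<^esub> y) = w \<otimes>\<^bsub>R\<^esub> y" using ll v(1) y(1) by (simp add: w_def R.m_assoc)
    then show ?thesis unfolding y(2) z(2) using z(1) aR by (simp add: R.minus_eq R.r_minus R.m_comm)
  qed
  have vyR: "v \<otimes>\<^bsub>R\<^esub> y \<in> carrier R" "\<ominus>\<^bsub>R\<^esub> z \<in> carrier R" using v(1) y(1) z(1) by simp_all
  obtain h Q Q' where hQ: "h \<in> mpolys R n" "Q \<in> mpolys R n" "Q' \<in> mpolys R n"
    "mpoly_subst R n (R.indexed_var(0 := h)) Ph = R.indexed_var 0 \<oplus>\<^bsub>mpoly_ring R n\<^esub> R.indexed_const a \<otimes>\<^bsub>mpoly_ring R n\<^esub> Q"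
    "mpoly_subst R n (R.indexed_var(0 := Ph)) h = R.indexed_var 0 \<oplus>\<^bsub>mpoly_ring R n\<^esub> R.indexed_const a \<otimes>\<^bsub>mpoly_ring R n\<^esub> Q'"
    by (rule R.solve_mod[where l = ll and m = mo and T = T and c = N0, OF aR vyR ll vy p0(1) T N0c mo nilc n Ph_eq]; (assumption | rule that))
  have "is_coordinate R (n + 1) (R.indexed_const a \<otimes>\<^bsub>mpoly_ring R (n + 1)\<^esub> R.indexed_var n \<oplus>\<^bsub>mpoly_ring R (n + 1)\<^esub> Ph)"
    by (rule R.coordinate_of_inverse_mod[OF a n Ph hQ])
  \<comment> \<open>The inverse shear takes \<open>Ph\<close> to \<open>Pt\<close>, and then
    \<open>Y\<close> takes \<open>Pt\<close> to \<open>P\<close>.\<close>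
  then have "is_coordinate R (n + 1) (R.indexed_const a \<otimes>\<^bsub>mpoly_ring R (n + 1)\<^esub> R.indexed_var n
      \<oplus>\<^bsub>mpoly_ring R (n + 1)\<^esub> mpoly_subst R n \<theta>' Ph)"
    by (rule R.coordinate_image_lift[OF _ aR Ph \<theta>' \<theta> \<theta>\<theta>])
  then have "is_coordinate R (n + 1) (R.indexed_const a \<otimes>\<^bsub>mpoly_ring R (n + 1)\<^esub> R.indexed_var n
      \<oplus>\<^bsub>mpoly_ring R (n + 1)\<^esub> mpoly_subst R n Y Pt)"
    unfolding \<theta>Ph by (rule R.coordinate_image_lift[OF _ aR PtR Y N YN])
  then show ?thesis unfolding YPt .
qed

end

section \<open>Specialisation of coordinates modulo \<open>a\<close> to the points\<close>

theorem theorem3p2: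
  fixes k :: "('k, 'c) ring_scheme"
    and R :: "('k, 'a, 'b) module_scheme"
    and n :: nat
    and a :: 'a
    and P :: "nat multiset \<Rightarrow> 'a"
  assumes "algebraically_closed k"
    and "fin_gen_algebra k R"
    and "krull_dim R = 1"
    and "n \<ge> 1"
    and "non_zerodivisor R a"
    and "P \<in> carrier (mpoly_ring R n)"
    and "is_coordinate (R Quot (PIdl\<^bsub>R\<^esub> a)) n (mpoly_image R (PIdl\<^bsub>R\<^esub> a) P)"
    and "seminormal_ring (red_ring R) \<or> ring_char k = 0"
  shows "is_coordinate R (n + 1)
    (ring.indexed_const R a \<otimes>\<^bsub>mpoly_ring R (n + 1)\<^esub> ring.indexed_var R n
      \<oplus>\<^bsub>mpoly_ring R (n + 1)\<^esub> P)"
proof -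
  interpret k: algebraically_closed k by fact
  have alg: "algebra k R" using assms(2) by (simp add: fin_gen_algebra_def)
  interpret R: cring R by (rule algebra.M_cring[OF alg])
  have aR: "a \<in> carrier R" using assms(5) unfolding non_zerodivisor_def by blast
  obtain A :: "('a \<Rightarrow> 'k) set" where A: "finite A"
    "\<And>\<chi>. \<chi> \<in> A \<Longrightarrow> alg_point k R \<chi> \<and> \<chi> a = \<zero>\<^bsub>k\<^esub>"
    "\<And>\<chi>. \<chi> \<in> A \<Longrightarrow> \<exists>e\<in>carrier R. \<chi> e = \<one>\<^bsub>k\<^esub> \<and> (\<forall>\<chi>'\<in>A - {\<chi>}. \<chi>' e = \<zero>\<^bsub>k\<^esub>)"
    "\<And>x. x \<in> carrier R \<Longrightarrow> (\<And>\<chi>. \<chi> \<in> A \<Longrightarrow> \<chi> x = \<zero>\<^bsub>k\<^esub>) \<Longrightarrow> \<exists>N::nat. x [^]\<^bsub>R\<^esub> N \<in> PIdl\<^bsub>R\<^esub> a"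
    by (rule ex_finite_points[OF assms(1,2,3,5)]) blast
  have "separated_points k R (\<lambda>c. c \<odot>\<^bsub>R\<^esub> \<one>\<^bsub>R\<^esub>) A"
  proof (intro separated_points.intro separated_points_axioms.intro)
    show "field k" by (rule k.field_axioms)
    show "cring R" by (rule R.is_cring)
    show "ring_hom_cring k R (\<lambda>c. c \<odot>\<^bsub>R\<^esub> \<one>\<^bsub>R\<^esub>)"
      by unfold_locales (rule algebra.scalar_hom[OF alg])
    show "finite A" by fact
    show "ring_hom_cring R k \<chi>" if "\<chi> \<in> A" for \<chi>
      by unfold_locales (use A(2)[OF that] in \<open>simp add: alg_point_def\<close>)
    show "\<chi> (c \<odot>\<^bsub>R\<^esub> \<one>\<^bsub>R\<^esub>) = c" if "\<chi> \<in> A" "c \<in> carrier k" for \<chi> c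
      using A(2)[OF that(1)] that(2) by (simp add: alg_point_def)
  qed (rule A(3))
  then interpret separated_points k R "\<lambda>c. c \<odot>\<^bsub>R\<^esub> \<one>\<^bsub>R\<^esub>" A .
  define I where "I = PIdl\<^bsub>R\<^esub> a"
  interpret I: ideal I R unfolding I_def by (rule R.cgenideal_ideal[OF aR])
  define S where "S = R Quot I"
  interpret \<pi>: ring_hom_cring R S "(+>\<^bsub>R\<^esub>) I" unfolding S_def by (rule I.rcos_ring_hom_cring[OF R.is_cring])
  have coordS: "is_coordinate S n (mpoly_map ((+>\<^bsub>R\<^esub>) I) P)"
    using assms(7) by (simp add: S_def I_def mpoly_image_def mpoly_map_def)
  obtain g h where gh: "g \<in> {..<n} \<rightarrow> mpolys S n" "h \<in> {..<n} \<rightarrow> mpolys S n" "g 0 = mpoly_map ((+>\<^bsub>R\<^esub>) I) P"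
    "\<And>j. j < n \<Longrightarrow> mpoly_subst S n g (h j) = ring.indexed_var S j"
    by (rule \<pi>.S.coordinate_system[OF coordS]; (assumption | rule that))
  \<comment> \<open>The projection is onto, so the image ring in \<open>factor_hom\<close> is the
    record \<open>S\<close> itself.\<close>
  have surj: "S\<lparr>carrier := (+>\<^bsub>R\<^esub>) I ` carrier R\<rparr> = S"
  proof -
    have "carrier S = (+>\<^bsub>R\<^esub>) I ` carrier R"
      unfolding S_def FactRing_def A_RCOSETS_def' partial_object.simps by blast
    then show ?thesis by (metis partial_object.surjective partial_object.update_convs(1))
  qed
  \<comment> \<open>Every point in \<open>A\<close> kills \<open>a\<close> and so factors through
    \<open>R/a\<close>; a coordinate system over \<open>R/a\<close> and its inverse are then mapped
    coefficientwise to \<open>k\<close>.\<close>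
  have "\<exists>g h. g \<in> {..<n} \<rightarrow> mpolys k n \<and> h \<in> {..<n} \<rightarrow> mpolys k n \<and>
      g 0 = mpoly_map \<chi> P \<and> (\<forall>j<n. mpoly_subst k n g (h j) = k.indexed_var j)" if \<chi>: "\<chi> \<in> A" for \<chi>
  proof -
    interpret \<chi>: ring_hom_cring R k \<chi> by (rule hom[OF \<chi>])
    have I0: "\<chi> x = \<zero>\<^bsub>k\<^esub>" if "x \<in> I" for x
    proof -
      obtain r where "r \<in> carrier R" "x = r \<otimes>\<^bsub>R\<^esub> a" using \<open>x \<in> I\<close> unfolding I_def cgenideal_def by blast
      then show ?thesis using A(2)[OF \<chi>] aR by simp
    qed
    have ker: "\<chi> x = \<zero>\<^bsub>k\<^esub>" if "x \<in> carrier R" "I +>\<^bsub>R\<^esub> x = \<zero>\<^bsub>S\<^esub>" for x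
    proof -
      have "I +>\<^bsub>R\<^esub> x = I" using that(2) unfolding S_def FactRing_def ring.simps .
      then show ?thesis by (rule I0[OF I.rcos_const_imp_mem[OF that(1)]])
    qed
    obtain \<psi> where "\<psi> \<in> ring_hom S k" and \<psi>: "\<And>x. x \<in> carrier R \<Longrightarrow> \<psi> (I +>\<^bsub>R\<^esub> x) = \<chi> x"
      by (rule factor_hom[OF \<pi>.ring_hom_cring_axioms \<chi>.ring_hom_cring_axioms ker, unfolded surj]; (assumption | rule that))
    then interpret \<psi>: ring_hom_cring S k \<psi> by unfold_locales
    define g' where "g' j = mpoly_map \<psi> (g j)" for j
    define h' where "h' j = mpoly_map \<psi> (h j)" for j
    have gj: "g j \<in> mpolys S n" "h j \<in> mpolys S n" if "j < n" for j using gh(1,2) that by auto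
    have "g' \<in> {..<n} \<rightarrow> mpolys k n" "h' \<in> {..<n} \<rightarrow> mpolys k n"
      using \<psi>.map_closed[OF gj(1)] \<psi>.map_closed[OF gj(2)] by (simp_all add: g'_def h'_def)
    moreover have "g' 0 = mpoly_map \<chi> P"
    proof
      fix u :: "nat multiset"
      show "g' 0 u = mpoly_map \<chi> P u"
        using \<psi>[OF R.mpolys_coeff[OF assms(6), of u]] by (simp add: g'_def gh(3) mpoly_map_apply)
    qed
    moreover have "mpoly_subst k n g' (h' j) = k.indexed_var j" if j: "j < n" for j
    proof -
      have "mpoly_subst k n g' (h' j) = mpoly_map \<psi> (mpoly_subst S n g (h j))"
        unfolding g'_def h'_def by (rule \<psi>.map_subst[OF gh(1) gj(2)[OF j], symmetric])
      then show ?thesis unfolding gh(4)[OF j] \<psi>.map_var .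
    qed
    ultimately show ?thesis by blast
  qed
  then show ?thesis
    using coordinate_of_points[OF A(4) assms(5) _ assms(6)] assms(4) by simp
qed

end
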